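(* Let $X,Y$ be complex Banach spaces, $\alpha>-1$, $1<p\le q<\infty$ and $\gamma_0=(n+1+\alpha)\left(\frac1p-\frac1q\right)$. Let $b\in\mathcal{H}(\mathbb{B}_n,\mathcal{L}(\overline{X},Y))$ satisfy $$\int_{\mathbb{B}_n}\frac{\|b(w)\|_{\mathcal{L}(\overline{X},Y)}}{|1-\langle z,w\rangle|^{n+1+\alpha}}\mathrm{d}\nu_\alpha(w)<\infty\ \text{ for every } z\in\mathbb{B}_n,\qquad \int_{\mathbb{B}_n}\|b(z)\|_{\mathcal{L}(\overline{X},Y)}\log\left(\frac1{1-|z|^2}\right)\mathrm{d}\nu_\alpha(z)<\infty.$$ The little Hankel operator $h_b:A^p_\alpha(\mathbb{B}_n,X)\to A^q_\alpha(\mathbb{B}_n,Y)$ is a bounded operator if and only if $b\in\Lambda_{\gamma_0}(\mathbb{B}_n,\mathcal{L}(\overline{X},Y))$. Moreover, $$\|h_b\|_{A^p_\alpha(\mathbb{B}_n,X)\to A^q_\alpha(\mathbb{B}_n,Y)}\simeq\|b\|_{\Lambda_{\gamma_0}(\mathbb{B}_n,\mathcal{L}(\overline{X},Y))}.$$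
   Context: $n\ge1$; $\mathbb{B}_n$ is the open unit ball of $\mathbb{C}^n$, $\langle z,w\rangle=\sum_j z_j\overline{w_j}$. $\mathrm{d}\nu_\alpha(z)=c_\alpha(1-|z|^2)^\alpha\mathrm{d}\nu(z)$, $c_\alpha=\frac{\Gamma(n+\alpha+1)}{n!\Gamma(\alpha+1)}$, where $\nu$ is Lebesgue measure normalized so that $\nu_\alpha$ is a probability measure on $\mathbb{B}_n$. For a complex Banach space $X$: $\mathcal{H}(\mathbb{B}_n,X)$ is the space of $X$-valued holomorphic functions on $\mathbb{B}_n$; $H^\infty(\mathbb{B}_n,X)$ the bounded ones; $A^p_\alpha(\mathbb{B}_n,X)$ those with $\|f\|^p_{p,\alpha,X}=\int_{\mathbb{B}_n}\|f(z)\|_X^p\mathrm{d}\nu_\alpha(z)<\infty$. $H^\infty(\mathbb{B}_n,X)$ is dense in $A^p_\alpha(\mathbb{B}_n,X)$. $X^{\star}$ is the dual of $X$ with scalar multiplication $(\lambda x^{\star})(x)=\overline\lambda x^{\star}(x)$. The complex conjugate of $x\in X$ is the functional $\overline{x}(x^{\star})=\overline{x^{\star}(x)}$ on $X^{\star}$, and $\overline{X}=\{\overline{x}:x\in X\}$ with norm $\|\overline{x}\|=\sup_{\|x^{\star}\|=1}|\overline{x}(x^{\star})|=\|x\|_X$; $\overline{X}$ is a Banach space and $x\mapsto\overline{x}$ is an isometric conjugate-linear bijection. $\mathcal{L}(\overline{X},Y)$ is the Banach space of bounded linear operators $\overline X\to Y$. The little Hankel operator is $h_bf(z)=\int_{\mathbb{B}_n}\frac{b(w)\overline{f(w)}}{(1-\langle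 z,w\rangle)^{n+1+\alpha}}\mathrm{d}\nu_\alpha(w)$ for $f\in H^\infty(\mathbb{B}_n,X)$, $z\in\mathbb{B}_n$ (a conjugate-linear map). It is a bounded operator from $A^p_\alpha(\mathbb{B}_n,X)$ to $A^q_\alpha(\mathbb{B}_n,Y)$ if $\|h_bf\|_{q,\alpha,Y}\le C\|f\|_{p,\alpha,X}$ for all $f\in H^\infty(\mathbb{B}_n,X)$ (it is then extended by density); its norm is the least such $C$. If $f\in\mathcal{H}(\mathbb{B}_n,X)$ has homogeneous expansion $f=\sum_{k\ge0}f_k$ ($f_k$ a homogeneous polynomial of degree $k$ with coefficients in $X$), then $R^{\alpha,t}f=\sum_{k=0}^\infty\frac{\Gamma(n+1+\alpha)\Gamma(n+1+k+\alpha+t)}{\Gamma(n+1+\alpha+t)\Gamma(n+1+k+\alpha)}f_k$. For $\gamma\ge0$, $\Lambda_\gamma(\mathbb{B}_n,X)$ is the space of $f\in\mathcal{H}(\mathbb{B}_n,X)$ such that for some nonnegative integer $k>\gamma$, $\|f\|_{\Lambda_\gamma(\mathbb{B}_n,X)}=\sup_{z\in\mathbb{B}_n}(1-|z|^2)^{k-\gamma}\|R^{\alpha,k}f(z)\|_X<\infty$ (the space is independent of $k>\gamma$; the norm is taken with a fixed such $k$). $A\simeq B$ means $A\le cB$ and $B\le c'A$ with positive constants $c,c'$ independent of $b$. *)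

theory Defs
  imports "HOL-Analysis.Analysis"
begin

section \<open>Complex Banach spaces\<close>

class complex_normed_vector = real_normed_vector +
  fixes scaleC :: "complex \<Rightarrow> 'a \<Rightarrow> 'a"  (infixr \<open>*\<^sub>C\<close> 75)
  assumes scaleC_add_right: "a *\<^sub>C (x + y) = a *\<^sub>C x + a *\<^sub>C y"
    and scaleC_add_left: "(a + b) *\<^sub>C x = a *\<^sub>C x + b *\<^sub>C x"
    and scaleC_scaleC: "a *\<^sub>C (b *\<^sub>C x) = (a * b) *\<^sub>C x"
    and scaleR_scaleC: "r *\<^sub>R x = complex_of_real r *\<^sub>C x"
    and norm_scaleC: "norm (a *\<^sub>C x) = cmod a * norm x"

class complex_banach = complex_normed_vector + complete_space

subclass (in complex_banach) banach ..

instantiation complex :: complex_banach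
begin

definition scaleC_complex :: "complex \<Rightarrow> complex \<Rightarrow> complex"
  where "scaleC_complex c x = c * x"

instance
  by standard (auto simp: scaleC_complex_def algebra_simps norm_mult scaleR_conv_of_real)

end

lemma bounded_linear_scaleC: "bounded_linear (\<lambda>x::'a::complex_normed_vector. c *\<^sub>C x)"
proof (rule bounded_linear_intro[where K = "cmod c"])
  show "c *\<^sub>C (r *\<^sub>R x) = r *\<^sub>R c *\<^sub>C x" for r and x :: 'a
    by (simp add: scaleR_scaleC scaleC_scaleC mult.commute)
qed (simp_all add: scaleC_add_right norm_scaleC mult.commute)

lemma scaleC_zero_right [simp]: "c *\<^sub>C (0::'a::complex_normed_vector) = 0"
  by (rule linear_simps(3)[OF bounded_linear_scaleC])

lemma scaleC_minus_right: "c *\<^sub>C (- x::'a::complex_normed_vector) = - (c *\<^sub>C x)"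
  by (rule linear_simps(4)[OF bounded_linear_scaleC])

lemma scaleC_diff_right: "c *\<^sub>C (x - y::'a::complex_normed_vector) = c *\<^sub>C x - c *\<^sub>C y"
  by (rule linear_simps(2)[OF bounded_linear_scaleC])

lemma scaleC_one [simp]: "1 *\<^sub>C (x::'a::complex_normed_vector) = x"
  by (metis of_real_1 scaleR_one scaleR_scaleC)

subsection \<open>Bounded complex-linear operators\<close>

typedef (overloaded) ('a, 'b) cblinfun =
  "{F :: 'a::complex_normed_vector \<Rightarrow>\<^sub>L 'b::complex_normed_vector.
     \<forall>c x. blinfun_apply F (c *\<^sub>C x) = c *\<^sub>C blinfun_apply F x}"
  morphisms blinfun_of_cblinfun Abs_cblinfun
  by (rule exI[of _ 0]) simp

setup_lifting type_definition_cblinfun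

lift_definition cblinfun_apply :: "('a::complex_normed_vector, 'b::complex_normed_vector) cblinfun \<Rightarrow> 'a \<Rightarrow> 'b"
  is blinfun_apply .

lemma cblinfun_eqI: "(\<And>x. cblinfun_apply F x = cblinfun_apply G x) \<Longrightarrow> F = G"
  by transfer (rule blinfun_eqI)

instantiation cblinfun :: (complex_normed_vector, complex_normed_vector) complex_normed_vector
begin

lift_definition norm_cblinfun :: "('a, 'b) cblinfun \<Rightarrow> real" is norm .

lift_definition zero_cblinfun :: "('a, 'b) cblinfun" is 0
  by simp

lift_definition plus_cblinfun :: "('a, 'b) cblinfun \<Rightarrow> ('a, 'b) cblinfun \<Rightarrow> ('a, 'b) cblinfun" is "(+)"
  by (simp add: blinfun.bilinear_simps scaleC_add_right)

lift_definition minus_cblinfun :: "('a, 'b) cblinfun \<Rightarrow> ('a, 'b) cblinfun \<Rightarrow> ('a, 'b) cblinfun" is "(-)"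
  by (simp add: blinfun.bilinear_simps scaleC_diff_right)

lift_definition uminus_cblinfun :: "('a, 'b) cblinfun \<Rightarrow> ('a, 'b) cblinfun" is uminus
  by (simp add: blinfun.bilinear_simps scaleC_minus_right)

lift_definition scaleR_cblinfun :: "real \<Rightarrow> ('a, 'b) cblinfun \<Rightarrow> ('a, 'b) cblinfun" is "scaleR"
  by (simp add: blinfun.bilinear_simps scaleR_scaleC scaleC_scaleC mult.commute)

lift_definition scaleC_cblinfun :: "complex \<Rightarrow> ('a, 'b) cblinfun \<Rightarrow> ('a, 'b) cblinfun"
  is "\<lambda>c F. Blinfun (\<lambda>x. c *\<^sub>C blinfun_apply F x)"
  by (simp add: bounded_linear_Blinfun_apply scaleC_scaleC mult.commute
      bounded_linear_compose[OF bounded_linear_scaleC blinfun.bounded_linear_right])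

definition dist_cblinfun :: "('a, 'b) cblinfun \<Rightarrow> ('a, 'b) cblinfun \<Rightarrow> real"
  where "dist_cblinfun a b = norm (a - b)"

definition sgn_cblinfun :: "('a, 'b) cblinfun \<Rightarrow> ('a, 'b) cblinfun"
  where "sgn_cblinfun x = inverse (norm x) *\<^sub>R x"

definition [code del]:
  "(uniformity :: (('a, 'b) cblinfun \<times> ('a, 'b) cblinfun) filter) =
    (INF e\<in>{0<..}. principal {(x, y). dist x y < e})"

definition open_cblinfun :: "('a, 'b) cblinfun set \<Rightarrow> bool"
  where [code del]: "open_cblinfun S = (\<forall>x\<in>S. \<forall>\<^sub>F (x', y) in uniformity. x' = x \<longrightarrow> y \<in> S)"

instance
proof
  have BL: "blinfun_apply (Blinfun (\<lambda>x. c *\<^sub>C blinfun_apply F x)) x = c *\<^sub>C blinfun_apply F x"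
    for c x and F :: "'a \<Rightarrow>\<^sub>L 'b"
    by (simp add: bounded_linear_Blinfun_apply
        bounded_linear_compose[OF bounded_linear_scaleC blinfun.bounded_linear_right])
  fix x y z :: "('a, 'b) cblinfun" and r s :: real and a b :: complex
  show "x + y + z = x + (y + z)"
    by transfer (rule add.assoc)
  show "x + y = y + x"
    by transfer (rule add.commute)
  show "0 + x = x" "- x + x = 0" "x - y = x + - y"
    by (transfer, simp)+
  show "r *\<^sub>R (x + y) = r *\<^sub>R x + r *\<^sub>R y"
    by transfer (rule scaleR_add_right)
  show "(r + s) *\<^sub>R x = r *\<^sub>R x + s *\<^sub>R x"
    by transfer (rule scaleR_add_left)
  show "r *\<^sub>R s *\<^sub>R x = (r * s) *\<^sub>R x" "1 *\<^sub>R x = x"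
    by (transfer, simp)+
  show "norm x = 0 \<longleftrightarrow> x = 0"
    by transfer (rule norm_eq_zero)
  show "norm (r *\<^sub>R x) = \<bar>r\<bar> * norm x"
    by transfer (rule norm_scaleR)
  show "norm (x + y) \<le> norm x + norm y"
    by transfer (rule norm_triangle_ineq)
  show "dist x y = norm (x - y)" "sgn x = inverse (norm x) *\<^sub>R x"
    by (simp_all add: dist_cblinfun_def sgn_cblinfun_def)
  show "(uniformity :: (('a, 'b) cblinfun \<times> ('a, 'b) cblinfun) filter) =
      (INF e\<in>{0<..}. principal {(x, y). dist x y < e})"
    by (rule uniformity_cblinfun_def)
  show "open U = (\<forall>x\<in>U. \<forall>\<^sub>F (x', y) in uniformity. x' = x \<longrightarrow> y \<in> U)" for U :: "('a, 'b) cblinfun set"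
    by (rule open_cblinfun_def)
  have sc: "cblinfun_apply (c *\<^sub>C u) v = c *\<^sub>C cblinfun_apply u v" for c v and u :: "('a, 'b) cblinfun"
    by transfer (rule BL)
  have ad: "cblinfun_apply (u + u') v = cblinfun_apply u v + cblinfun_apply u' v" for v and u u' :: "('a, 'b) cblinfun"
    by transfer (rule blinfun.add_left)
  have sR: "cblinfun_apply (t *\<^sub>R u) v = t *\<^sub>R cblinfun_apply u v" for t v and u :: "('a, 'b) cblinfun"
    by transfer (rule blinfun.scaleR_left)
  show "a *\<^sub>C (x + y) = a *\<^sub>C x + a *\<^sub>C y"
    by (rule cblinfun_eqI) (simp only: sc ad scaleC_add_right)
  show "(a + b) *\<^sub>C x = a *\<^sub>C x + b *\<^sub>C x"
    by (rule cblinfun_eqI) (simp only: sc ad scaleC_add_left)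
  show assoc: "c *\<^sub>C d *\<^sub>C u = (c * d) *\<^sub>C u" for c d and u :: "('a, 'b) cblinfun"
    by (rule cblinfun_eqI) (simp only: sc scaleC_scaleC)
  show "r *\<^sub>R x = complex_of_real r *\<^sub>C x"
    by (rule cblinfun_eqI) (simp only: sc sR scaleR_scaleC)
  have le: "norm (c *\<^sub>C u) \<le> cmod c * norm u" for c and u :: "('a, 'b) cblinfun"
    unfolding norm_cblinfun.rep_eq
  proof (rule norm_blinfun_bound)
    fix v
    have "norm (cblinfun_apply u v) \<le> norm (blinfun_of_cblinfun u) * norm v"
      unfolding cblinfun_apply.rep_eq by (rule norm_blinfun)
    then have "cmod c * norm (cblinfun_apply u v) \<le> cmod c * (norm (blinfun_of_cblinfun u) * norm v)"
      by (rule mult_left_mono) simp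
    then show "norm (blinfun_apply (blinfun_of_cblinfun (c *\<^sub>C u)) v)
        \<le> cmod c * norm (blinfun_of_cblinfun u) * norm v"
      unfolding cblinfun_apply.rep_eq[symmetric] sc norm_scaleC mult.assoc .
  qed simp
  show "norm (a *\<^sub>C x) = cmod a * norm x"
  proof (cases "a = 0")
    case True
    have "0 \<le> norm (a *\<^sub>C x)"
      by transfer (rule norm_ge_zero)
    with True le[of a x] show ?thesis
      by simp
  next
    case False
    have "1 *\<^sub>C x = x"
      by (rule cblinfun_eqI) (simp only: sc scaleC_one)
    then have "inverse a *\<^sub>C a *\<^sub>C x = x"
      using False by (simp add: assoc)
    then have "norm x \<le> cmod (inverse a) * norm (a *\<^sub>C x)"
      using le[of "inverse a" "a *\<^sub>C x"] by simp
    then have "cmod a * norm x \<le> norm (a *\<^sub>C x)"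
      using False by (simp add: norm_inverse norm_divide field_simps)
    with le[of a x] show ?thesis by simp
  qed
qed

end

lemma norm_cblinfun: "norm (cblinfun_apply F x) \<le> norm F * norm x"
  by transfer (rule norm_blinfun)

lemma cblinfun_apply_scaleC_left: "cblinfun_apply (c *\<^sub>C F) x = c *\<^sub>C cblinfun_apply F x"
  by transfer (simp add: bounded_linear_Blinfun_apply
      bounded_linear_compose[OF bounded_linear_scaleC blinfun.bounded_linear_right])

lemma cblinfun_apply_scaleC_right: "cblinfun_apply F (c *\<^sub>C x) = c *\<^sub>C cblinfun_apply F x"
  by transfer simp

lemma cblinfun_apply_add_left: "cblinfun_apply (F + G) x = cblinfun_apply F x + cblinfun_apply G x"
  by transfer (simp add: blinfun.bilinear_simps)

lemma cblinfun_apply_add_right: "cblinfun_apply F (x + y) = cblinfun_apply F x + cblinfun_apply F y"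
  by transfer (simp add: blinfun.bilinear_simps)

lemma cblinfun_apply_minus_left: "cblinfun_apply (- F) x = - cblinfun_apply F x"
  by transfer (simp add: blinfun.bilinear_simps)

lemma cblinfun_apply_zero_left: "cblinfun_apply 0 x = 0"
  by transfer simp

lemma ex_cblinfun:
  fixes f :: "'a::complex_normed_vector \<Rightarrow> 'b::complex_normed_vector"
  assumes "\<And>x y. f (x + y) = f x + f y" "\<And>c x. f (c *\<^sub>C x) = c *\<^sub>C f x" "\<And>x. norm (f x) \<le> norm x * K"
  shows "\<exists>F. cblinfun_apply F = f"
proof -
  have "bounded_linear f"
    using assms by (intro bounded_linear_intro[where K = K]) (simp_all add: scaleR_scaleC)
  with assms(2) show ?thesis
    by (intro exI[of _ "Abs_cblinfun (Blinfun f)"])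
      (simp add: cblinfun_apply.rep_eq Abs_cblinfun_inverse bounded_linear_Blinfun_apply)
qed

instance cblinfun :: (complex_normed_vector, complex_banach) complex_banach
proof
  fix X :: "nat \<Rightarrow> ('a, 'b) cblinfun"
  assume "Cauchy X"
  then have "Cauchy (\<lambda>n. blinfun_of_cblinfun (X n))"
    by (simp add: Cauchy_def dist_norm norm_cblinfun.rep_eq minus_cblinfun.rep_eq)
  then obtain L where L: "(\<lambda>n. blinfun_of_cblinfun (X n)) \<longlonglongrightarrow> L"
    using convergent_eq_Cauchy by blast
  have "blinfun_apply L (c *\<^sub>C x) = c *\<^sub>C blinfun_apply L x" for c x
  proof (rule LIMSEQ_unique)
    show "(\<lambda>n. blinfun_apply (blinfun_of_cblinfun (X n)) (c *\<^sub>C x)) \<longlonglongrightarrow> blinfun_apply L (c *\<^sub>C x)"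
      by (intro blinfun.tendsto L tendsto_const)
    have "(\<lambda>n. c *\<^sub>C blinfun_apply (blinfun_of_cblinfun (X n)) x) \<longlonglongrightarrow> c *\<^sub>C blinfun_apply L x"
      by (intro bounded_linear.tendsto[OF bounded_linear_scaleC] blinfun.tendsto L tendsto_const)
    moreover have "blinfun_apply (blinfun_of_cblinfun (X n)) (c *\<^sub>C x) = c *\<^sub>C blinfun_apply (blinfun_of_cblinfun (X n)) x" for n
      using blinfun_of_cblinfun by blast
    ultimately show "(\<lambda>n. blinfun_apply (blinfun_of_cblinfun (X n)) (c *\<^sub>C x)) \<longlonglongrightarrow> c *\<^sub>C blinfun_apply L x"
      by simp
  qed
  then have "blinfun_of_cblinfun (Abs_cblinfun L) = L"
    by (simp add: Abs_cblinfun_inverse)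
  with L have "X \<longlonglongrightarrow> Abs_cblinfun L"
    by (simp add: LIMSEQ_def dist_norm norm_cblinfun.rep_eq minus_cblinfun.rep_eq)
  then show "convergent X"
    by (rule convergentI)
qed

subsection \<open>The dual with conjugated scalar multiplication, and the conjugate space\<close>

typedef (overloaded) 'a cdual = "UNIV :: ('a::complex_normed_vector, complex) cblinfun set"
  morphisms functional_of Abs_cdual
  by simp

setup_lifting type_definition_cdual

instantiation cdual :: (complex_normed_vector) complex_normed_vector
begin

lift_definition norm_cdual :: "'a cdual \<Rightarrow> real" is norm .
lift_definition zero_cdual :: "'a cdual" is 0 .
lift_definition plus_cdual :: "'a cdual \<Rightarrow> 'a cdual \<Rightarrow> 'a cdual" is "(+)" .
lift_definition minus_cdual :: "'a cdual \<Rightarrow> 'a cdual \<Rightarrow> 'a cdual" is "(-)" .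
lift_definition uminus_cdual :: "'a cdual \<Rightarrow> 'a cdual" is uminus .
lift_definition scaleR_cdual :: "real \<Rightarrow> 'a cdual \<Rightarrow> 'a cdual" is scaleR .
lift_definition scaleC_cdual :: "complex \<Rightarrow> 'a cdual \<Rightarrow> 'a cdual" is "\<lambda>c F. cnj c *\<^sub>C F" .

definition dist_cdual :: "'a cdual \<Rightarrow> 'a cdual \<Rightarrow> real"
  where "dist_cdual a b = norm (a - b)"

definition sgn_cdual :: "'a cdual \<Rightarrow> 'a cdual"
  where "sgn_cdual x = inverse (norm x) *\<^sub>R x"

definition [code del]:
  "(uniformity :: ('a cdual \<times> 'a cdual) filter) = (INF e\<in>{0<..}. principal {(x, y). dist x y < e})"

definition open_cdual :: "'a cdual set \<Rightarrow> bool"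
  where [code del]: "open_cdual S = (\<forall>x\<in>S. \<forall>\<^sub>F (x', y) in uniformity. x' = x \<longrightarrow> y \<in> S)"

instance
proof
  fix x y z :: "'a cdual" and r s :: real and a b :: complex
  show "x + y + z = x + (y + z)" "x + y = y + x" "0 + x = x" "- x + x = 0" "x - y = x + - y"
    "r *\<^sub>R (x + y) = r *\<^sub>R x + r *\<^sub>R y" "(r + s) *\<^sub>R x = r *\<^sub>R x + s *\<^sub>R x"
    "r *\<^sub>R s *\<^sub>R x = (r * s) *\<^sub>R x" "1 *\<^sub>R x = x"
    "norm x = 0 \<longleftrightarrow> x = 0" "norm (r *\<^sub>R x) = \<bar>r\<bar> * norm x" "norm (x + y) \<le> norm x + norm y"
    by (transfer, simp add: algebra_simps norm_triangle_ineq)+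
  show "dist x y = norm (x - y)" "sgn x = inverse (norm x) *\<^sub>R x"
    by (simp_all add: dist_cdual_def sgn_cdual_def)
  show "(uniformity :: ('a cdual \<times> 'a cdual) filter) = (INF e\<in>{0<..}. principal {(x, y). dist x y < e})"
    by (rule uniformity_cdual_def)
  show "open U = (\<forall>x\<in>U. \<forall>\<^sub>F (x', y) in uniformity. x' = x \<longrightarrow> y \<in> U)" for U :: "'a cdual set"
    by (rule open_cdual_def)
  show "a *\<^sub>C (x + y) = a *\<^sub>C x + a *\<^sub>C y" "(a + b) *\<^sub>C x = a *\<^sub>C x + b *\<^sub>C x"
    "a *\<^sub>C b *\<^sub>C x = (a * b) *\<^sub>C x" "r *\<^sub>R x = complex_of_real r *\<^sub>C x" "norm (a *\<^sub>C x) = cmod a * norm x"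
    by (transfer, simp add: scaleC_add_right scaleC_add_left scaleC_scaleC scaleR_scaleC norm_scaleC)+
qed

end

definition cdual_apply :: "'a::complex_normed_vector cdual \<Rightarrow> 'a \<Rightarrow> complex"
  where "cdual_apply \<phi> = cblinfun_apply (functional_of \<phi>)"

lemma cdual_apply_scaleC_left: "cdual_apply (c *\<^sub>C \<phi>) x = cnj c * cdual_apply \<phi> x"
  by (simp add: cdual_apply_def scaleC_cdual.rep_eq cblinfun_apply_scaleC_left scaleC_complex_def)

definition is_conjugate_of :: "('a::complex_normed_vector cdual, complex) cblinfun \<Rightarrow> 'a \<Rightarrow> bool"
  where "is_conjugate_of \<Phi> x \<longleftrightarrow> (\<forall>\<phi>. cblinfun_apply \<Phi> \<phi> = cnj (cdual_apply \<phi> x))"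

lemma ex_conjugate: "\<exists>\<Phi>. is_conjugate_of \<Phi> x"
proof -
  have "\<exists>\<Phi>. cblinfun_apply \<Phi> = (\<lambda>\<phi>. cnj (cdual_apply \<phi> x))"
  proof (rule ex_cblinfun)
    fix \<phi> :: "'a cdual"
    show "norm (cnj (cdual_apply \<phi> x)) \<le> norm \<phi> * norm x"
      by (simp add: cdual_apply_def norm_cdual.rep_eq norm_cblinfun)
  qed (simp_all add: cdual_apply_def plus_cdual.rep_eq scaleC_cdual.rep_eq cblinfun_apply_add_left
      cblinfun_apply_scaleC_left scaleC_complex_def)
  then show ?thesis
    unfolding is_conjugate_of_def by metis
qed

lemma is_conjugate_of_unique: "is_conjugate_of \<Phi> x \<Longrightarrow> is_conjugate_of \<Psi> x \<Longrightarrow> \<Phi> = \<Psi>"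
  by (rule cblinfun_eqI) (simp add: is_conjugate_of_def)

lemma is_conjugate_of_add: "is_conjugate_of \<Phi> x \<Longrightarrow> is_conjugate_of \<Psi> y \<Longrightarrow> is_conjugate_of (\<Phi> + \<Psi>) (x + y)"
  by (simp add: is_conjugate_of_def cdual_apply_def cblinfun_apply_add_left cblinfun_apply_add_right)

lemma is_conjugate_of_scaleC: "is_conjugate_of \<Phi> x \<Longrightarrow> is_conjugate_of (c *\<^sub>C \<Phi>) (cnj c *\<^sub>C x)"
  by (simp add: is_conjugate_of_def cdual_apply_def cblinfun_apply_scaleC_left
      cblinfun_apply_scaleC_right scaleC_complex_def)

lemma is_conjugate_of_scaleR: "is_conjugate_of \<Phi> x \<Longrightarrow> is_conjugate_of (r *\<^sub>R \<Phi>) (r *\<^sub>R x)"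
  using is_conjugate_of_scaleC[of \<Phi> x "complex_of_real r"] by (simp add: scaleR_scaleC)

lemma is_conjugate_of_uminus: "is_conjugate_of \<Phi> x \<Longrightarrow> is_conjugate_of (- \<Phi>) (- x)"
  using is_conjugate_of_scaleR[of \<Phi> x "-1"] by simp

lemma is_conjugate_of_diff: "is_conjugate_of \<Phi> x \<Longrightarrow> is_conjugate_of \<Psi> y \<Longrightarrow> is_conjugate_of (\<Phi> - \<Psi>) (x - y)"
  using is_conjugate_of_add[OF _ is_conjugate_of_uminus, of \<Phi> x \<Psi> y] by simp

lemma is_conjugate_of_zero: "is_conjugate_of 0 (0 :: 'a::complex_normed_vector)"
proof -
  obtain \<Phi> where "is_conjugate_of \<Phi> (0::'a)"
    using ex_conjugate by blast
  from is_conjugate_of_scaleR[OF this, of 0] show ?thesis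
    by simp
qed

typedef (overloaded) 'a conj_space =
  "{\<Phi> :: ('a::complex_normed_vector cdual, complex) cblinfun. \<exists>x. is_conjugate_of \<Phi> x}"
  morphisms cblinfun_of_conj Abs_conj_space
  using ex_conjugate by blast

setup_lifting type_definition_conj_space

lift_definition bar :: "'a::complex_normed_vector \<Rightarrow> 'a conj_space"
  is "\<lambda>x. THE \<Phi>. is_conjugate_of \<Phi> x"
proof -
  fix x :: 'a
  obtain \<Phi> where "is_conjugate_of \<Phi> x"
    using ex_conjugate by blast
  then have "is_conjugate_of (THE \<Phi>. is_conjugate_of \<Phi> x) x"
    by (rule theI) (rule is_conjugate_of_unique[OF _ \<open>is_conjugate_of \<Phi> x\<close>])
  then show "\<exists>y. is_conjugate_of (THE \<Phi>. is_conjugate_of \<Phi> x) y" ..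
qed

lemma is_conjugate_of_bar: "is_conjugate_of (cblinfun_of_conj (bar x)) x"
proof -
  obtain \<Phi> where "is_conjugate_of \<Phi> x"
    using ex_conjugate by blast
  then show ?thesis
    unfolding bar.rep_eq by (rule theI) (rule is_conjugate_of_unique[OF _ \<open>is_conjugate_of \<Phi> x\<close>])
qed

lemma bar_apply: "cblinfun_apply (cblinfun_of_conj (bar x)) \<phi> = cnj (cdual_apply \<phi> x)"
  using is_conjugate_of_bar by (auto simp: is_conjugate_of_def)

instantiation conj_space :: (complex_normed_vector) complex_normed_vector
begin

lift_definition norm_conj_space :: "'a conj_space \<Rightarrow> real" is norm .

lift_definition zero_conj_space :: "'a conj_space" is 0
  using is_conjugate_of_zero by blast

lift_definition plus_conj_space :: "'a conj_space \<Rightarrow> 'a conj_space \<Rightarrow> 'a conj_space" is "(+)"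
  using is_conjugate_of_add by blast

lift_definition minus_conj_space :: "'a conj_space \<Rightarrow> 'a conj_space \<Rightarrow> 'a conj_space" is "(-)"
  using is_conjugate_of_diff by blast

lift_definition uminus_conj_space :: "'a conj_space \<Rightarrow> 'a conj_space" is uminus
  using is_conjugate_of_uminus by blast

lift_definition scaleR_conj_space :: "real \<Rightarrow> 'a conj_space \<Rightarrow> 'a conj_space" is scaleR
  using is_conjugate_of_scaleR by blast

lift_definition scaleC_conj_space :: "complex \<Rightarrow> 'a conj_space \<Rightarrow> 'a conj_space" is scaleC
  using is_conjugate_of_scaleC by blast

definition dist_conj_space :: "'a conj_space \<Rightarrow> 'a conj_space \<Rightarrow> real"
  where "dist_conj_space a b = norm (a - b)"

definition sgn_conj_space :: "'a conj_space \<Rightarrow> 'a conj_space"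
  where "sgn_conj_space x = inverse (norm x) *\<^sub>R x"

definition [code del]:
  "(uniformity :: ('a conj_space \<times> 'a conj_space) filter) = (INF e\<in>{0<..}. principal {(x, y). dist x y < e})"

definition open_conj_space :: "'a conj_space set \<Rightarrow> bool"
  where [code del]: "open_conj_space S = (\<forall>x\<in>S. \<forall>\<^sub>F (x', y) in uniformity. x' = x \<longrightarrow> y \<in> S)"

instance
proof
  fix x y z :: "'a conj_space" and r s :: real and a b :: complex
  show "x + y + z = x + (y + z)" "x + y = y + x" "0 + x = x" "- x + x = 0" "x - y = x + - y"
    "r *\<^sub>R (x + y) = r *\<^sub>R x + r *\<^sub>R y" "(r + s) *\<^sub>R x = r *\<^sub>R x + s *\<^sub>R x"
    "r *\<^sub>R s *\<^sub>R x = (r * s) *\<^sub>R x" "1 *\<^sub>R x = x"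
    "norm x = 0 \<longleftrightarrow> x = 0" "norm (r *\<^sub>R x) = \<bar>r\<bar> * norm x" "norm (x + y) \<le> norm x + norm y"
    by (transfer, simp add: algebra_simps norm_triangle_ineq)+
  show "dist x y = norm (x - y)" "sgn x = inverse (norm x) *\<^sub>R x"
    by (simp_all add: dist_conj_space_def sgn_conj_space_def)
  show "(uniformity :: ('a conj_space \<times> 'a conj_space) filter) = (INF e\<in>{0<..}. principal {(x, y). dist x y < e})"
    by (rule uniformity_conj_space_def)
  show "open U = (\<forall>x\<in>U. \<forall>\<^sub>F (x', y) in uniformity. x' = x \<longrightarrow> y \<in> U)" for U :: "'a conj_space set"
    by (rule open_conj_space_def)
  show "a *\<^sub>C (x + y) = a *\<^sub>C x + a *\<^sub>C y" "(a + b) *\<^sub>C x = a *\<^sub>C x + b *\<^sub>C x"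
    "a *\<^sub>C b *\<^sub>C x = (a * b) *\<^sub>C x" "r *\<^sub>R x = complex_of_real r *\<^sub>C x" "norm (a *\<^sub>C x) = cmod a * norm x"
    by (transfer, simp add: scaleC_add_right scaleC_add_left scaleC_scaleC scaleR_scaleC norm_scaleC)+
qed

end

lemma bar_eqI: "is_conjugate_of (cblinfun_of_conj \<Phi>) x \<Longrightarrow> bar x = \<Phi>"
  using is_conjugate_of_unique[OF is_conjugate_of_bar] cblinfun_of_conj_inject by blast

lemma bar_add: "bar (x + y) = bar x + bar y"
  by (rule bar_eqI) (simp add: plus_conj_space.rep_eq is_conjugate_of_add is_conjugate_of_bar)

lemma bar_scaleC: "bar (c *\<^sub>C x) = cnj c *\<^sub>C bar x"
  using is_conjugate_of_scaleC[OF is_conjugate_of_bar, of "cnj c" x]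
  by (intro bar_eqI) (simp add: scaleC_conj_space.rep_eq)

lemma surj_bar: "surj (bar :: 'a::complex_normed_vector \<Rightarrow> 'a conj_space)"
proof -
  have "\<exists>x. \<Phi> = bar x" for \<Phi> :: "'a conj_space"
  proof -
    obtain x where "is_conjugate_of (cblinfun_of_conj \<Phi>) x"
      using cblinfun_of_conj by blast
    then have "cblinfun_of_conj \<Phi> = cblinfun_of_conj (bar x)"
      using is_conjugate_of_bar by (rule is_conjugate_of_unique)
    then show ?thesis
      by (auto simp: cblinfun_of_conj_inject)
  qed
  then show ?thesis
    by (auto simp: surj_def)
qed

section \<open>The Bochner integral in arbitrary Banach spaces\<close>

text \<open>
  The library's \<^const>\<open>has_bochner_integral\<close> requires a second-countable range, that is, a
  separable Banach space. The following is the same definition without that requirement.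
\<close>

definition has_vec_integral :: "'a measure \<Rightarrow> ('a \<Rightarrow> 'b::real_normed_vector) \<Rightarrow> 'b \<Rightarrow> bool"
  where "has_vec_integral M f x \<longleftrightarrow>
    f \<in> borel_measurable M \<and>
    (\<exists>s. (\<forall>i. Bochner_Integration.simple_bochner_integrable M (s i)) \<and>
         (\<lambda>i. \<integral>\<^sup>+w. ennreal (norm (f w - s i w)) \<partial>M) \<longlonglongrightarrow> 0 \<and>
         (\<lambda>i. Bochner_Integration.simple_bochner_integral M (s i)) \<longlonglongrightarrow> x)"

definition vec_integral :: "'a measure \<Rightarrow> ('a \<Rightarrow> 'b::real_normed_vector) \<Rightarrow> 'b"
  where "vec_integral M f = (if \<exists>x. has_vec_integral M f x then THE x. has_vec_integral M f x else 0)"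

lemma has_vec_integral_eq_has_bochner_integral:
  fixes f :: "'a \<Rightarrow> 'b::{real_normed_vector, second_countable_topology}"
  shows "has_vec_integral M f x \<longleftrightarrow> has_bochner_integral M f x"
  unfolding has_vec_integral_def has_bochner_integral.simps by blast

section \<open>Function spaces on the unit ball\<close>

definition hinner :: "complex ^ 'n \<Rightarrow> complex ^ 'n \<Rightarrow> complex"
  where "hinner z w = (\<Sum>j\<in>UNIV. z $ j * cnj (w $ j))"

text \<open>
  The measure lives on the ball alone (its space is the ball), so that values of functions
  outside the ball are irrelevant for measurability as well as for integrals.
\<close>

definition ball_measure :: "real \<Rightarrow> (complex ^ 'n) measure"
  where "ball_measure \<alpha> = density (restrict_space lborel (ball 0 1))
    (\<lambda>z. ennreal (Gamma (real CARD('n) + \<alpha> + 1) / (fact CARD('n) * Gamma (\<alpha> + 1))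
       * (1 - (norm z)\<^sup>2) powr \<alpha> / measure lborel (ball (0 :: complex ^ 'n) 1)))"

definition holomorphic_ball :: "(complex ^ 'n \<Rightarrow> 'a::complex_normed_vector) \<Rightarrow> bool"
  where "holomorphic_ball f \<longleftrightarrow>
    (\<forall>z\<in>ball 0 1. \<exists>f'. (f has_derivative f') (at z) \<and> (\<forall>c v. f' (c *s v) = c *\<^sub>C f' v))"

definition Hinf :: "(complex ^ 'n \<Rightarrow> 'a::complex_normed_vector) set"
  where "Hinf = {f. holomorphic_ball f \<and> bounded (f ` ball 0 1)}"

definition bergman :: "real \<Rightarrow> real \<Rightarrow> (complex ^ 'n \<Rightarrow> 'a::complex_normed_vector) set"
  where "bergman p \<alpha> = {f. holomorphic_ball f \<and> integrable (ball_measure \<alpha>) (\<lambda>z. norm (f z) powr p)}"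

definition bergman_norm :: "real \<Rightarrow> real \<Rightarrow> (complex ^ 'n \<Rightarrow> 'a::complex_normed_vector) \<Rightarrow> real"
  where "bergman_norm p \<alpha> f = (\<integral>z. norm (f z) powr p \<partial>ball_measure \<alpha>) powr (1 / p)"

subsection \<open>Fractional derivatives and Lipschitz spaces\<close>

definition homogeneous_poly :: "nat \<Rightarrow> (complex ^ 'n \<Rightarrow> 'a::complex_normed_vector) \<Rightarrow> bool"
  where "homogeneous_poly k P \<longleftrightarrow>
    (\<exists>a :: ('n \<Rightarrow> nat) \<Rightarrow> 'a. \<forall>z. P z = (\<Sum>m | sum m UNIV = k. (\<Prod>j\<in>UNIV. (z $ j) ^ m j) *\<^sub>C a m))"

definition homogeneous_expansion ::
    "(complex ^ 'n \<Rightarrow> 'a::complex_normed_vector) \<Rightarrow> (nat \<Rightarrow> complex ^ 'n \<Rightarrow> 'a) \<Rightarrow> bool"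
  where "homogeneous_expansion f F \<longleftrightarrow>
    (\<forall>k. homogeneous_poly k (F k)) \<and> (\<forall>z\<in>ball 0 1. (\<lambda>k. F k z) sums f z)"

text \<open>
  The expansion is unique: restricting to complex lines through the origin determines every
  homogeneous part on the ball, hence everywhere.
\<close>

definition homogeneous_part :: "(complex ^ 'n \<Rightarrow> 'a::complex_normed_vector) \<Rightarrow> nat \<Rightarrow> complex ^ 'n \<Rightarrow> 'a"
  where "homogeneous_part f = (THE F. homogeneous_expansion f F)"

definition frac_deriv ::
    "real \<Rightarrow> real \<Rightarrow> (complex ^ 'n \<Rightarrow> 'a::complex_normed_vector) \<Rightarrow> complex ^ 'n \<Rightarrow> 'a"
  where "frac_deriv \<alpha> t f z =
    (\<Sum>k. (Gamma (real CARD('n) + 1 + \<alpha>) * Gamma (real CARD('n) + 1 + real k + \<alpha> + t)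
         / (Gamma (real CARD('n) + 1 + \<alpha> + t) * Gamma (real CARD('n) + 1 + real k + \<alpha>)))
       *\<^sub>R homogeneous_part f k z)"

definition lipschitz_norm ::
    "real \<Rightarrow> real \<Rightarrow> nat \<Rightarrow> (complex ^ 'n \<Rightarrow> 'a::complex_normed_vector) \<Rightarrow> ennreal"
  where "lipschitz_norm \<alpha> \<gamma> k f =
    (SUP z\<in>ball 0 1. ennreal ((1 - (norm z)\<^sup>2) powr (real k - \<gamma>) * norm (frac_deriv \<alpha> (real k) f z)))"

definition lipschitz_space :: "real \<Rightarrow> real \<Rightarrow> (complex ^ 'n \<Rightarrow> 'a::complex_normed_vector) set"
  where "lipschitz_space \<alpha> \<gamma> =
    {f. holomorphic_ball f \<and> (\<exists>k::nat. real k > \<gamma> \<and> lipschitz_norm \<alpha> \<gamma> k f < \<infinity>)}"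

section \<open>Little Hankel operators\<close>

definition admissible_symbol ::
    "real \<Rightarrow> (complex ^ 'n \<Rightarrow> ('x::complex_banach conj_space, 'y::complex_banach) cblinfun) \<Rightarrow> bool"
  where "admissible_symbol \<alpha> b \<longleftrightarrow> holomorphic_ball b \<and>
    (\<forall>z\<in>ball 0 1. integrable (ball_measure \<alpha>)
       (\<lambda>w. norm (b w) / cmod (1 - hinner z w) powr (real CARD('n) + 1 + \<alpha>))) \<and>
    integrable (ball_measure \<alpha>) (\<lambda>z. norm (b z) * ln (1 / (1 - (norm z)\<^sup>2)))"

definition hankel ::
    "real \<Rightarrow> (complex ^ 'n \<Rightarrow> ('x::complex_banach conj_space, 'y::complex_banach) cblinfun)
      \<Rightarrow> (complex ^ 'n \<Rightarrow> 'x) \<Rightarrow> complex ^ 'n \<Rightarrow> 'y"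
  where "hankel \<alpha> b f z = vec_integral (ball_measure \<alpha>)
    (\<lambda>w. (1 / (1 - hinner z w) powr complex_of_real (real CARD('n) + 1 + \<alpha>))
          *\<^sub>C cblinfun_apply (b w) (bar (f w)))"

definition hankel_bound ::
    "real \<Rightarrow> real \<Rightarrow> real \<Rightarrow> (complex ^ 'n \<Rightarrow> ('x::complex_banach conj_space, 'y::complex_banach) cblinfun)
      \<Rightarrow> real \<Rightarrow> bool"
  where "hankel_bound \<alpha> p q b C \<longleftrightarrow> 0 \<le> C \<and>
    (\<forall>f\<in>Hinf. hankel \<alpha> b f \<in> bergman q \<alpha> \<and>
       bergman_norm q \<alpha> (hankel \<alpha> b f) \<le> C * bergman_norm p \<alpha> f)"

definition hankel_bounded ::
    "real \<Rightarrow> real \<Rightarrow> real \<Rightarrow> (complex ^ 'n \<Rightarrow> ('x::complex_banach conj_space, 'y::complex_banach) cblinfun) \<Rightarrow> bool"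
  where "hankel_bounded \<alpha> p q b \<longleftrightarrow> (\<exists>C. hankel_bound \<alpha> p q b C)"

definition hankel_norm ::
    "real \<Rightarrow> real \<Rightarrow> real \<Rightarrow> (complex ^ 'n \<Rightarrow> ('x::complex_banach conj_space, 'y::complex_banach) cblinfun) \<Rightarrow> real"
  where "hankel_norm \<alpha> p q b = Inf {C. hankel_bound \<alpha> p q b C}"

end

theory Submission
  imports Defs "HOL-Complex_Analysis.Complex_Analysis"
begin

text \<open>
  Pairing with unit functionals reduces integrals of operator-valued functions to scalar ones.
  Testing \<open>h\<^sub>b\<close> on \<open>(1 - \<langle>w,z\<rangle>) powr (- m)\<close> and evaluating at \<open>z\<close> gives a fractional derivative of \<open>b\<close>
  of high order \<open>m\<close>; the Forelli--Rudin estimate and the point evaluation estimate bound it,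
  and integration along the radius lowers \<open>m\<close> to any \<open>k > \<gamma>\<^sub>0\<close>. Conversely, under the
  additional weight \<open>(1 - |w|\<^sup>2) powr k\<close> the symbol may be replaced by its fractional derivative,
  so \<open>h\<^sub>b f\<close> is dominated by the positive Bergman projection of \<open>\<parallel>f\<parallel> (1 - |w|\<^sup>2) powr \<gamma>\<^sub>0\<close>. Point
  evaluation bounds this function by a multiple of \<open>\<parallel>f\<parallel> powr (p / q)\<close>, and the projection is bounded on \<open>L\<^sup>q\<close>
  by Schur's test.
\<close>

section \<open>Functionals\<close>

text \<open>The target spaces need not be separable, so measurability and integration of vector
  functions are delicate. A vector integral is therefore handled only through scalar functionals,
  and Hahn--Banach is the tool behind every norm estimate and every identity between vectors. With s
  = n + 1 + \<alpha>, the fractional derivative of order t is the integral of b against the kernel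
  of exponent s + t: the Gamma factors are quotients of binomial coefficients of two kernels. Hence
  derivatives of b, values of the operator on test functions and the reproducing formula belong to
  one family of integrals. The order m is large because the p-th power of a test function must have
  exponent m p > s for the Forelli--Rudin estimate, which k > \<open>\<gamma>\<^sub>0\<close> alone
  does not ensure; the exponents then match through s/q + (m - s/p) = m -
  \<open>\<gamma>\<^sub>0\<close>. Explicit evaluation is confined to the integrals of |<w,e>|^(2k),
  which come from Gaussian integrals. All constants are fixed before b, since the equivalence of
  norms asserts this uniformity.\<close>

definition sublinear :: "('a::real_vector \<Rightarrow> real) \<Rightarrow> bool"
  where "sublinear q \<longleftrightarrow> (\<forall>x y. q (x + y) \<le> q x + q y) \<and> (\<forall>t x. 0 \<le> t \<longrightarrow> q (t *\<^sub>R x) = t * q x)"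

lemma sublinear_zero: "sublinear q \<Longrightarrow> q 0 = 0"
  unfolding sublinear_def by (metis mult_zero_left order_refl scaleR_zero_left)

lemma sublinear_minus: "sublinear q \<Longrightarrow> - q (- x) \<le> q x"
  using sublinear_zero[of q] unfolding sublinear_def by (smt (verit) add.right_inverse)

text \<open>The witness is the infimum over t \<ge> 0 of q (x + t y) - t q y. It is finite because -
  q (- x) is a lower bound, and t = 1 at x = - y gives the last inequality. In effect q is lowered
  until it is odd in the direction y.\<close>

lemma sublinear_slope_ex:
  assumes q: "sublinear (q :: 'a::real_vector \<Rightarrow> real)"
  obtains p where "sublinear p" "\<And>x. p x \<le> q x" "p (- y) \<le> - q y"
proof
  define S where "S x = (\<lambda>t. q (x + t *\<^sub>R y) - t * q y) ` {0..}" for x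
  define p where "p x = Inf (S x)" for x
  have add: "q (x + y) \<le> q x + q y" for x y
    using q by (auto simp: sublinear_def)
  have hom: "0 \<le> t \<Longrightarrow> q (t *\<^sub>R x) = t * q x" for t x
    using q by (auto simp: sublinear_def)
  have low: "- q (- x) \<le> q (x + t *\<^sub>R y) - t * q y" if "0 \<le> t" for x t
    using add[of "x + t *\<^sub>R y" "- x"] hom[OF that, of y] by (simp add: algebra_simps)
  have bdd: "bdd_below (S x)" for x
    unfolding bdd_below_def S_def using low by blast
  have le: "p x \<le> q (x + t *\<^sub>R y) - t * q y" if "0 \<le> t" for x t
    unfolding p_def by (intro cInf_lower bdd) (auto simp: S_def that)
  have ge: "c \<le> p x" if "\<And>t. 0 \<le> t \<Longrightarrow> c \<le> q (x + t *\<^sub>R y) - t * q y" for c x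
    unfolding p_def by (intro cInf_greatest) (auto simp: S_def that)
  show "p x \<le> q x" for x
    using le[of 0 x] by simp
  show "p (- y) \<le> - q y"
    using le[of 1 "- y"] sublinear_zero[OF q] by simp
  have sub: "p (x + z) \<le> p x + p z" for x z
  proof -
    have "p (x + z) - (q (z + u *\<^sub>R y) - u * q y) \<le> p x" if u: "0 \<le> u" for u
    proof (rule ge)
      fix t :: real assume t: "0 \<le> t"
      have "p (x + z) \<le> q ((x + t *\<^sub>R y) + (z + u *\<^sub>R y)) - (t + u) * q y"
        using le[of "t + u" "x + z"] t u by (simp add: algebra_simps)
      also have "\<dots> \<le> q (x + t *\<^sub>R y) + q (z + u *\<^sub>R y) - (t + u) * q y"
        using add by simp
      finally show "p (x + z) - (q (z + u *\<^sub>R y) - u * q y) \<le> q (x + t *\<^sub>R y) - t * q y"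
        by (simp add: algebra_simps)
    qed
    then have "p (x + z) - p x \<le> p z"
      by (intro ge) (smt (verit))
    then show ?thesis by simp
  qed
  have scale_le: "t * p x \<le> p (t *\<^sub>R x)" if t: "0 < t" for t x
  proof (rule ge)
    fix u :: real assume u: "0 \<le> u"
    have "t * p x \<le> t * (q (x + (u / t) *\<^sub>R y) - (u / t) * q y)"
      using t u by (intro mult_left_mono le) auto
    also have "\<dots> = q (t *\<^sub>R (x + (u / t) *\<^sub>R y)) - u * q y"
      using t by (subst hom) (auto simp: field_simps)
    finally show "t * p x \<le> q (t *\<^sub>R x + u *\<^sub>R y) - u * q y"
      using t by (simp add: scaleR_add_right)
  qed
  have scale: "p (t *\<^sub>R x) = t * p x" if t: "0 < t" for t x
  proof (rule antisym[OF _ scale_le[OF t]])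
    have "(1 / t) * p (t *\<^sub>R x) \<le> p ((1 / t) *\<^sub>R t *\<^sub>R x)"
      using t by (intro scale_le) auto
    then show "p (t *\<^sub>R x) \<le> t * p x"
      using t by (simp add: field_simps)
  qed
  have "p 0 = 0"
    using scale[of 2 0] by simp
  then show "sublinear p"
    unfolding sublinear_def using sub scale by (metis less_eq_real_def mult_zero_left scaleR_zero_left)
qed

text \<open>A minimal sublinear functional is linear, so no extension argument is needed.\<close>

lemma sublinear_dominates_linear:
  assumes q: "sublinear (q :: 'a::real_vector \<Rightarrow> real)"
  obtains f where "linear f" "\<And>x. f x \<le> q x"
proof -
  \<comment> \<open>\<open>?P\<close> reverses the pointwise order: the maximal element is a minimal
    sublinear functional below q, and chains need lower bounds. These are pointwise infima, kept
    finite by - q (- x).\<close>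
  let ?A = "{p. sublinear p \<and> p \<le> q}" and ?P = "(\<lambda>p p' :: 'a \<Rightarrow> real. p' \<le> p)"
  have "\<exists>m\<in>?A. \<forall>a\<in>?A. ?P m a \<longrightarrow> a = m"
  proof (rule predicate_Zorn)
    show "partial_order_on ?A (relation_of ?P ?A)"
      by (auto simp: partial_order_on_def preorder_on_def refl_on_def trans_def antisym_def
          relation_of_def)
  next
    fix C assume C: "C \<in> Chains (relation_of ?P ?A)"
    show "\<exists>u\<in>?A. \<forall>a\<in>C. ?P a u"
    proof (cases "C = {}")
      case True
      then show ?thesis using q by auto
    next
      case False
      have CA: "C \<subseteq> ?A" and tot: "\<And>a b. a \<in> C \<Longrightarrow> b \<in> C \<Longrightarrow> a \<le> b \<or> b \<le> a"
        using C by (auto simp: Chains_def relation_of_def)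
      define u where "u x = (INF p\<in>C. p x)" for x
      have low: "- q (- x) \<le> p x" if "p \<in> C" for p x
        using CA that sublinear_minus[of p x] le_funD[of p q "- x"] by fastforce
      have bdd: "bdd_below ((\<lambda>p. p x) ` C)" for x
        using low by (intro bdd_belowI2)
      have le: "u x \<le> p x" if "p \<in> C" for p x
        unfolding u_def by (intro cINF_lower bdd that)
      have ge: "c \<le> u x" if "\<And>p. p \<in> C \<Longrightarrow> c \<le> p x" for c x
        unfolding u_def using False that by (intro cINF_greatest)
      have sub: "u (x + y) \<le> u x + u y" for x y
      proof -
        \<comment> \<open>The chain is totally ordered, so the smaller of p and p' can serve both
          arguments; an infimum of arbitrary sublinear functionals need not be subadditive.\<close>
        have *: "u (x + y) \<le> p x + p' y" if p: "p \<in> C" "p' \<in> C" for p p'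
        proof -
          obtain r where r: "r \<in> C" "r \<le> p" "r \<le> p'"
            using tot[OF p] p by blast
          have "u (x + y) \<le> r x + r y"
            using le[OF r(1), of "x + y"] CA r(1) unfolding sublinear_def by (smt (verit) mem_Collect_eq subsetD)
          then show ?thesis
            using r(2,3) by (smt (verit) le_funD)
        qed
        have "u (x + y) - p' y \<le> u x" if "p' \<in> C" for p'
          using *[OF _ that] by (intro ge) (simp add: algebra_simps)
        then have "u (x + y) - u x \<le> u y"
          by (intro ge) (simp add: algebra_simps)
        then show ?thesis by simp
      qed
      have homC: "p (t *\<^sub>R x) = t * p x" if "p \<in> C" "0 \<le> t" for p t x
        using CA that by (auto simp: sublinear_def)
      have scale_le: "t * u x \<le> u (t *\<^sub>R x)" if "0 < t" for t x
        using that by (intro ge) (simp add: homC le)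
      have scale: "u (t *\<^sub>R x) = t * u x" if t: "0 < t" for t x
        using scale_le[OF t, of x] scale_le[of "1 / t" "t *\<^sub>R x"] t by (simp add: field_simps)
      have "u 0 = 0"
        using scale[of 2 0] by simp
      with sub scale have "sublinear u"
        unfolding sublinear_def by (metis less_eq_real_def mult_zero_left scaleR_zero_left)
      moreover obtain p where p: "p \<in> C"
        using False by blast
      have "u \<le> q"
        using le[OF p] CA p by (auto simp: le_fun_def intro: order_trans)
      ultimately have "u \<in> ?A"
        by simp
      then show ?thesis
        using le by (auto simp: le_fun_def)
    qed
  qed
  then obtain m where m: "sublinear m" "m \<le> q"
    and min: "\<And>a. sublinear a \<Longrightarrow> a \<le> q \<Longrightarrow> a \<le> m \<Longrightarrow> a = m"
    by auto
  \<comment> \<open>Lowering m in the direction y cannot change it, by minimality; hence m is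
    already odd at y. Oddness turns subadditivity into additivity.\<close>
  have neg: "m (- y) = - m y" for y
  proof -
    obtain p where p: "sublinear p" "\<And>x. p x \<le> m x" "p (- y) \<le> - m y"
      using sublinear_slope_ex[OF m(1)] by metis
    then have "p = m"
      using m(2) by (intro min) (auto simp: le_fun_def intro: order_trans)
    then show ?thesis
      using p(3) sublinear_minus[OF m(1), of y] by simp
  qed
  have "linear m"
  proof (rule linearI)
    have sub: "m (x + y) \<le> m x + m y" for x y
      using m(1) by (simp add: sublinear_def)
    show add: "m (x + y) = m x + m y" for x y
      using sub[of x y] sub[of "x + y" "- y"] neg[of y] by simp
    show "m (r *\<^sub>R x) = r *\<^sub>R m x" for r x
    proof (cases "0 \<le> r")
      case True
      then show ?thesis using m(1) by (simp add: sublinear_def)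
    next
      case False
      then have "m ((- r) *\<^sub>R x) = (- r) * m x"
        using m(1) by (simp add: sublinear_def del: scaleR_minus_left)
      then show ?thesis using neg[of "r *\<^sub>R x"] by simp
    qed
  qed
  with m(2) show ?thesis
    using that by (auto simp: le_fun_def)
qed

text \<open>The norm is first lowered in the direction x. Every linear functional below the result
  is at most - norm x at - x, hence at least norm x at x, so no extension from the line through x is
  required.\<close>

lemma norming_real_functional:
  fixes x :: "'a::real_normed_vector"
  obtains f :: "'a \<Rightarrow> real" where "linear f" "\<And>y. f y \<le> norm y" "f x = norm x"
proof -
  have "sublinear (norm :: 'a \<Rightarrow> real)"
    by (simp add: sublinear_def norm_triangle_ineq)
  then obtain p where p: "sublinear p" "\<And>y. p y \<le> norm y" "p (- x) \<le> - norm x"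
    using sublinear_slope_ex[of norm x] by metis
  obtain f where f: "linear f" "\<And>y. f y \<le> p y"
    using sublinear_dominates_linear[OF p(1)] by metis
  have "f x = norm x"
    using f(2)[of x] f(2)[of "- x"] p(2)[of x] p(3) linear_neg[OF f(1), of x] by simp
  then show ?thesis
    using that f p(2) by (meson order_trans)
qed

text \<open>The usual complexification f y - i f (i y) of a real norming functional. The bound on
  its modulus follows from the bound on its real part after y is multiplied by the unimodular c that
  makes the value real and nonnegative.\<close>

lemma norming_functional:
  fixes x :: "'a::complex_normed_vector"
  obtains \<phi> :: "('a, complex) cblinfun"
    where "\<And>y. cmod (cblinfun_apply \<phi> y) \<le> norm y" "cmod (cblinfun_apply \<phi> x) = norm x"
proof -
  obtain f :: "'a \<Rightarrow> real" where f: "linear f" "\<And>y. f y \<le> norm y" "f x = norm x"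
    using norming_real_functional by blast
  define g where "g y = Complex (f y) (- f (\<i> *\<^sub>C y))" for y
  have sc: "f (c *\<^sub>C y) = Re c * f y + Im c * f (\<i> *\<^sub>C y)" for c y
  proof -
    have "c *\<^sub>C y = Re c *\<^sub>R y + Im c *\<^sub>R (\<i> *\<^sub>C y)"
      by (subst complex_eq[of c]) (simp add: scaleC_add_left scaleR_scaleC scaleC_scaleC mult.commute)
    then show ?thesis
      by (simp add: linear_add[OF f(1)] linear_scale[OF f(1)])
  qed
  have add: "g (y + z) = g y + g z" for y z
    by (simp add: g_def scaleC_add_right linear_add[OF f(1)] complex_eq_iff)
  have hom: "g (c *\<^sub>C y) = c *\<^sub>C g y" for c y
    by (simp add: g_def scaleC_scaleC scaleC_complex_def complex_eq_iff sc[of c] sc[of "\<i> * c"])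
  have bound: "cmod (g y) \<le> norm y" for y
  proof (cases "g y = 0")
    case False
    define c where "c = cnj (g y) / cmod (g y)"
    have c: "cmod c = 1" and "c * g y = cmod (g y)"
      using False by (auto simp: c_def norm_divide complex_norm_square[symmetric] power2_eq_square mult.commute)
    then have "cmod (g y) = Re (g (c *\<^sub>C y))"
      by (simp add: hom scaleC_complex_def)
    also have "\<dots> \<le> norm (c *\<^sub>C y)"
      using f(2) by (simp add: g_def)
    finally show ?thesis
      using c by (simp add: norm_scaleC)
  qed simp
  obtain \<phi> where \<phi>: "cblinfun_apply \<phi> = g"
    using ex_cblinfun[of g 1] add hom bound by auto
  have "norm x \<le> cmod (g x)"
    using f(3) complex_Re_le_cmod[of "g x"] by (simp add: g_def)
  then show ?thesis
    using that[of \<phi>] bound \<phi> by (simp add: antisym)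
qed

section \<open>Norms and identities tested by functionals\<close>

lemma cblinfun_norm_le:
  assumes "\<And>x. norm (cblinfun_apply F x) \<le> C * norm x" "0 \<le> C"
  shows "norm F \<le> C"
  using assms by transfer (rule norm_blinfun_bound)

text \<open>This is how norms of vector integrals are estimated below: each functional of norm at
  most one turns the integral into a scalar one, to which ordinary integral inequalities
  apply.\<close>

lemma norm_le_functional:
  fixes x :: "'a::complex_normed_vector"
  assumes "\<And>\<phi>. (\<And>y. cmod (cblinfun_apply \<phi> y) \<le> norm y) \<Longrightarrow> cmod (cblinfun_apply \<phi> x) \<le> B"
  shows "norm x \<le> B"
  using norming_functional[of x] assms by metis

lemma cblinfun_apply_diff_right: "cblinfun_apply F (x - y) = cblinfun_apply F x - cblinfun_apply F y"
  by transfer (simp add: blinfun.bilinear_simps)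

lemma eq_functional:
  fixes x y :: "'a::complex_normed_vector"
  assumes "\<And>\<phi> :: ('a, complex) cblinfun. cblinfun_apply \<phi> x = cblinfun_apply \<phi> y"
  shows "x = y"
proof -
  have "norm (x - y) \<le> 0"
    by (rule norm_le_functional) (simp add: cblinfun_apply_diff_right assms)
  then show ?thesis by simp
qed

text \<open>One inequality is the definition of the operator norm. The other needs norming
  functionals: a functional of norm at most one on the original space is an element of the unit ball
  of \<open>cdual\<close>, on which \<open>bar x\<close> is evaluated.\<close>

lemma norm_bar: "norm (bar x) = norm (x :: 'a::complex_normed_vector)"
proof (rule antisym)
  show "norm (bar x) \<le> norm x"
    unfolding norm_conj_space.rep_eq
    by (rule cblinfun_norm_le) (auto simp: bar_apply cdual_apply_def norm_cdual.rep_eq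
        intro: order_trans[OF norm_cblinfun] simp: mult.commute)
  show "norm x \<le> norm (bar x)"
  proof (rule norm_le_functional)
    fix \<phi> :: "('a, complex) cblinfun"
    assume \<phi>: "\<And>y. cmod (cblinfun_apply \<phi> y) \<le> norm y"
    have 1: "norm (Abs_cdual \<phi>) \<le> 1"
      using cblinfun_norm_le[of \<phi> 1] \<phi> by (simp add: norm_cdual.rep_eq Abs_cdual_inverse)
    have "cmod (cblinfun_apply \<phi> x) = cmod (cblinfun_apply (cblinfun_of_conj (bar x)) (Abs_cdual \<phi>))"
      by (simp add: bar_apply cdual_apply_def Abs_cdual_inverse)
    also have "\<dots> \<le> norm (bar x) * norm (Abs_cdual \<phi>)"
      unfolding norm_conj_space.rep_eq by (rule norm_cblinfun)
    also have "\<dots> \<le> norm (bar x)"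
      using 1 by (simp add: mult_left_le)
    finally show "cmod (cblinfun_apply \<phi> x) \<le> norm (bar x)" .
  qed
qed

lemma bounded_bilinear_cblinfun_apply:
  "bounded_bilinear (cblinfun_apply :: ('a::complex_normed_vector, 'b::complex_normed_vector) cblinfun \<Rightarrow> 'a \<Rightarrow> 'b)"
proof
  show "\<exists>K. \<forall>(F :: ('a, 'b) cblinfun) x. norm (cblinfun_apply F x) \<le> norm F * norm x * K"
    using norm_cblinfun by (intro exI[of _ 1]) auto
qed (simp_all add: cblinfun_apply_add_left cblinfun_apply_add_right scaleR_scaleC
    cblinfun_apply_scaleC_left cblinfun_apply_scaleC_right)

lemma bounded_linear_bar: "bounded_linear (bar :: 'a::complex_normed_vector \<Rightarrow> 'a conj_space)"
  by (rule bounded_linear_intro[where K = 1])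
    (simp_all add: bar_add norm_bar scaleR_scaleC bar_scaleC)

lemma bounded_bilinear_scaleC:
  "bounded_bilinear (scaleC :: complex \<Rightarrow> 'a::complex_normed_vector \<Rightarrow> 'a)"
proof
  show "(r *\<^sub>R c) *\<^sub>C x = r *\<^sub>R c *\<^sub>C x" for r c and x :: 'a
    by (simp only: scaleR_conv_of_real scaleR_scaleC scaleC_scaleC)
  show "c *\<^sub>C r *\<^sub>R x = r *\<^sub>R c *\<^sub>C x" for r c and x :: 'a
    by (simp only: scaleR_scaleC scaleC_scaleC mult.commute)
  show "\<exists>K. \<forall>c (x :: 'a). norm (c *\<^sub>C x) \<le> norm c * norm x * K"
    by (rule exI[of _ 1]) (simp add: norm_scaleC)
qed (simp_all add: scaleC_add_left scaleC_add_right)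

lemmas continuous_on_scaleC = bounded_bilinear.continuous_on[OF bounded_bilinear_scaleC]
lemmas continuous_on_cblinfun_apply = bounded_bilinear.continuous_on[OF bounded_bilinear_cblinfun_apply]
lemmas continuous_on_bar = bounded_linear.continuous_on[OF bounded_linear_bar]

lemma bounded_linear_cblinfun_apply: "bounded_linear (cblinfun_apply F)"
  by (rule bounded_bilinear.bounded_linear_right[OF bounded_bilinear_cblinfun_apply])

section \<open>The Hermitian inner product\<close>

lemma hinner_add_left: "hinner (x + y) w = hinner x w + hinner y w"
  by (simp add: hinner_def distrib_right sum.distrib)

lemma hinner_diff_left: "hinner (x - y) w = hinner x w - hinner y w"
  by (simp add: hinner_def left_diff_distrib sum_subtractf)

lemma hinner_scale_left: "hinner (c *s x) w = c * hinner x w"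
  by (simp add: hinner_def sum_distrib_left mult.assoc)

lemma hinner_commute: "hinner w z = cnj (hinner z w)"
  by (simp add: hinner_def mult.commute)

lemma hinner_add_right: "hinner w (x + y) = hinner w x + hinner w y"
  by (subst (1 2 3) hinner_commute) (simp add: hinner_add_left)

lemma hinner_scale_right: "hinner w (c *s x) = cnj c * hinner w x"
  by (subst (1 2) hinner_commute) (simp add: hinner_scale_left)

lemma hinner_zero [simp]: "hinner 0 w = 0" "hinner w 0 = 0"
  by (simp_all add: hinner_def)

lemma scaleR_eq_scale: "r *\<^sub>R (x :: complex ^ 'n) = complex_of_real r *s x"
  by (simp add: vec_eq_iff scaleR_conv_of_real[symmetric])

lemma hinner_scaleR_left: "hinner (r *\<^sub>R x) w = of_real r * hinner x w"
  by (simp add: scaleR_eq_scale hinner_scale_left)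

lemma inner_eq_Re_hinner: "z \<bullet> w = Re (hinner z w)"
  by (simp add: hinner_def inner_vec_def inner_complex_def)

lemma hinner_self: "hinner w w = of_real ((norm w)\<^sup>2)"
proof -
  have "Im (hinner w w) = 0"
    by (simp add: hinner_def mult.commute)
  moreover have "Re (hinner w w) = (norm w)\<^sup>2"
    using inner_eq_Re_hinner[of w w] by (simp add: power2_norm_eq_inner)
  ultimately show ?thesis by (simp add: complex_eq_iff)
qed

lemma norm_scale_vec: "norm (c *s (z :: complex ^ 'n)) = cmod c * norm z"
  by (simp add: norm_vec_def norm_mult L2_set_right_distrib)

text \<open>Multiplying z by a unimodular number makes the product real and nonnegative, where it
  equals the real inner product and the real Cauchy--Schwarz inequality applies.\<close>

lemma norm_hinner_le: "cmod (hinner z w) \<le> norm z * norm w"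
proof (cases "hinner z w = 0")
  case False
  define c where "c = cnj (hinner z w) / cmod (hinner z w)"
  have c: "cmod c = 1" and "c * hinner z w = cmod (hinner z w)"
    using False by (auto simp: c_def norm_divide complex_norm_square[symmetric] power2_eq_square mult.commute)
  then have "cmod (hinner z w) = (c *s z) \<bullet> w"
    by (simp add: inner_eq_Re_hinner hinner_scale_left)
  also have "\<dots> \<le> norm (c *s z) * norm w"
    by (rule norm_cauchy_schwarz)
  finally show ?thesis
    using c by (simp add: norm_scale_vec)
qed auto

lemma norm_hinner_less_1: "norm z < 1 \<Longrightarrow> norm w < 1 \<Longrightarrow> cmod (hinner z w) < 1"
  using norm_hinner_le[of z w] mult_strict_mono'[of "norm z" 1 "norm w" 1] by simp

lemma continuous_on_hinner [continuous_intros]: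
  "continuous_on S f \<Longrightarrow> continuous_on S g \<Longrightarrow> continuous_on S (\<lambda>x. hinner (f x) (g x))"
  unfolding hinner_def by (intro continuous_intros)

lemma continuous_on_scale_vec [continuous_intros]:
  fixes f :: "'a::topological_space \<Rightarrow> complex" and g :: "'a \<Rightarrow> complex ^ 'n"
  shows "continuous_on S f \<Longrightarrow> continuous_on S g \<Longrightarrow> continuous_on S (\<lambda>x. f x *s g x)"
  unfolding vector_scalar_mult_def by (intro continuous_intros)

section \<open>Invariance and averaging\<close>

lemma nn_integral_lborel_shift:
  fixes f :: "'a::euclidean_space \<Rightarrow> ennreal"
  assumes [measurable]: "f \<in> borel_measurable borel"
  shows "(\<integral>\<^sup>+x. f (a + x) \<partial>lborel) = (\<integral>\<^sup>+x. f x \<partial>lborel)"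
  by (subst (2) lborel_distr_plus[symmetric, of a]) (simp add: nn_integral_distr)

text \<open>
  Uniqueness of Haar measure in disguise: compare a set with the (isometry invariant) unit ball
  by integrating over all translates.
\<close>

lemma distr_lborel_isometry:
  fixes T :: "'a::euclidean_space \<Rightarrow> 'a"
  assumes T: "linear T" and iso: "\<And>x. norm (T x) = norm x"
  shows "distr lborel borel T = lborel"
proof (rule measure_eqI)
  have "inj T"
    by (rule linear_injective_0[THEN iffD2, OF T, rule_format]) (metis iso norm_eq_zero)
  then have "surj T"
    using linear_injective_imp_surjective[OF T] by blast
  then obtain S where S: "\<And>y. T (S y) = y"
    using surj_f_inv_f by metis
  have cont: "continuous_on UNIV T"
    by (rule linear_continuous_on[OF linear_conv_bounded_linear[THEN iffD1, OF T]])
  then have Tm [measurable]: "T \<in> borel_measurable borel"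
    by (rule borel_measurable_continuous_onI)
  fix A assume "A \<in> sets (distr lborel borel T)"
  then have A [measurable]: "A \<in> sets borel" by simp
  define B where "B = ball (0 :: 'a) 1"
  have [measurable]: "B \<in> sets borel" by (simp add: B_def)
  have Bsym: "indicator B (x - y) = (indicator B (y - x) :: ennreal)" for x y
    by (simp add: B_def indicator_def norm_minus_commute)
  have BT: "indicator B (T x) = (indicator B x :: ennreal)" for x
    by (simp add: B_def indicator_def iso)
  have "emeasure (distr lborel borel T) A * emeasure lborel B
      = (\<integral>\<^sup>+x. indicator A (T x) \<partial>lborel) * emeasure lborel B"
  proof -
    have "emeasure (distr lborel borel T) A = (\<integral>\<^sup>+x. indicator A x \<partial>distr lborel borel T)"
      by simp
    also have "\<dots> = (\<integral>\<^sup>+x. indicator A (T x) \<partial>lborel)"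
      by (rule nn_integral_distr) auto
    finally show ?thesis by simp
  qed
  also have "\<dots> = (\<integral>\<^sup>+x. (\<integral>\<^sup>+y. indicator A (T x) * indicator B (T x - y) \<partial>lborel) \<partial>lborel)"
  proof -
    have "(\<integral>\<^sup>+y. indicator B (T x - y) \<partial>lborel) = emeasure lborel B" for x
      using nn_integral_lborel_shift[of "indicator B" "- T x"] by (simp add: Bsym)
    then show ?thesis
      by (simp add: nn_integral_cmult nn_integral_multc)
  qed
  also have "\<dots> = (\<integral>\<^sup>+y. (\<integral>\<^sup>+x. indicator A (T x) * indicator B (T x - y) \<partial>lborel) \<partial>lborel)"
    by (rule lborel_pair.Fubini') measurable
  \<comment> \<open>Translating x by \<open>S y\<close> shifts \<open>T x\<close> by y. The
    translate thus moves from the indicator of the ball to the indicator of A.\<close>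
  also have "\<dots> = (\<integral>\<^sup>+y. (\<integral>\<^sup>+x. indicator A (T x + y) * indicator B (T x) \<partial>lborel) \<partial>lborel)"
  proof (rule nn_integral_cong)
    fix y
    have "T (S y + x) = T x + y" for x
      by (simp add: linear_add[OF T] S)
    then show "(\<integral>\<^sup>+x. indicator A (T x) * indicator B (T x - y) \<partial>lborel)
        = (\<integral>\<^sup>+x. indicator A (T x + y) * indicator B (T x) \<partial>lborel :: ennreal)"
      using nn_integral_lborel_shift[of "\<lambda>x. indicator A (T x) * indicator B (T x - y)" "S y"] by simp
  qed
  also have "\<dots> = (\<integral>\<^sup>+x. (\<integral>\<^sup>+y. indicator A (T x + y) * indicator B (T x) \<partial>lborel) \<partial>lborel)"
    by (rule lborel_pair.Fubini') measurable
  also have "\<dots> = (\<integral>\<^sup>+x. indicator B x * emeasure lborel A \<partial>lborel)"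
    by (simp add: nn_integral_multc BT nn_integral_lborel_shift mult.commute[of "emeasure lborel A"])
  also have "\<dots> = emeasure lborel A * emeasure lborel B"
    by (simp add: nn_integral_multc mult.commute)
  finally have eq: "emeasure (distr lborel borel T) A * emeasure lborel B = emeasure lborel A * emeasure lborel B" .
  have "emeasure lborel B \<noteq> 0" "emeasure lborel B \<noteq> \<infinity>"
    using emeasure_lborel_ball_finite[of "0 :: 'a" 1] content_ball_pos[of 1 "0 :: 'a"]
    unfolding B_def measure_def by auto
  with eq show "emeasure (distr lborel borel T) A = emeasure lborel A"
    by (simp add: ennreal_mult_cancel_left mult.commute[of _ "emeasure lborel B"])
qed simp

text \<open>Fubini on M times the unit interval: every \<open>T t\<close> preserves M, so replacing
  h by its mean along orbits changes no integral. The means are gauge integrals because Cauchy's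
  formula delivers them in that form; continuity along orbits identifies them with Lebesgue
  integrals.\<close>

lemma rotation_average:
  fixes h :: "'a \<Rightarrow> complex" and T :: "real \<Rightarrow> 'a \<Rightarrow> 'a"
  assumes M: "sigma_finite_measure M"
    and T [measurable]: "(\<lambda>(x, t). T t x) \<in> M \<Otimes>\<^sub>M borel \<rightarrow>\<^sub>M M"
    and inv: "\<And>t. distr M M (T t) = M"
    and h: "integrable M h"
    and cont: "\<And>x. x \<in> space M \<Longrightarrow> continuous_on {0..1} (\<lambda>t. h (T t x))"
    and A: "\<And>x. x \<in> space M \<Longrightarrow> ((\<lambda>t. h (T t x)) has_integral A x) {0..1}"
  shows "integrable M A" "(\<integral>x. A x \<partial>M) = (\<integral>x. h x \<partial>M)"
proof -
  have hm [measurable]: "h \<in> borel_measurable M"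
    using h by simp
  define U where "U = restrict_space lborel {0..1::real}"
  have U: "emeasure U (space U) = 1"
    by (simp add: U_def space_restrict_space emeasure_restrict_space)
  interpret U: finite_measure U
    by standard (simp add: U)
  interpret M: sigma_finite_measure M by fact
  interpret pair_sigma_finite M U ..
  have [measurable_cong]: "sets U = sets (restrict_space borel {0..1})"
    unfolding U_def by (rule sets_restrict_space_cong) simp
  have id: "(\<lambda>t. t) \<in> U \<rightarrow>\<^sub>M borel"
    by (rule measurable_ident_sets[THEN measurable_compose, of _ _ "\<lambda>x. x"]) (auto intro: measurable_restrict_space1 simp: U_def)
  have Tm: "(\<lambda>(x, t). T t x) \<in> M \<Otimes>\<^sub>M U \<rightarrow>\<^sub>M M"
    using measurable_compose[OF measurable_Pair[OF measurable_fst measurable_compose[OF measurable_snd id]] T]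
    by (simp add: case_prod_beta)
  have Tt [measurable]: "T t \<in> M \<rightarrow>\<^sub>M M" for t
    using measurable_compose[OF measurable_Pair2' T, of t] by simp
  have fm [measurable]: "(\<lambda>(x, t). h (T t x)) \<in> borel_measurable (M \<Otimes>\<^sub>M U)"
    using measurable_compose[OF Tm hm] by (simp add: case_prod_beta')
  have fm': "(\<lambda>(x, t). ennreal (norm (h (T t x)))) \<in> borel_measurable (M \<Otimes>\<^sub>M U)"
    using measurable_compose[OF fm, of "\<lambda>z. ennreal (norm z)"] by (simp add: case_prod_beta')
  have f: "integrable (M \<Otimes>\<^sub>M U) (\<lambda>(x, t). h (T t x))"
  proof (rule integrableI_bounded[OF fm])
    have "(\<integral>\<^sup>+x. ennreal (norm (h (T t x))) \<partial>M) = (\<integral>\<^sup>+x. ennreal (norm (h x)) \<partial>M)" for t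
      by (subst (2) inv[of t, symmetric]) (simp add: nn_integral_distr)
    then have "(\<integral>\<^sup>+p. ennreal (norm (case p of (x, t) \<Rightarrow> h (T t x))) \<partial>(M \<Otimes>\<^sub>M U))
        = (\<integral>\<^sup>+t. (\<integral>\<^sup>+x. ennreal (norm (h x)) \<partial>M) \<partial>U)"
      using nn_integral_snd[OF fm'] by (simp add: case_prod_beta')
    also have "\<dots> = (\<integral>\<^sup>+x. ennreal (norm (h x)) \<partial>M)"
      by (simp add: U)
    also have "\<dots> < \<infinity>"
      using h by (simp add: integrable_iff_bounded)
    finally show "(\<integral>\<^sup>+p. ennreal (norm (case p of (x, t) \<Rightarrow> h (T t x))) \<partial>(M \<Otimes>\<^sub>M U)) < \<infinity>" .
  qed
  have Aeq: "(\<integral>t. h (T t x) \<partial>U) = A x" if x: "x \<in> space M" for x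
  proof -
    have s: "set_integrable lborel {0..1} (\<lambda>t. h (T t x))"
      by (rule borel_integrable_atLeastAtMost'[OF cont[OF x]])
    have "(\<integral>t. h (T t x) \<partial>U) = (LINT t:{0..1}|lborel. h (T t x))"
      by (simp add: U_def integral_restrict_space set_lebesgue_integral_def)
    also have "\<dots> = A x"
      using set_borel_integral_eq_integral(2)[OF s] A[OF x] by (simp add: integral_unique)
    finally show ?thesis .
  qed
  have f': "integrable M (\<lambda>x. \<integral>t. h (T t x) \<partial>U)"
    using integrable_fst[OF f] by simp
  have "integrable M (\<lambda>x. \<integral>t. h (T t x) \<partial>U) \<longleftrightarrow> integrable M A"
    by (rule Bochner_Integration.integrable_cong) (auto simp: Aeq)
  with f' show "integrable M A"
    by simp
  have "(\<integral>x. A x \<partial>M) = (\<integral>x. (\<integral>t. h (T t x) \<partial>U) \<partial>M)"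
    by (intro Bochner_Integration.integral_cong refl Aeq[symmetric])
  also have "\<dots> = (\<integral>t. (\<integral>x. h (T t x) \<partial>M) \<partial>U)"
    using Fubini_integral[OF f] by simp
  also have "\<dots> = (\<integral>t. (\<integral>x. h x \<partial>M) \<partial>U)"
  proof (rule Bochner_Integration.integral_cong[OF refl])
    show "(\<integral>x. h (T t x) \<partial>M) = (\<integral>x. h x \<partial>M)" for t
      by (subst (2) inv[of t, symmetric]) (simp add: integral_distr)
  qed
  also have "\<dots> = (\<integral>x. h x \<partial>M)"
    by (simp add: measure_def U)
  finally show "(\<integral>x. A x \<partial>M) = (\<integral>x. h x \<partial>M)" .
qed

section \<open>Cauchy's formula on the unit circle, and rotations about a direction\<close>

definition circ :: "real \<Rightarrow> complex"
  where "circ t = cis (2 * pi * t)"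

lemma norm_circ [simp]: "cmod (circ t) = 1"
  by (simp add: circ_def)

lemma circ_nonzero [simp]: "circ t \<noteq> 0"
  by (simp add: circ_def)

lemma circ_cnj: "circ t * cnj (circ t) = 1"
  by (simp add: circ_def cis_mult cis_cnj)

lemma continuous_on_circ [continuous_intros]:
  "continuous_on S f \<Longrightarrow> continuous_on S (\<lambda>x. circ (f x))"
  unfolding circ_def cis_conv_exp by (intro continuous_intros)

text \<open>Cauchy's formula for the k-th derivative at 0. On the circle dw = 2 pi i w dt, and the
  factor w cancels one of the k + 1 powers in the denominator.\<close>

lemma circle_coefficient:
  assumes hol: "G holomorphic_on cball 0 1"
  shows "((\<lambda>t. G (circ t) / circ t ^ k) has_integral (deriv ^^ k) G 0 / fact k) {0..1}"
proof -
  have "((\<lambda>u. G u / (u - 0) ^ Suc k) has_contour_integral (2 * pi * \<i>) / fact k * (deriv ^^ k) G 0) (circlepath 0 1)"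
    by (intro Cauchy_has_contour_integral_higher_derivative_circlepath
        holomorphic_on_imp_continuous_on holomorphic_on_subset[OF hol]) auto
  then have "((\<lambda>t. G (circlepath 0 1 t) / (circlepath 0 1 t - 0) ^ Suc k
      * vector_derivative (circlepath 0 1) (at t within {0..1}))
      has_integral (2 * pi * \<i>) / fact k * (deriv ^^ k) G 0) {0..1}"
    by (simp only: has_contour_integral_def)
  moreover have "circlepath 0 1 t = circ t" for t
    by (simp add: circlepath circ_def cis_conv_exp mult_ac)
  moreover have "exp (2 * of_real pi * \<i> * of_real t) = circ t" for t
    by (simp add: circ_def cis_conv_exp mult_ac)
  ultimately have "((\<lambda>t. G (circ t) / circ t ^ Suc k * (2 * pi * \<i> * circ t))
      has_integral (2 * pi * \<i>) / fact k * (deriv ^^ k) G 0) {0..1}"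
    by (subst (asm) has_integral_cong[where g = "\<lambda>t. G (circ t) / circ t ^ Suc k * (2 * pi * \<i> * circ t)"])
      (simp_all add: vector_derivative_circlepath01)
  then have *: "((\<lambda>t. (1 / (2 * pi * \<i>)) * (G (circ t) / circ t ^ Suc k * (2 * pi * \<i> * circ t)))
      has_integral (1 / (2 * pi * \<i>)) * ((2 * pi * \<i>) / fact k * (deriv ^^ k) G 0)) {0..1}"
    by (rule has_integral_mult_right)
  have cancel: "(1 / a) * (g / c ^ Suc k * (a * c)) = g / c ^ k" "(1 / a) * (a / b * d) = d / b"
    if "a \<noteq> 0" "c \<noteq> 0" for a b c d g :: complex
    using that by simp_all
  have "complex_of_real (2 * pi) * \<i> \<noteq> 0"
    by simp
  note c = cancel[OF this circ_nonzero]
  show ?thesis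
    using * unfolding c .
qed

lemma circle_mean:
  assumes "G holomorphic_on cball 0 1"
  shows "((\<lambda>t. G (circ t)) has_integral G 0) {0..1}"
  using circle_coefficient[OF assms, of 0] by simp

text \<open>For a unit vector e, the unitary map that fixes e and multiplies the orthogonal
  complement of e by \<open>circ t\<close>.\<close>

definition rotate_about :: "complex ^ 'n \<Rightarrow> real \<Rightarrow> complex ^ 'n \<Rightarrow> complex ^ 'n"
  where "rotate_about e t w = hinner w e *s e + circ t *s (w - hinner w e *s e)"

lemma norm_add_orthogonal:
  assumes "hinner x y = 0"
  shows "(norm (x + y))\<^sup>2 = (norm x)\<^sup>2 + (norm y)\<^sup>2"
proof -
  have "hinner y x = 0"
    using assms by (subst hinner_commute) simp
  then have "hinner (x + y) (x + y) = hinner x x + hinner y y"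
    using assms by (simp add: hinner_add_left hinner_add_right)
  then show ?thesis
    unfolding hinner_self by (simp flip: of_real_add add: of_real_eq_iff del: of_real_power)
qed

lemma hinner_projection:
  assumes "norm e = 1"
  shows "hinner (w - hinner w e *s e) e = 0" "hinner e (w - hinner w e *s e) = 0"
proof -
  show *: "hinner (w - hinner w e *s e) e = 0"
    using assms by (simp add: hinner_diff_left hinner_scale_left hinner_self)
  then show "hinner e (w - hinner w e *s e) = 0"
    by (subst hinner_commute) simp
qed

text \<open>Pythagoras for the component along e and its complement. The inequality for the whole
  disc of c keeps a complex disc inside the ball: its centre is the projection of w, and its
  boundary is the orbit of w under \<open>rotate_about\<close>.\<close>

lemma norm_decomposition:
  assumes "norm e = 1" "cmod c \<le> 1"
  shows "norm (hinner w e *s e + c *s (w - hinner w e *s e)) \<le> norm w"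
    "cmod c = 1 \<Longrightarrow> norm (hinner w e *s e + c *s (w - hinner w e *s e)) = norm w"
proof -
  have "hinner (a *s e) (d *s (w - hinner w e *s e)) = 0" for a d
    unfolding hinner_scale_left hinner_scale_right hinner_projection(2)[OF assms(1)] by simp
  then have sq: "(norm (hinner w e *s e + d *s (w - hinner w e *s e)))\<^sup>2
      = (norm (hinner w e *s e))\<^sup>2 + (cmod d * norm (w - hinner w e *s e))\<^sup>2" for d
    by (simp only: norm_add_orthogonal norm_scale_vec[of d])
  have "hinner w e *s e + 1 *s (w - hinner w e *s e) = w"
    by (simp only: vector_smult_lid add_diff_eq add_diff_cancel_left')
  then have w: "(norm w)\<^sup>2 = (norm (hinner w e *s e))\<^sup>2 + (norm (w - hinner w e *s e))\<^sup>2"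
    using sq[of 1] by (simp only: norm_one mult_1)
  show "norm (hinner w e *s e + c *s (w - hinner w e *s e)) = norm w" if "cmod c = 1"
  proof (rule power2_eq_imp_eq)
    show "(norm (hinner w e *s e + c *s (w - hinner w e *s e)))\<^sup>2 = (norm w)\<^sup>2"
      by (simp only: sq w that mult_1)
  qed simp_all
  have "(cmod c * norm (w - hinner w e *s e))\<^sup>2 \<le> (norm (w - hinner w e *s e))\<^sup>2"
    by (intro power_mono mult_left_le_one_le assms norm_ge_zero mult_nonneg_nonneg)
  then have "(norm (hinner w e *s e + c *s (w - hinner w e *s e)))\<^sup>2 \<le> (norm w)\<^sup>2"
    by (simp only: sq w add_le_cancel_left)
  then show "norm (hinner w e *s e + c *s (w - hinner w e *s e)) \<le> norm w"
    by (rule power2_le_imp_le) simp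
qed

lemma linear_scale_vec: "linear (\<lambda>w :: complex ^ 'n. c *s w)"
proof (rule linearI)
  show "c *s r *\<^sub>R x = r *\<^sub>R (c *s x)" for r and x :: "complex ^ 'n"
    unfolding scaleR_eq_scale vector_smult_assoc by (simp only: mult.commute)
qed (rule vector_add_ldistrib)

lemma linear_rotate_about: "linear (rotate_about e t)"
proof (rule linearI)
  fix r x y
  have add: "(a + b) * d + c * (u + v - (a + b) * d) = (a * d + c * (u - a * d)) + (b * d + c * (v - b * d))"
    for a b c d u v :: complex
    by (simp add: ring_distribs)
  have scale: "k * a * d + c * (k * u - k * a * d) = k * (a * d + c * (u - a * d))"
    for a c d u k :: complex
    by (simp add: algebra_simps)
  show "rotate_about e t (x + y) = rotate_about e t x + rotate_about e t y"
    unfolding rotate_about_def hinner_add_left vec_eq_iff vector_add_component vector_minus_component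
      vector_smult_component by (rule allI, rule add)
  show "rotate_about e t (r *\<^sub>R x) = r *\<^sub>R rotate_about e t x"
    unfolding rotate_about_def scaleR_eq_scale hinner_scale_left vec_eq_iff vector_add_component
      vector_minus_component vector_smult_component by (rule allI, rule scale)
qed

lemma norm_rotate_about: "norm e = 1 \<Longrightarrow> norm (rotate_about e t w) = norm w"
  unfolding rotate_about_def by (rule norm_decomposition(2)) auto

section \<open>Gaussian integrals and moments of the weighted measures\<close>

lemma nn_integral_lborel_scale:
  fixes f :: "'a::euclidean_space \<Rightarrow> ennreal"
  assumes [measurable]: "f \<in> borel_measurable borel" and c: "0 < c"
  shows "(\<integral>\<^sup>+x. f x \<partial>lborel) = ennreal (c ^ DIM('a)) * (\<integral>\<^sup>+x. f (c *\<^sub>R x) \<partial>lborel)"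
proof -
  have "(\<integral>\<^sup>+x. f x \<partial>lborel) = (\<integral>\<^sup>+x. f x \<partial>density (distr lborel borel (\<lambda>x. 0 + c *\<^sub>R x)) (\<lambda>_. \<bar>c\<bar> ^ DIM('a)))"
    using c by (subst lborel_affine[of c 0]) auto
  also have "\<dots> = (\<integral>\<^sup>+x. ennreal (c ^ DIM('a)) * f x \<partial>distr lborel borel (\<lambda>x. 0 + c *\<^sub>R x))"
    using c by (subst nn_integral_density) (auto simp: ennreal_power)
  also have "\<dots> = (\<integral>\<^sup>+x. ennreal (c ^ DIM('a)) * f (c *\<^sub>R x) \<partial>lborel)"
    by (subst nn_integral_distr) auto
  also have "\<dots> = ennreal (c ^ DIM('a)) * (\<integral>\<^sup>+x. f (c *\<^sub>R x) \<partial>lborel)"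
    by (rule nn_integral_cmult) auto
  finally show ?thesis .
qed

text \<open>
  Integrate \<open>f w * u powr a * exp (- |w|\<^sup>2 - u)\<close> over \<open>w\<close> and \<open>u > 0\<close>, directly and
  with \<open>t = u + |w|\<^sup>2\<close>, \<open>w = sqrt t * v\<close> as new variables: this replaces polar coordinates.
\<close>

lemma gaussian_integral_eq_ball_integral:
  fixes f :: "complex ^ 'n \<Rightarrow> ennreal"
  assumes [measurable]: "f \<in> borel_measurable borel"
    and hom: "\<And>r w. 0 < r \<Longrightarrow> f (r *\<^sub>R w) = ennreal (r ^ (2 * k)) * f w"
    and a: "-1 < a"
  shows "(\<integral>\<^sup>+w. f w * ennreal (exp (- (norm w)\<^sup>2)) \<partial>lborel) * ennreal (Gamma (a + 1))
    = ennreal (Gamma (real CARD('n) + real k + a + 1))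
      * (\<integral>\<^sup>+w\<in>ball 0 1. f w * ennreal ((1 - (norm w)\<^sup>2) powr a) \<partial>lborel)"
proof -
  define m where "m = real CARD('n) + real k + a"
  have m: "0 < m + 1" using a by (simp add: m_def)
  \<comment> \<open>The power is extended by 0 to the negative half line (and
    \<open>0 powr b\<close> is 0). So u and t run over all of the real line, and passing from u to t
    = u + |w|^2 is a plain translation.\<close>
  define g where "g b x = ennreal (indicator {0..} x * x powr b)" for b x :: real
  have [measurable]: "g b \<in> borel_measurable borel" for b
    unfolding g_def by measurable
  have Gam: "ennreal (Gamma (b + 1)) = (\<integral>\<^sup>+u. g b u * ennreal (exp (- u)) \<partial>lborel)" if "0 < b + 1" for b
    unfolding g_def Gamma_conv_nn_integral_real[OF that]
    by (intro nn_integral_cong) (simp add: ennreal_mult'[symmetric] exp_minus divide_inverse)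
  have gs: "g a (t * x) = ennreal (t powr a) * g a x" if "0 < t" for t x
    using that by (auto simp: g_def ennreal_mult'[symmetric] powr_mult indicator_def zero_le_mult_iff
        not_le mult_less_0_iff)
  define I where "I = (\<integral>\<^sup>+v. f v * g a (1 - (norm v)\<^sup>2) \<partial>lborel)"
  have "(\<integral>\<^sup>+w. f w * ennreal (exp (- (norm w)\<^sup>2)) \<partial>lborel) * ennreal (Gamma (a + 1))
      = (\<integral>\<^sup>+w. (\<integral>\<^sup>+u. f w * (ennreal (exp (- (norm w)\<^sup>2)) * (g a u * ennreal (exp (- u)))) \<partial>lborel) \<partial>lborel)"
  proof -
    have "(\<integral>\<^sup>+w. f w * ennreal (exp (- (norm w)\<^sup>2)) \<partial>lborel) * ennreal (Gamma (a + 1))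
        = (\<integral>\<^sup>+w. f w * ennreal (exp (- (norm w)\<^sup>2)) * ennreal (Gamma (a + 1)) \<partial>lborel)"
      by (rule nn_integral_multc[symmetric]) measurable
    also have "\<dots> = (\<integral>\<^sup>+w. (\<integral>\<^sup>+u. f w * (ennreal (exp (- (norm w)\<^sup>2)) * (g a u * ennreal (exp (- u)))) \<partial>lborel) \<partial>lborel)"
    proof (rule nn_integral_cong)
      fix w
      have "(\<integral>\<^sup>+u. f w * (ennreal (exp (- (norm w)\<^sup>2)) * (g a u * ennreal (exp (- u)))) \<partial>lborel)
        = f w * (ennreal (exp (- (norm w)\<^sup>2)) * (\<integral>\<^sup>+u. g a u * ennreal (exp (- u)) \<partial>lborel))"
        by (subst nn_integral_cmult, measurable, subst nn_integral_cmult, measurable)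
      also have "(\<integral>\<^sup>+u. g a u * ennreal (exp (- u)) \<partial>lborel) = ennreal (Gamma (a + 1))"
        using a by (intro Gam[symmetric]) simp
      finally show "f w * ennreal (exp (- (norm w)\<^sup>2)) * ennreal (Gamma (a + 1))
        = (\<integral>\<^sup>+u. f w * (ennreal (exp (- (norm w)\<^sup>2)) * (g a u * ennreal (exp (- u)))) \<partial>lborel)"
        by (simp only: mult.assoc)
    qed
    finally show ?thesis .
  qed
  also have "\<dots> = (\<integral>\<^sup>+w. (\<integral>\<^sup>+t. f w * (g a (t - (norm w)\<^sup>2) * ennreal (exp (- t))) \<partial>lborel) \<partial>lborel)"
  proof (rule nn_integral_cong)
    fix w :: "complex ^ 'n"
    have "(\<integral>\<^sup>+u. f w * (ennreal (exp (- (norm w)\<^sup>2)) * (g a u * ennreal (exp (- u)))) \<partial>lborel)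
      = (\<integral>\<^sup>+t. f w * (ennreal (exp (- (norm w)\<^sup>2)) * (g a (- (norm w)\<^sup>2 + t)
          * ennreal (exp (- (- (norm w)\<^sup>2 + t))))) \<partial>lborel)"
      by (rule nn_integral_lborel_shift[symmetric]) measurable
    also have "\<dots> = (\<integral>\<^sup>+t. f w * (g a (t - (norm w)\<^sup>2) * ennreal (exp (- t))) \<partial>lborel)"
    proof (rule nn_integral_cong)
      fix t :: real
      have "ennreal (exp (- (norm w)\<^sup>2)) * ennreal (exp (- (- (norm w)\<^sup>2 + t))) = ennreal (exp (- t))"
        by (simp add: ennreal_mult'[symmetric] exp_add[symmetric])
      then show "f w * (ennreal (exp (- (norm w)\<^sup>2)) * (g a (- (norm w)\<^sup>2 + t)
          * ennreal (exp (- (- (norm w)\<^sup>2 + t))))) = f w * (g a (t - (norm w)\<^sup>2) * ennreal (exp (- t)))"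
        by (simp only: uminus_add_conv_diff mult.left_commute[of _ "g a _"])
    qed
    finally show "(\<integral>\<^sup>+u. f w * (ennreal (exp (- (norm w)\<^sup>2)) * (g a u * ennreal (exp (- u)))) \<partial>lborel)
      = (\<integral>\<^sup>+t. f w * (g a (t - (norm w)\<^sup>2) * ennreal (exp (- t))) \<partial>lborel)" .
  qed
  also have "\<dots> = (\<integral>\<^sup>+t. (\<integral>\<^sup>+w. f w * (g a (t - (norm w)\<^sup>2) * ennreal (exp (- t))) \<partial>lborel) \<partial>lborel)"
    by (rule lborel_pair.Fubini') measurable
  \<comment> \<open>Scaling by sqrt t in real dimension 2n contributes t^n, homogeneity of f
    contributes t^k and the weight contributes t powr a; together this is the exponent m. For t
    \<le> 0 both sides vanish.\<close>
  also have "\<dots> = (\<integral>\<^sup>+t. g m t * ennreal (exp (- t)) * I \<partial>lborel)"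
  proof (rule nn_integral_cong)
    fix t :: real
    have "(\<integral>\<^sup>+w. f w * g a (t - (norm w)\<^sup>2) \<partial>lborel) = g m t * I"
    proof (cases "0 < t")
      case True
      have "(\<integral>\<^sup>+w. f w * g a (t - (norm w)\<^sup>2) \<partial>lborel)
          = ennreal (sqrt t ^ DIM(complex ^ 'n)) * (\<integral>\<^sup>+v. f (sqrt t *\<^sub>R v) * g a (t - (norm (sqrt t *\<^sub>R v))\<^sup>2) \<partial>lborel)"
        using True by (intro nn_integral_lborel_scale) auto
      also have "(\<integral>\<^sup>+v. f (sqrt t *\<^sub>R v) * g a (t - (norm (sqrt t *\<^sub>R v))\<^sup>2) \<partial>lborel)
          = (\<integral>\<^sup>+v. ennreal (t ^ k * t powr a) * (f v * g a (1 - (norm v)\<^sup>2)) \<partial>lborel)"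
      proof (rule nn_integral_cong)
        fix v :: "complex ^ 'n"
        have "t - (norm (sqrt t *\<^sub>R v))\<^sup>2 = t * (1 - (norm v)\<^sup>2)"
          using True by (simp add: power_mult_distrib algebra_simps)
        moreover have "sqrt t ^ (2 * k) = t ^ k"
          using True by (simp add: power_mult)
        ultimately show "f (sqrt t *\<^sub>R v) * g a (t - (norm (sqrt t *\<^sub>R v))\<^sup>2)
            = ennreal (t ^ k * t powr a) * (f v * g a (1 - (norm v)\<^sup>2))"
          using True by (simp add: hom gs ennreal_mult' mult_ac)
      qed
      also have "\<dots> = ennreal (t ^ k * t powr a) * I"
        unfolding I_def by (rule nn_integral_cmult) measurable
      also have "sqrt t ^ DIM(complex ^ 'n) = t ^ CARD('n)"
        using True by (simp add: power_mult mult.commute[of _ 2])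
      also have "ennreal (t ^ CARD('n)) * (ennreal (t ^ k * t powr a) * I) = g m t * I"
        using True by (simp add: g_def m_def powr_add powr_realpow mult.assoc[symmetric] ennreal_mult'[symmetric])
      finally show ?thesis .
    next
      case False
      have "g a (t - (norm w)\<^sup>2) = 0" for w :: "complex ^ 'n"
      proof -
        have "t - (norm w)\<^sup>2 = 0 \<or> t - (norm w)\<^sup>2 < 0"
          using False zero_le_power2[of "norm w"] by linarith
        then show ?thesis by (auto simp: g_def indicator_def)
      qed
      moreover have "g m t = 0"
        using False by (cases "t = 0") (auto simp: g_def)
      ultimately show ?thesis by simp
    qed
    then show "(\<integral>\<^sup>+w. f w * (g a (t - (norm w)\<^sup>2) * ennreal (exp (- t))) \<partial>lborel)
        = g m t * ennreal (exp (- t)) * I"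
      by (subst mult.assoc[symmetric], subst nn_integral_multc) (auto simp: mult_ac)
  qed
  also have "\<dots> = ennreal (Gamma (m + 1)) * I"
    using m by (simp add: Gam nn_integral_multc)
  also have "I = (\<integral>\<^sup>+w\<in>ball 0 1. f w * ennreal ((1 - (norm w)\<^sup>2) powr a) \<partial>lborel)"
    unfolding I_def
  proof (rule nn_integral_cong)
    fix w :: "complex ^ 'n"
    consider "norm w < 1" | "norm w = 1" | "1 < norm w" by linarith
    then show "f w * g a (1 - (norm w)\<^sup>2) = f w * ennreal ((1 - (norm w)\<^sup>2) powr a) * indicator (ball 0 1) w"
    proof cases
      case 1
      then have "(norm w)\<^sup>2 \<le> 1" by (simp add: power_le_one)
      with 1 show ?thesis by (simp add: g_def)
    next
      case 3
      then have "1 < (norm w)\<^sup>2" by (simp add: one_less_power)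
      then have "indicator {0..} (1 - (norm w)\<^sup>2) = (0 :: real)" by (simp add: indicator_def)
      with 3 show ?thesis by (simp only: g_def mult_zero_left ennreal_0 mult_zero_right) simp
    qed (simp add: g_def)
  qed
  finally show ?thesis
    by (simp add: m_def)
qed

text \<open>The number pi^n. It is written through the volume of the ball because
  \<open>ball_measure\<close> is normalized by that volume, which then cancels without being
  evaluated.\<close>

definition gaussian_mass :: "'n::finite itself \<Rightarrow> real"
  where "gaussian_mass _ = fact CARD('n) * measure lborel (ball (0 :: complex ^ 'n) 1)"

lemma gaussian_mass_pos: "0 < gaussian_mass TYPE('n::finite)"
  by (simp add: gaussian_mass_def content_ball_pos)

lemma gaussian_mass: "(\<integral>\<^sup>+w. ennreal (exp (- (norm w)\<^sup>2)) \<partial>(lborel :: (complex ^ 'n) measure)) = ennreal (gaussian_mass TYPE('n))"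
proof -
  have "(\<integral>\<^sup>+w. ennreal (exp (- (norm w)\<^sup>2)) \<partial>(lborel :: (complex ^ 'n) measure))
    = ennreal (Gamma (real CARD('n) + 1)) * (\<integral>\<^sup>+w\<in>ball 0 1. ennreal ((1 - (norm w)\<^sup>2) powr 0) \<partial>(lborel :: (complex ^ 'n) measure))"
    using gaussian_integral_eq_ball_integral[of "\<lambda>_ :: complex ^ 'n. 1" 0 0] by simp
  also have "(\<integral>\<^sup>+w\<in>ball 0 1. ennreal ((1 - (norm w)\<^sup>2) powr 0) \<partial>(lborel :: (complex ^ 'n) measure))
      = (\<integral>\<^sup>+w. indicator (ball 0 1) w \<partial>(lborel :: (complex ^ 'n) measure))"
  proof (rule nn_integral_cong)
    fix w :: "complex ^ 'n"
    \<comment> \<open>Since \<open>0 powr 0\<close> is 0, the base must be seen to be nonzero inside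
      the ball before the power with exponent 0 can be replaced by 1.\<close>
    have "norm w < 1 \<Longrightarrow> (norm w)\<^sup>2 \<noteq> 1"
      by (simp add: abs_square_eq_1)
    then show "ennreal ((1 - (norm w)\<^sup>2) powr 0) * indicator (ball 0 1) w = indicator (ball 0 1) w"
      by (auto simp: indicator_def)
  qed
  also have "\<dots> = ennreal (measure lborel (ball (0 :: complex ^ 'n) 1))"
    using emeasure_lborel_ball_finite[of "0 :: complex ^ 'n" 1] by (simp add: emeasure_eq_ennreal_measure)
  finally show ?thesis
    by (simp add: gaussian_mass_def ennreal_mult' Gamma_fact add.commute)
qed

section \<open>Gaussian moments by rotation averages\<close>

lemma continuous_rotation:
  "continuous_on UNIV (\<lambda>(x, t). circ t *s (x :: complex ^ 'n))"
  "continuous_on UNIV (\<lambda>(x, t). rotate_about e t (x :: complex ^ 'n))"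
  unfolding rotate_about_def case_prod_beta by (intro continuous_intros)+

lemma rotation_lborel:
  "(\<lambda>(x, t). circ t *s (x :: complex ^ 'n)) \<in> lborel \<Otimes>\<^sub>M borel \<rightarrow>\<^sub>M lborel"
  "distr lborel lborel (\<lambda>x. circ t *s (x :: complex ^ 'n)) = lborel"
proof -
  show "(\<lambda>(x, t). circ t *s (x :: complex ^ 'n)) \<in> lborel \<Otimes>\<^sub>M borel \<rightarrow>\<^sub>M lborel"
    using borel_measurable_continuous_onI[OF continuous_rotation(1)]
    by (simp add: borel_prod[symmetric] measurable_cong_sets[OF sets_pair_measure_cong[OF sets_lborel refl] refl])
  show "distr lborel lborel (\<lambda>x. circ t *s (x :: complex ^ 'n)) = lborel"
    using distr_lborel_isometry[OF linear_scale_vec, of "circ t"] by (simp add: norm_scale_vec cong: distr_cong)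
qed

text \<open>
  The function \<open>\<lambda>w. hinner w e ^ k * exp (hinner e w)\<close> is integrated against the Gaussian twice:
  translating by \<open>e\<close> and using the mean value property gives the total mass, averaging over
  rotations gives the moment.
\<close>

lemma gaussian_moment:
  fixes e :: "complex ^ 'n"
  assumes e: "norm e = 1"
  shows "(\<integral>\<^sup>+w. ennreal (cmod (hinner w e) ^ (2 * k)) * ennreal (exp (- (norm w)\<^sup>2)) \<partial>lborel)
    = ennreal (fact k * gaussian_mass TYPE('n))"
proof -
  define E where "E w = exp (- (norm w)\<^sup>2)" for w :: "complex ^ 'n"
  have Ec: "continuous_on UNIV E"
    unfolding E_def by (intro continuous_intros)
  define \<Phi> where "\<Phi> w = hinner w e ^ k * exp (hinner e w) * of_real (E w)" for w
  have \<Phi>c: "continuous_on UNIV \<Phi>"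
    unfolding \<Phi>_def using Ec by (intro continuous_intros)
  then have \<Phi>m [measurable]: "\<Phi> \<in> borel_measurable borel"
    by (rule borel_measurable_continuous_onI)
  \<comment> \<open>With x = |w|: x^k \<le> k! exp x from one term of the exponential series, and 2x
    - x^2 \<le> 2 - x^2/2 from (x - 2)^2 \<ge> 0. What remains is a wider Gaussian, of finite
    mass.\<close>
  have bound: "cmod (\<Phi> w) \<le> fact k * exp 2 * exp (- (norm ((1 / sqrt 2) *\<^sub>R w))\<^sup>2)" for w
  proof -
    define x where "x = norm w"
    have h: "cmod (hinner w e) \<le> x" "cmod (hinner e w) \<le> x"
      using norm_hinner_le[of w e] norm_hinner_le[of e w] e by (auto simp: x_def)
    have x0: "0 \<le> x" by (simp add: x_def)
    have "x ^ k / fact k \<le> exp x"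
    proof -
      have "(\<Sum>n\<in>{k}. x ^ n / fact n) \<le> (\<Sum>n. x ^ n / fact n)"
        using x0 by (intro sum_le_suminf summable_exp_generic[of x, unfolded divide_inverse_commute[symmetric]])
          (auto simp: divide_inverse mult.commute intro: summable_exp)
      then show ?thesis
        by (simp add: exp_def divide_inverse mult.commute)
    qed
    then have 1: "x ^ k \<le> fact k * exp x"
      by (simp add: field_simps)
    have 2: "exp (cmod (hinner e w)) \<le> exp x"
      using h by simp
    have "cmod (\<Phi> w) \<le> x ^ k * exp x * exp (- x\<^sup>2)"
    proof -
      have "cmod (\<Phi> w) = cmod (hinner w e) ^ k * cmod (exp (hinner e w)) * exp (- x\<^sup>2)"
        by (simp add: \<Phi>_def E_def x_def norm_mult norm_power)
      also have "\<dots> \<le> x ^ k * exp x * exp (- x\<^sup>2)"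
        using h x0 norm_exp[of "hinner e w"] 2 by (intro mult_mono power_mono) auto
      finally show ?thesis .
    qed
    also have "\<dots> \<le> (fact k * exp x) * exp x * exp (- x\<^sup>2)"
      using 1 by (intro mult_right_mono) auto
    also have "\<dots> = fact k * exp (2 * x - x\<^sup>2)"
      by (simp add: exp_add[symmetric] exp_diff exp_minus exp_double power2_eq_square field_simps)
    also have "\<dots> \<le> fact k * exp (2 - x\<^sup>2 / 2)"
    proof -
      have "0 \<le> (x - 2)\<^sup>2" by simp
      then show ?thesis by (simp add: power2_eq_square algebra_simps)
    qed
    also have "\<dots> = fact k * exp 2 * exp (- (norm ((1 / sqrt 2) *\<^sub>R w))\<^sup>2)"
      by (simp add: x_def exp_add[symmetric] power_mult_distrib power_divide mult.assoc)
    finally show ?thesis .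
  qed
  have int: "integrable lborel \<Phi>"
  proof (rule integrableI_bounded)
    have "(\<integral>\<^sup>+w. ennreal (norm (\<Phi> w)) \<partial>lborel)
        \<le> (\<integral>\<^sup>+w. ennreal (fact k * exp 2) * ennreal (exp (- (norm ((1 / sqrt 2) *\<^sub>R (w :: complex ^ 'n)))\<^sup>2)) \<partial>lborel)"
      using bound by (intro nn_integral_mono) (simp add: ennreal_mult'[symmetric])
    also have "\<dots> = ennreal (fact k * exp 2) * (\<integral>\<^sup>+w. ennreal (exp (- (norm ((1 / sqrt 2) *\<^sub>R (w :: complex ^ 'n)))\<^sup>2)) \<partial>lborel)"
      by (rule nn_integral_cmult) measurable
    also have "\<dots> < \<infinity>"
    proof -
      have "ennreal (gaussian_mass TYPE('n))
          = ennreal ((1 / sqrt 2) ^ DIM(complex ^ 'n)) * (\<integral>\<^sup>+w. ennreal (exp (- (norm ((1 / sqrt 2) *\<^sub>R (w :: complex ^ 'n)))\<^sup>2)) \<partial>lborel)"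
        unfolding gaussian_mass[symmetric] by (rule nn_integral_lborel_scale) auto
      moreover have "(1 / sqrt 2) ^ DIM(complex ^ 'n) > 0"
        by simp
      ultimately have "(\<integral>\<^sup>+w. ennreal (exp (- (norm ((1 / sqrt 2) *\<^sub>R (w :: complex ^ 'n)))\<^sup>2)) \<partial>lborel) < \<infinity>"
        by (metis ennreal_eq_0_iff ennreal_less_top ennreal_mult_eq_top_iff infinity_ennreal_def not_le top.not_eq_extremum)
      then show ?thesis
        by (simp add: ennreal_mult_less_top)
    qed
    finally show "(\<integral>\<^sup>+w. ennreal (norm (\<Phi> w)) \<partial>lborel) < \<infinity>" .
  qed measurable
  have sf: "sigma_finite_measure (lborel :: (complex ^ 'n) measure)" ..
  have Erot: "E (circ t *s w) = E w" for t w
    by (simp add: E_def norm_scale_vec)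

  \<comment> \<open>Along the orbit, with a = <w,e>, the factor <w,e>^k contributes
    \<open>circ t ^ k\<close> and the exponential is the conjugate of exp (a z) on the circle. The
    mean is a^k times the conjugate of the k-th Taylor coefficient a^k / k!.\<close>
  have avg1: "((\<lambda>t. \<Phi> (circ t *s w)) has_integral
      of_real (cmod (hinner w e) ^ (2 * k) / fact k * E w)) {0..1}" for w
  proof -
    define a where "a = hinner w e"
    have hol: "(\<lambda>z. exp (a * z)) holomorphic_on cball 0 1"
      by (intro holomorphic_intros)
    have der: "(deriv ^^ m) (\<lambda>z. exp (a * z)) = (\<lambda>z. a ^ m * exp (a * z))" for m
    proof (induction m)
      case (Suc m)
      have "deriv (\<lambda>z. a ^ m * exp (a * z)) z = a ^ Suc m * exp (a * z)" for z
        by (rule DERIV_imp_deriv) (auto intro!: derivative_eq_intros)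
      then show ?case using Suc by auto
    qed auto
    have "((\<lambda>t. exp (a * circ t) / circ t ^ k) has_integral a ^ k / fact k) {0..1}"
      using circle_coefficient[OF hol, of k] by (simp add: der)
    then have "((\<lambda>t. cnj (exp (a * circ t) / circ t ^ k)) has_integral cnj (a ^ k / fact k)) {0..1}"
      using has_integral_linear[OF _ bounded_linear_cnj, unfolded o_def] by blast
    then have "((\<lambda>t. (a ^ k * of_real (E w)) * cnj (exp (a * circ t) / circ t ^ k)) has_integral
        (a ^ k * of_real (E w)) * cnj (a ^ k / fact k)) {0..1}"
      by (rule has_integral_mult_right)
    moreover have "(a ^ k * of_real (E w)) * cnj (exp (a * circ t) / circ t ^ k) = \<Phi> (circ t *s w)" for t
    proof -
      have "cnj (1 / circ t ^ k) = circ t ^ k"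
      proof -
        have "circ t ^ k * cnj (circ t ^ k) = 1"
          unfolding complex_cnj_power power_mult_distrib[symmetric] circ_cnj by simp
        then show ?thesis
          by (simp add: field_simps)
      qed
      moreover have "cnj (exp (a * circ t)) = exp (hinner e (circ t *s w))"
        by (simp add: a_def exp_cnj hinner_scale_right mult.commute) (metis hinner_commute)
      ultimately show ?thesis
        unfolding \<Phi>_def Erot hinner_scale_left a_def[symmetric]
        by (simp add: power_mult_distrib divide_inverse mult_ac)
    qed
    moreover have "(a ^ k * of_real (E w)) * cnj (a ^ k / fact k) = of_real (cmod a ^ (2 * k) / fact k * E w)"
    proof -
      have "a ^ k * cnj (a ^ k) = of_real (cmod a ^ (2 * k))"
        by (simp only: complex_cnj_power power_mult_distrib[symmetric] complex_norm_square[symmetric]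
            of_real_power power_mult)
      then show ?thesis by (simp add: field_simps)
    qed
    ultimately show ?thesis unfolding a_def by (simp only:)
  qed
  have c1: "continuous_on {0..1} (\<lambda>t. \<Phi> (circ t *s w))" for w
    by (intro continuous_on_compose2[OF \<Phi>c] continuous_intros) auto
  have m1: "integrable lborel (\<lambda>w. complex_of_real (cmod (hinner w e) ^ (2 * k) / fact k * E w))"
    "(\<integral>w. complex_of_real (cmod (hinner w e) ^ (2 * k) / fact k * E w) \<partial>lborel) = (\<integral>w. \<Phi> w \<partial>lborel)"
    by (rule rotation_average[OF sf rotation_lborel int c1 avg1])+

  \<comment> \<open>This is \<Phi> translated by e. Expanding |e + u|^2 cancels the antiholomorphic
    exponential exp <e,u>, so along rotations only a holomorphic function of <u,e> is left, with
    value 1 at the centre.\<close>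
  define \<Psi> where "\<Psi> u = (1 + hinner u e) ^ k * exp (- hinner u e) * of_real (E u)" for u
  have \<Psi>c: "continuous_on UNIV \<Psi>"
    unfolding \<Psi>_def using Ec by (intro continuous_intros)
  have shift: "\<Phi> (e + u) = \<Psi> u" for u
  proof -
    have "(norm (e + u))\<^sup>2 = 1 + (norm u)\<^sup>2 + 2 * Re (hinner u e)"
      using e by (simp add: power2_norm_eq_inner inner_add_left inner_add_right inner_commute[of e u]
          inner_eq_Re_hinner[symmetric] norm_eq_1)
    then have "- 1 - hinner u u - hinner u e - hinner e u = of_real (- (norm (e + u))\<^sup>2)"
      unfolding hinner_self by (subst hinner_commute[of e u]) (simp add: complex_eq_iff)
    then have "of_real (E (e + u)) = exp (- 1 - hinner u u - hinner u e - hinner e u)"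
      by (simp only: E_def exp_of_real)
    then have "exp (hinner e (e + u)) * of_real (E (e + u)) = exp (- hinner u e) * exp (- hinner u u)"
      using e by (simp add: hinner_add_right hinner_self mult_exp_exp algebra_simps)
    also have "exp (- hinner u u) = of_real (E u)"
      by (simp add: E_def hinner_self exp_of_real[symmetric])
    finally show ?thesis
      using e unfolding \<Phi>_def \<Psi>_def by (simp add: hinner_add_left hinner_self mult.assoc)
  qed
  have distr: "distr lborel borel ((+) e) = lborel"
    by (rule lborel_distr_plus)
  have int2: "integrable lborel \<Psi>" and eq2: "(\<integral>w. \<Phi> w \<partial>lborel) = (\<integral>w. \<Psi> w \<partial>lborel)"
  proof -
    have "integrable (distr lborel borel ((+) e)) \<Phi>"
      unfolding distr by (rule int)
    then show "integrable lborel \<Psi>"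
      by (subst (asm) integrable_distr_eq) (auto simp: shift)
    have "(\<integral>w. \<Phi> w \<partial>lborel) = (\<integral>w. \<Phi> w \<partial>distr lborel borel ((+) e))"
      unfolding distr ..
    then show "(\<integral>w. \<Phi> w \<partial>lborel) = (\<integral>w. \<Psi> w \<partial>lborel)"
      by (subst (asm) integral_distr) (auto simp: shift)
  qed
  have avg2: "((\<lambda>t. \<Psi> (circ t *s u)) has_integral of_real (E u)) {0..1}" for u
  proof -
    have "((\<lambda>t. (1 + hinner u e * circ t) ^ k * exp (- (hinner u e * circ t)) * of_real (E u)) has_integral
       (1 + hinner u e * 0) ^ k * exp (- (hinner u e * 0)) * of_real (E u)) {0..1}"
      by (rule circle_mean[where G = "\<lambda>z. (1 + hinner u e * z) ^ k * exp (- (hinner u e * z)) * of_real (E u)"])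
        (auto intro!: holomorphic_intros)
    then show ?thesis
      by (simp add: \<Psi>_def Erot hinner_scale_left mult.commute)
  qed
  have c2: "continuous_on {0..1} (\<lambda>t. \<Psi> (circ t *s w))" for w
    by (intro continuous_on_compose2[OF \<Psi>c] continuous_intros) auto
  have "(\<integral>w. complex_of_real (E w) \<partial>lborel) = (\<integral>w. \<Psi> w \<partial>lborel)"
    by (rule rotation_average(2)[OF sf rotation_lborel int2 c2 avg2])
  then have "complex_of_real (\<integral>w. cmod (hinner w e) ^ (2 * k) / fact k * E w \<partial>lborel) = of_real (\<integral>w. E w \<partial>lborel)"
    by (simp only: integral_complex_of_real[symmetric] m1(2) eq2)
  then have eq: "(\<integral>w. cmod (hinner w e) ^ (2 * k) / fact k * E w \<partial>lborel) = (\<integral>w. E w \<partial>lborel)"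
    by (simp only: of_real_eq_iff)
  have "(\<integral>w. E w \<partial>lborel) = gaussian_mass TYPE('n)"
    using gaussian_mass[where 'n = 'n] gaussian_mass_pos[where 'n = 'n]
    by (intro integral_eq_nn_integral[THEN trans]) (auto simp: E_def)
  moreover have "integrable lborel (\<lambda>w. cmod (hinner w e) ^ (2 * k) / fact k * E w)"
    using m1(1) by (simp only: complex_of_real_integrable_eq)
  ultimately have "(\<integral>\<^sup>+w. ennreal (cmod (hinner w e) ^ (2 * k) / fact k * E w) \<partial>lborel) = ennreal (gaussian_mass TYPE('n))"
    using eq by (subst nn_integral_eq_integral) (auto simp: E_def)
  moreover have "(\<integral>\<^sup>+w. ennreal (cmod (hinner w e) ^ (2 * k)) * ennreal (exp (- (norm w)\<^sup>2)) \<partial>lborel)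
      = (\<integral>\<^sup>+w. ennreal (fact k) * ennreal (cmod (hinner w e) ^ (2 * k) / fact k * E w) \<partial>lborel)"
    by (intro nn_integral_cong) (simp add: ennreal_mult'[symmetric] E_def)
  ultimately show ?thesis
    unfolding E_def
    by (subst (asm) nn_integral_cmult) (auto simp: ennreal_mult' intro!: borel_measurable_continuous_onI continuous_intros)
qed

section \<open>The weighted measures on the ball\<close>

text \<open>The constant c_\<alpha>; the volume of the ball is kept apart because it drops out
  whenever two weights are compared.\<close>

definition weight_const :: "'n::finite itself \<Rightarrow> real \<Rightarrow> real"
  where "weight_const _ \<alpha> = Gamma (real CARD('n) + \<alpha> + 1) / (fact CARD('n) * Gamma (\<alpha> + 1))"

lemma weight_const_pos: "-1 < \<alpha> \<Longrightarrow> 0 < weight_const TYPE('n::finite) \<alpha>"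
  by (simp add: weight_const_def Gamma_real_pos add_pos_pos)

lemma sets_ball_measure: "sets (ball_measure \<alpha> :: (complex ^ 'n) measure) = sets (restrict_space borel (ball 0 1))"
  unfolding ball_measure_def sets_density by (rule sets_restrict_space_cong) simp

lemma space_ball_measure: "space (ball_measure \<alpha> :: (complex ^ 'n) measure) = ball 0 1"
  by (simp add: ball_measure_def space_restrict_space)

lemma borel_measurable_ball_measure:
  "f \<in> borel_measurable (ball_measure \<alpha> :: (complex ^ 'n) measure) \<longleftrightarrow> f \<in> borel_measurable (restrict_space borel (ball 0 1))"
  by (rule measurable_cong_sets[THEN eqset_imp_iff]) (simp_all add: sets_ball_measure)

lemma measurable_ball_continuous:
  "continuous_on (ball 0 1) f \<Longrightarrow> f \<in> borel_measurable (ball_measure \<alpha> :: (complex ^ 'n) measure)"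
  unfolding borel_measurable_ball_measure by (rule borel_measurable_continuous_on_restrict)

lemma measurable_ball_borel:
  "f \<in> borel_measurable borel \<Longrightarrow> f \<in> borel_measurable (ball_measure \<alpha> :: (complex ^ 'n) measure)"
  unfolding borel_measurable_ball_measure by (rule measurable_restrict_space1)

lemma norm_sq_less_1: "norm (w :: 'a::real_normed_vector) < 1 \<Longrightarrow> (norm w)\<^sup>2 < 1"
  by (simp add: power_less_one_iff abs_square_less_1)

lemma nn_integral_ball_measure:
  fixes f :: "complex ^ 'n \<Rightarrow> ennreal"
  assumes f: "f \<in> borel_measurable (ball_measure \<alpha>)" and \<alpha>: "-1 < \<alpha>"
  shows "(\<integral>\<^sup>+w. f w \<partial>ball_measure \<alpha>)
    = ennreal (weight_const TYPE('n) \<alpha> / measure lborel (ball (0 :: complex ^ 'n) 1))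
      * (\<integral>\<^sup>+w\<in>ball 0 1. f w * ennreal ((1 - (norm w)\<^sup>2) powr \<alpha>) \<partial>lborel)"
proof -
  let ?R = "restrict_space lborel (ball (0 :: complex ^ 'n) 1)"
  define c where "c = weight_const TYPE('n) \<alpha> / measure lborel (ball (0 :: complex ^ 'n) 1)"
  have c: "0 \<le> c"
    using weight_const_pos[OF \<alpha>, where 'n = 'n] by (simp add: c_def)
  have R: "f \<in> borel_measurable ?R \<longleftrightarrow> f \<in> borel_measurable (restrict_space borel (ball 0 1))" for f :: "complex ^ 'n \<Rightarrow> ennreal"
    by (rule measurable_cong_sets[THEN eqset_imp_iff]) (auto intro!: sets_restrict_space_cong)
  have fR: "f \<in> borel_measurable ?R"
    using f unfolding borel_measurable_ball_measure R .
  have dR: "(\<lambda>w. ennreal (b * (1 - (norm w)\<^sup>2) powr \<alpha>)) \<in> borel_measurable ?R" for b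
    by (intro measurable_restrict_space1) measurable
  have m: "(\<lambda>w. f w * ennreal ((1 - (norm w)\<^sup>2) powr \<alpha>) * indicator (ball 0 1) w) \<in> borel_measurable lborel"
    using borel_measurable_times_ennreal[OF fR dR[of 1]]
    by (subst (asm) borel_measurable_restrict_space_iff_ennreal) (auto simp: mult_ac)
  have "(ball_measure \<alpha> :: (complex ^ 'n) measure) = density ?R (\<lambda>w. ennreal (c * (1 - (norm w)\<^sup>2) powr \<alpha>))"
    by (simp add: ball_measure_def c_def weight_const_def field_simps)
  then have "(\<integral>\<^sup>+w. f w \<partial>ball_measure \<alpha>) = (\<integral>\<^sup>+w. ennreal (c * (1 - (norm w)\<^sup>2) powr \<alpha>) * f w \<partial>?R)"
    using nn_integral_density[OF dR fR] by simp
  also have "\<dots> = (\<integral>\<^sup>+w. ennreal (c * (1 - (norm w)\<^sup>2) powr \<alpha>) * f w * indicator (ball 0 1) w \<partial>lborel)"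
    by (rule nn_integral_restrict_space) simp
  also have "\<dots> = (\<integral>\<^sup>+w. ennreal c * (f w * ennreal ((1 - (norm w)\<^sup>2) powr \<alpha>) * indicator (ball 0 1) w) \<partial>lborel)"
    using c by (intro nn_integral_cong) (simp add: ennreal_mult mult_ac)
  also have "\<dots> = ennreal c * (\<integral>\<^sup>+w\<in>ball 0 1. f w * ennreal ((1 - (norm w)\<^sup>2) powr \<alpha>) \<partial>lborel)"
    by (rule nn_integral_cmult[OF m])
  finally show ?thesis
    unfolding c_def .
qed

text \<open>Moves a power of 1 - |w|^2 between integrand and measure at the price of a ratio of
  normalizing constants. It serves both to derive weighted kernel estimates and to return from the
  weight \<alpha> + k to \<alpha>.\<close>

lemma nn_integral_ball_measure_shift:
  fixes f :: "complex ^ 'n \<Rightarrow> ennreal"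
  assumes f: "f \<in> borel_measurable (ball_measure \<alpha>)" and \<alpha>: "-1 < \<alpha>" "-1 < \<alpha> + \<delta>"
  shows "(\<integral>\<^sup>+w. f w * ennreal ((1 - (norm w)\<^sup>2) powr \<delta>) \<partial>ball_measure \<alpha>)
    = ennreal (weight_const TYPE('n) \<alpha> / weight_const TYPE('n) (\<alpha> + \<delta>)) * (\<integral>\<^sup>+w. f w \<partial>ball_measure (\<alpha> + \<delta>))"
proof -
  define v where "v = measure lborel (ball (0 :: complex ^ 'n) 1)"
  have v: "0 < v" by (simp add: v_def content_ball_pos)
  note w = weight_const_pos[OF \<alpha>(1), where 'n = 'n] weight_const_pos[OF \<alpha>(2), where 'n = 'n]
  have m: "(\<lambda>w. f w * ennreal ((1 - (norm w)\<^sup>2) powr \<delta>)) \<in> borel_measurable (ball_measure \<alpha>)"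
    by (intro borel_measurable_times_ennreal f measurable_ball_borel) measurable
  have f': "f \<in> borel_measurable (ball_measure (\<alpha> + \<delta>))"
    using f unfolding borel_measurable_ball_measure .
  have "(\<integral>\<^sup>+w\<in>ball 0 1. f w * ennreal ((1 - (norm w)\<^sup>2) powr \<delta>) * ennreal ((1 - (norm w)\<^sup>2) powr \<alpha>) \<partial>lborel)
      = (\<integral>\<^sup>+w\<in>ball 0 1. f w * ennreal ((1 - (norm w)\<^sup>2) powr (\<alpha> + \<delta>)) \<partial>lborel)"
    by (intro nn_integral_cong) (simp add: indicator_def powr_add ennreal_mult' mult_ac)
  then show ?thesis
    unfolding nn_integral_ball_measure[OF m \<alpha>(1)] nn_integral_ball_measure[OF f' \<alpha>(2)] mult.assoc[symmetric]
    using v w by (simp add: v_def[symmetric] ennreal_mult'[symmetric])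
qed

lemma isometry_measurable_ball:
  fixes T :: "real \<Rightarrow> complex ^ 'n \<Rightarrow> complex ^ 'n"
  assumes c: "continuous_on UNIV (\<lambda>(x, t). T t x)" and iso: "\<And>t x. norm (T t x) = norm x"
  shows "(\<lambda>(x, t). T t x) \<in> ball_measure \<alpha> \<Otimes>\<^sub>M borel \<rightarrow>\<^sub>M ball_measure \<alpha>"
proof -
  have b: "(\<lambda>(x, t). T t x) \<in> borel \<Otimes>\<^sub>M borel \<rightarrow>\<^sub>M borel"
    using borel_measurable_continuous_onI[OF c] by (simp add: borel_prod)
  have "(\<lambda>x. x) \<in> ball_measure \<alpha> \<rightarrow>\<^sub>M (borel :: (complex ^ 'n) measure)"
    by (rule measurable_ball_borel) simp
  then have "(\<lambda>p. (fst p, snd p)) \<in> (ball_measure \<alpha> :: (complex ^ 'n) measure) \<Otimes>\<^sub>M (borel :: real measure) \<rightarrow>\<^sub>M borel \<Otimes>\<^sub>M borel"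
    by (intro measurable_Pair measurable_compose[OF measurable_fst] measurable_snd)
  from measurable_compose[OF this b]
  have "(\<lambda>(x, t). T t x) \<in> ball_measure \<alpha> \<Otimes>\<^sub>M borel \<rightarrow>\<^sub>M restrict_space borel (ball 0 1)"
    by (intro measurable_restrict_space2) (auto simp: case_prod_beta' space_pair_measure space_ball_measure iso)
  then show ?thesis
    by (subst measurable_cong_sets[OF refl sets_ball_measure])
qed

text \<open>The density is radial, so the invariance is inherited from Lebesgue measure.\<close>

lemma distr_ball_measure_isometry:
  fixes T :: "complex ^ 'n \<Rightarrow> complex ^ 'n"
  assumes T: "linear T" and iso: "\<And>x. norm (T x) = norm x" and \<alpha>: "-1 < \<alpha>"
  shows "distr (ball_measure \<alpha>) (ball_measure \<alpha>) T = ball_measure \<alpha>"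
proof (rule measure_eqI)
  have cont: "continuous_on UNIV T"
    by (rule linear_continuous_on[OF linear_conv_bounded_linear[THEN iffD1, OF T]])
  have [measurable]: "ball (0 :: complex ^ 'n) 1 \<in> sets borel"
    by simp
  have [measurable]: "T \<in> borel_measurable borel"
    by (rule borel_measurable_continuous_onI[OF cont])
  have "T \<in> ball_measure \<alpha> \<rightarrow>\<^sub>M restrict_space borel (ball 0 1)"
    by (intro measurable_restrict_space2 measurable_ball_borel) (auto simp: space_ball_measure iso)
  then have Tm: "T \<in> ball_measure \<alpha> \<rightarrow>\<^sub>M ball_measure \<alpha>"
    by (subst measurable_cong_sets[OF refl sets_ball_measure])
  fix A assume "A \<in> sets (distr (ball_measure \<alpha>) (ball_measure \<alpha>) T)"
  then have A: "A \<in> sets (ball_measure \<alpha>)" by simp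
  then have [measurable]: "A \<in> sets borel"
    by (auto simp: sets_ball_measure sets_restrict_space_iff)
  have mA: "indicator A \<in> borel_measurable (ball_measure \<alpha>)"
    by (rule measurable_ball_borel) measurable
  have mA': "(\<lambda>w. indicator A (T w)) \<in> borel_measurable (ball_measure \<alpha>)"
    by (rule measurable_ball_borel) measurable
  define F where "F w = (indicator A w * ennreal ((1 - (norm w)\<^sup>2) powr \<alpha>) * indicator (ball 0 1) w :: ennreal)" for w
  have [measurable]: "F \<in> borel_measurable borel"
    unfolding F_def by measurable
  have "(\<integral>\<^sup>+w. F w \<partial>lborel) = (\<integral>\<^sup>+w. F w \<partial>distr lborel borel T)"
    by (simp add: distr_lborel_isometry[OF T iso])
  also have "\<dots> = (\<integral>\<^sup>+w. F (T w) \<partial>lborel)"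
    by (rule nn_integral_distr) auto
  finally have F: "(\<integral>\<^sup>+w. F (T w) \<partial>lborel) = (\<integral>\<^sup>+w. F w \<partial>lborel)" ..
  have FT: "F (T w) = indicator A (T w) * ennreal ((1 - (norm w)\<^sup>2) powr \<alpha>) * indicator (ball 0 1) w" for w
    by (simp add: F_def iso indicator_def)
  have "emeasure (distr (ball_measure \<alpha>) (ball_measure \<alpha>) T) A = (\<integral>\<^sup>+w. indicator A w \<partial>distr (ball_measure \<alpha>) (ball_measure \<alpha>) T)"
    using A by simp
  also have "\<dots> = (\<integral>\<^sup>+w. indicator A (T w) \<partial>ball_measure \<alpha>)"
    using A by (intro nn_integral_distr Tm) simp
  also have "\<dots> = (\<integral>\<^sup>+w. indicator A w \<partial>ball_measure \<alpha>)"
    unfolding nn_integral_ball_measure[OF mA \<alpha>] nn_integral_ball_measure[OF mA' \<alpha>] FT[symmetric] F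
    unfolding F_def ..
  finally show "emeasure (distr (ball_measure \<alpha>) (ball_measure \<alpha>) T) A = emeasure (ball_measure \<alpha>) A"
    using A by simp
qed simp

text \<open>The integrand is homogeneous of degree 2k, so its weighted integral over the ball is its
  Gaussian integral times a quotient of Gamma values; the constants of the measure cancel
  \<open>gaussian_mass\<close>.\<close>

lemma nn_ball_moment:
  fixes e :: "complex ^ 'n"
  assumes e: "norm e = 1" and \<alpha>: "-1 < \<alpha>"
  shows "(\<integral>\<^sup>+w. ennreal (cmod (hinner w e) ^ (2 * k)) \<partial>ball_measure \<alpha>)
    = ennreal (fact k * Gamma (real CARD('n) + 1 + \<alpha>) / Gamma (real CARD('n) + 1 + \<alpha> + real k))"
proof -
  define v where "v = measure lborel (ball (0 :: complex ^ 'n) 1)"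
  define n where "n = real CARD('n)"
  have v: "0 < v" by (simp add: v_def content_ball_pos)
  have hm [measurable]: "(\<lambda>w. ennreal (cmod (hinner w e) ^ (2 * k))) \<in> borel_measurable borel"
    by (intro measurable_compose[OF borel_measurable_continuous_onI measurable_ennreal] continuous_intros)
  have hom: "ennreal (cmod (hinner (r *\<^sub>R w) e) ^ (2 * k)) = ennreal (r ^ (2 * k)) * ennreal (cmod (hinner w e) ^ (2 * k))"
    if "0 < r" for r w
    using that by (simp add: hinner_scaleR_left norm_mult power_mult_distrib ennreal_mult')
  define I where "I = (\<integral>\<^sup>+w\<in>ball 0 1. ennreal (cmod (hinner w e) ^ (2 * k)) * ennreal ((1 - (norm w)\<^sup>2) powr \<alpha>) \<partial>lborel)"
  have pos: "0 < Gamma (n + real k + \<alpha> + 1)" "0 < Gamma (\<alpha> + 1)"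
    using \<alpha> by (simp_all add: n_def Gamma_real_pos)
  have "ennreal (fact k * (fact CARD('n) * v)) * ennreal (Gamma (\<alpha> + 1)) = ennreal (Gamma (n + real k + \<alpha> + 1)) * I"
    using gaussian_integral_eq_ball_integral[OF hm hom \<alpha>] gaussian_moment[OF e, of k]
    by (simp add: gaussian_mass_def v_def I_def n_def)
  then have "ennreal (1 / Gamma (n + real k + \<alpha> + 1)) * (ennreal (Gamma (n + real k + \<alpha> + 1)) * I)
      = ennreal (1 / Gamma (n + real k + \<alpha> + 1)) * (ennreal (fact k * (fact CARD('n) * v)) * ennreal (Gamma (\<alpha> + 1)))"
    by simp
  then have I: "I = ennreal (fact k * (fact CARD('n) * v) * Gamma (\<alpha> + 1) / Gamma (n + real k + \<alpha> + 1))"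
    using pos v by (simp add: mult.assoc[symmetric] ennreal_mult'[symmetric] ennreal_1[symmetric] del: ennreal_1)
      (simp add: mult_ac)
  have "(\<integral>\<^sup>+w. ennreal (cmod (hinner w e) ^ (2 * k)) \<partial>ball_measure \<alpha>) = ennreal (weight_const TYPE('n) \<alpha> / v) * I"
    unfolding I_def v_def by (rule nn_integral_ball_measure[OF measurable_ball_borel \<alpha>]) measurable
  also have "\<dots> = ennreal (weight_const TYPE('n) \<alpha> / v
      * (fact k * (fact CARD('n) * v) * Gamma (\<alpha> + 1) / Gamma (n + real k + \<alpha> + 1)))"
    unfolding I using v pos by (intro ennreal_mult''[symmetric]) simp
  also have "weight_const TYPE('n) \<alpha> / v
      * (fact k * (fact CARD('n) * v) * Gamma (\<alpha> + 1) / Gamma (n + real k + \<alpha> + 1))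
      = fact k * Gamma (n + 1 + \<alpha>) / Gamma (n + 1 + \<alpha> + real k)"
    using v pos by (simp add: weight_const_def n_def[symmetric] field_simps add_ac)
  finally show ?thesis
    by (simp add: n_def)
qed

lemma unit_vector: obtains e :: "complex ^ 'n" where "norm e = 1"
proof -
  define v where "v = ((\<chi> i. 1) :: complex ^ 'n)"
  have "v \<noteq> 0"
    by (simp add: v_def vec_eq_iff)
  then show ?thesis
    by (intro that[of "(1 / norm v) *\<^sub>R v"]) simp
qed

text \<open>Total mass one is the moment of order k = 0.\<close>

lemma emeasure_ball_measure:
  assumes "-1 < \<alpha>"
  shows "emeasure (ball_measure \<alpha> :: (complex ^ 'n) measure) (space (ball_measure \<alpha>)) = 1"
proof -
  obtain e :: "complex ^ 'n" where "norm e = 1"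
    by (rule unit_vector)
  moreover have "0 < real CARD('n) + 1 + \<alpha>"
    using assms by simp
  then have "0 < Gamma (real CARD('n) + 1 + \<alpha>)"
    by (rule Gamma_real_pos)
  then have "Gamma (real CARD('n) + 1 + \<alpha>) \<noteq> 0"
    by (rule less_imp_neq[symmetric])
  ultimately show ?thesis
    using nn_ball_moment[of e \<alpha> 0] assms by simp
qed

lemma finite_ball_measure: "-1 < \<alpha> \<Longrightarrow> finite_measure (ball_measure \<alpha> :: (complex ^ 'n) measure)"
  by (rule finite_measureI) (simp add: emeasure_ball_measure)

lemma sigma_finite_ball_measure: "-1 < \<alpha> \<Longrightarrow> sigma_finite_measure (ball_measure \<alpha> :: (complex ^ 'n) measure)"
  using finite_ball_measure finite_measure.axioms(1) by blast

lemma integrable_ball_bounded: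
  fixes f :: "complex ^ 'n \<Rightarrow> 'b::{banach, second_countable_topology}"
  assumes "-1 < \<alpha>" and "continuous_on (ball 0 1) f" and "\<And>w. norm w < 1 \<Longrightarrow> norm (f w) \<le> B"
  shows "integrable (ball_measure \<alpha>) f"
  using assms by (intro finite_measure.integrable_const_bound[OF finite_ball_measure, where B = B]
      AE_I2 measurable_ball_continuous) (auto simp: space_ball_measure)

lemma integrable_ball_mult_bounded:
  fixes f g :: "complex ^ 'n \<Rightarrow> complex"
  assumes f: "integrable (ball_measure \<alpha>) f" and "continuous_on (ball 0 1) g"
    and g: "\<And>w. norm w < 1 \<Longrightarrow> cmod (g w) \<le> B"
  shows "integrable (ball_measure \<alpha>) (\<lambda>w. f w * g w)"
proof (rule Bochner_Integration.integrable_bound)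
  show "integrable (ball_measure \<alpha>) (\<lambda>w. B * norm (f w))"
    using f by simp
  show "(\<lambda>w. f w * g w) \<in> borel_measurable (ball_measure \<alpha>)"
    by (intro borel_measurable_times borel_measurable_integrable[OF f] measurable_ball_continuous assms(2))
  show "AE w in ball_measure \<alpha>. norm (f w * g w) \<le> norm (B * norm (f w))"
  proof (rule AE_I2)
    fix w assume "w \<in> space (ball_measure \<alpha> :: (complex ^ 'n) measure)"
    then have "cmod (g w) \<le> B" using g by (simp add: space_ball_measure)
    moreover from this have "0 \<le> B" using norm_ge_zero order_trans by blast
    ultimately show "norm (f w * g w) \<le> norm (B * norm (f w))"
      by (simp add: norm_mult abs_mult mult.commute[of B] mult_left_mono)
  qed
qed

lemma ball_moment:
  fixes e :: "complex ^ 'n"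
  assumes e: "norm e = 1" and \<alpha>: "-1 < \<alpha>"
  shows "(\<integral>w. complex_of_real (cmod (hinner w e) ^ (2 * k)) \<partial>ball_measure \<alpha>)
    = of_real (fact k * Gamma (real CARD('n) + 1 + \<alpha>) / Gamma (real CARD('n) + 1 + \<alpha> + real k))"
proof -
  have "0 < Gamma (real CARD('n) + 1 + \<alpha>)" "0 < Gamma (real CARD('n) + 1 + \<alpha> + real k)"
    using \<alpha> by (simp_all add: Gamma_real_pos)
  moreover have "(\<lambda>w. cmod (hinner w e) ^ (2 * k)) \<in> borel_measurable (ball_measure \<alpha>)"
    by (intro measurable_ball_continuous continuous_intros)
  ultimately have "(\<integral>w. cmod (hinner w e) ^ (2 * k) \<partial>ball_measure \<alpha>)
    = fact k * Gamma (real CARD('n) + 1 + \<alpha>) / Gamma (real CARD('n) + 1 + \<alpha> + real k)"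
    by (subst integral_eq_nn_integral) (simp_all add: nn_ball_moment[OF e \<alpha>])
  then show ?thesis
    by (simp only: integral_complex_of_real)
qed

text \<open>Powers of <w,e> of different degrees are orthogonal: the mean over the scalar rotations
  \<open>circ t\<close> extracts the k-th Taylor coefficient of G times |<w,e>|^(2k), and the
  integral of the latter is known.\<close>

lemma moment_coefficient:
  fixes e :: "complex ^ 'n"
  assumes e: "norm e = 1" and \<alpha>: "-1 < \<alpha>" and G: "G holomorphic_on ball 0 1"
    and int: "integrable (ball_measure \<alpha>) (\<lambda>w. G (hinner w e))"
  shows "(\<integral>w. G (hinner w e) * cnj (hinner w e) ^ k \<partial>ball_measure \<alpha>) = (deriv ^^ k) G 0 / fact k
      * of_real (fact k * Gamma (real CARD('n) + 1 + \<alpha>) / Gamma (real CARD('n) + 1 + \<alpha> + real k))"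
proof -
  define h where "h w = G (hinner w e) * cnj (hinner w e) ^ k" for w
  have lt: "cmod (hinner w e) \<le> norm w" for w
    using norm_hinner_le[of w e] e by simp
  have Gc: "continuous_on (ball 0 1) (\<lambda>w. G (hinner w e))"
    using lt by (intro continuous_on_compose2[OF holomorphic_on_imp_continuous_on[OF G]] continuous_intros)
      (auto intro: le_less_trans[OF lt])
  have hc: "continuous_on (ball 0 1) h"
    unfolding h_def by (intro continuous_intros Gc)
  have "cmod (cnj (hinner w e) ^ k) \<le> 1" if "norm w < 1" for w
    using lt[of w] that by (simp add: norm_power power_le_one)
  then have hint: "integrable (ball_measure \<alpha>) h"
    unfolding h_def by (intro integrable_ball_mult_bounded[OF int]) (auto intro!: continuous_intros)
  have avg: "((\<lambda>t. h (circ t *s w)) has_integral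
      (deriv ^^ k) G 0 / fact k * of_real (cmod (hinner w e) ^ (2 * k))) {0..1}"
    if "w \<in> space (ball_measure \<alpha>)" for w
  proof -
    define a where "a = hinner w e"
    have a: "cmod a < 1"
      using that lt[of w] by (simp add: a_def space_ball_measure)
    have az: "a * z \<in> ball 0 1" if "cmod z \<le> 1" for z
      using mult_mono[OF order_refl that, of "cmod a"] a by (simp add: norm_mult)
    have hol: "(\<lambda>z. G (a * z)) holomorphic_on cball 0 1"
      using az by (intro holomorphic_on_compose_gen[OF _ G, unfolded o_def] holomorphic_intros) auto
    have "(deriv ^^ k) (\<lambda>z. G (a * z)) 0 = a ^ k * (deriv ^^ k) G (a * 0)"
      by (rule higher_deriv_compose_linear[OF G, of "ball 0 1"]) (use az in \<open>auto simp: less_imp_le\<close>)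
    then have "((\<lambda>t. G (a * circ t) / circ t ^ k) has_integral a ^ k * (deriv ^^ k) G 0 / fact k) {0..1}"
      using circle_coefficient[OF hol, of k] by simp
    then have "((\<lambda>t. cnj a ^ k * (G (a * circ t) / circ t ^ k)) has_integral
        cnj a ^ k * (a ^ k * (deriv ^^ k) G 0 / fact k)) {0..1}"
      by (rule has_integral_mult_right)
    moreover have "cnj a ^ k * (G (a * circ t) / circ t ^ k) = h (circ t *s w)" for t
    proof -
      have "cnj (circ t) ^ k * circ t ^ k = 1"
        using circ_cnj[of t] by (simp add: power_mult_distrib[symmetric] mult.commute)
      then have "cnj (circ t) ^ k = 1 / circ t ^ k"
        by (simp add: eq_divide_eq)
      then show ?thesis
        by (simp add: h_def hinner_scale_left a_def[symmetric] power_mult_distrib mult_ac)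
    qed
    moreover have "cnj a ^ k * (a ^ k * (deriv ^^ k) G 0 / fact k)
        = (deriv ^^ k) G 0 / fact k * of_real (cmod a ^ (2 * k))"
    proof -
      have "a ^ k * cnj a ^ k = of_real (cmod a ^ (2 * k))"
        by (simp only: power_mult_distrib[symmetric] complex_norm_square[symmetric] of_real_power power_mult)
      then show ?thesis
        by (metis (no_types, lifting) mult.assoc mult.commute times_divide_eq_right)
    qed
    ultimately show ?thesis
      unfolding a_def by (simp only:)
  qed
  have cont: "continuous_on {0..1} (\<lambda>t. h (circ t *s w))" if "w \<in> space (ball_measure \<alpha>)" for w
    using that by (intro continuous_on_compose2[OF hc] continuous_intros)
      (auto simp: norm_scale_vec space_ball_measure)
  have "(\<integral>w. h w \<partial>ball_measure \<alpha>)
      = (\<integral>w. (deriv ^^ k) G 0 / fact k * of_real (cmod (hinner w e) ^ (2 * k)) \<partial>ball_measure \<alpha>)"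
    by (rule rotation_average(2)[OF sigma_finite_ball_measure[OF \<alpha>] isometry_measurable_ball
          distr_ball_measure_isometry[OF linear_scale_vec _ \<alpha>] hint cont avg, symmetric])
      (auto simp: norm_scale_vec continuous_rotation(1))
  also have "\<dots> = (deriv ^^ k) G 0 / fact k * (\<integral>w. of_real (cmod (hinner w e) ^ (2 * k)) \<partial>ball_measure \<alpha>)"
    by (rule integral_mult_right_zero)
  finally show ?thesis
    unfolding h_def ball_moment[OF e \<alpha>] .
qed

section \<open>The kernel and its binomial series\<close>

definition kern :: "real \<Rightarrow> complex \<Rightarrow> complex"
  where "kern s u = 1 / (1 - u) powr complex_of_real s"

definition kern_coeff :: "real \<Rightarrow> nat \<Rightarrow> real"
  where "kern_coeff s k = pochhammer s k / fact k"

lemma kern_coeff_nonneg: "0 \<le> s \<Longrightarrow> 0 \<le> kern_coeff s k"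
  by (auto simp: kern_coeff_def pochhammer_prod intro!: divide_nonneg_pos prod_nonneg)

lemma kern_coeff_Gamma: "0 < s \<Longrightarrow> kern_coeff s k = Gamma (s + real k) / (Gamma s * fact k)"
  unfolding kern_coeff_def by (subst pochhammer_Gamma) (auto elim!: nonpos_Ints_cases)

lemma one_minus_nonpos: "cmod u < 1 \<Longrightarrow> 1 - u \<notin> \<real>\<^sub>\<le>\<^sub>0"
  using complex_Re_le_cmod[of u] by (auto simp: complex_nonpos_Reals_iff)

lemma kern_powr: "kern s u = (1 - u) powr (- complex_of_real s)"
  by (simp add: kern_def powr_minus divide_inverse)

lemma holomorphic_kern: "kern s holomorphic_on ball 0 1"
  unfolding kern_powr using one_minus_nonpos by (intro holomorphic_intros) auto

lemma continuous_on_kern: "continuous_on (ball 0 1) (kern s)"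
  by (rule holomorphic_on_imp_continuous_on[OF holomorphic_kern])

lemma norm_kern: "cmod (kern s u) = 1 / cmod (1 - u) powr s"
  by (simp add: kern_def norm_divide norm_powr_real_powr')

lemma kern_mult: "kern s u * kern t u = kern (s + t) u"
  by (simp add: kern_powr powr_add[symmetric])

lemma cnj_kern: "cmod u < 1 \<Longrightarrow> cnj (kern s u) = kern s (cnj u)"
  using complex_Re_le_cmod[of u] by (simp add: kern_powr cnj_powr)

lemma norm_kern_le:
  assumes "cmod u \<le> \<rho>" "\<rho> < 1" "0 \<le> s"
  shows "cmod (kern s u) \<le> 1 / (1 - \<rho>) powr s"
proof -
  have "1 - \<rho> \<le> cmod (1 - u)"
    using norm_triangle_ineq2[of 1 u] assms by simp
  moreover from this have "0 < cmod (1 - u)"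
    using assms by linarith
  ultimately show ?thesis
    unfolding norm_kern using assms by (intro divide_left_mono powr_mono2 mult_pos_pos) auto
qed

lemma kern_has_field_derivative:
  assumes "cmod u < 1"
  shows "(kern s has_field_derivative of_real s * kern (s + 1) u) (at u)"
proof -
  have "((\<lambda>u. (1 - u) powr (- complex_of_real s)) has_field_derivative
      (- of_real s * (1 - u) powr (- complex_of_real s - 1)) * (- 1)) (at u)"
    by (rule DERIV_chain2[where f = "\<lambda>z. z powr (- complex_of_real s)" and g = "\<lambda>u. 1 - u",
          OF has_field_derivative_powr[OF one_minus_nonpos[OF assms]]])
      (auto intro!: derivative_eq_intros)
  then show ?thesis
    unfolding kern_powr by (simp add: diff_minus_eq_add)
qed

text \<open>The generalized binomial series; the sign (-1)^k of the binomial coefficient cancels the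
  one in (-u)^k.\<close>

lemma kern_sums:
  assumes "cmod u < 1"
  shows "(\<lambda>k. of_real (kern_coeff s k) * u ^ k) sums kern s u"
proof -
  have "(\<lambda>k. ((- of_real s) gchoose k) * (- u) ^ k) sums (1 + (- u)) powr (- of_real s)"
    using assms by (intro gen_binomial_complex) simp
  moreover have "((- complex_of_real s) gchoose k) * (- u) ^ k = of_real (kern_coeff s k) * u ^ k" for k
  proof -
    have "((- complex_of_real s) gchoose k) * (- u) ^ k
        = ((- 1) ^ k * (- 1) ^ k) * (pochhammer (complex_of_real s) k / fact k) * u ^ k"
      by (simp add: gbinomial_pochhammer power_minus[of u])
    then show ?thesis
      by (simp add: kern_coeff_def pochhammer_of_real power_mult_distrib[symmetric])
  qed
  ultimately show ?thesis
    by (simp add: kern_powr)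
qed

lemma kern_sums_real:
  assumes "0 \<le> x" "x < 1"
  shows "(\<lambda>k. kern_coeff s k * x ^ k) sums ((1 - x) powr (- s))"
proof -
  have "(\<lambda>k. complex_of_real (kern_coeff s k * x ^ k)) sums kern s (of_real x)"
    using kern_sums[of "of_real x" s] assms by simp
  moreover have "kern s (of_real x) = of_real ((1 - x) powr (- s))"
    using assms powr_of_real[of "1 - x" "- s"] by (simp add: kern_powr)
  ultimately show ?thesis
    by (simp only: sums_of_real_iff)
qed

lemma deriv_of_power_series:
  assumes "\<And>z. cmod z < 1 \<Longrightarrow> (\<lambda>k. a k * z ^ k) sums G z"
  shows "(deriv ^^ k) G 0 / fact k = a k"
proof -
  have "G has_fps_expansion Abs_fps a"
  proof (rule has_fps_expansionI)
    have "eventually (\<lambda>u. u \<in> ball (0 :: complex) 1) (nhds 0)"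
      by (rule eventually_nhds_in_open) auto
    then show "\<forall>\<^sub>F u in nhds 0. (\<lambda>n. fps_nth (Abs_fps a) n * u ^ n) sums G u"
      by eventually_elim (simp add: assms)
  qed
  then show ?thesis
    using fps_nth_fps_expansion[of G "Abs_fps a" k] by simp
qed

lemma continuous_on_kern_hinner:
  "norm z < 1 \<Longrightarrow> continuous_on (ball 0 1) (\<lambda>w. kern s (hinner z w))"
  "norm z < 1 \<Longrightarrow> continuous_on (ball 0 1) (\<lambda>w. kern s (hinner w z))"
  by (rule continuous_on_compose2[OF continuous_on_kern]; auto intro!: continuous_intros norm_hinner_less_1)+

lemma hinner_le_left: "norm w < 1 \<Longrightarrow> cmod (hinner z w) \<le> norm z"
  using norm_hinner_le[of z w] mult_left_mono[of "norm w" 1 "norm z"] by simp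

lemma kern_hinner_le:
  "norm z < 1 \<Longrightarrow> norm w < 1 \<Longrightarrow> 0 \<le> s \<Longrightarrow> cmod (kern s (hinner z w)) \<le> 1 / (1 - norm z) powr s"
  by (intro norm_kern_le hinner_le_left)

text \<open>For fixed z in the ball, |<z,w>| \<le> |z| < 1 uniformly in w, so the binomial series is
  dominated by its value at |z| and may be integrated term by term against any integrable F.\<close>

lemma kern_integral_sums:
  fixes z :: "complex ^ 'n"
  assumes F: "integrable (ball_measure \<alpha>) F" and z: "norm z < 1" and s: "0 \<le> s"
  shows "(\<lambda>k. of_real (kern_coeff s k) * (\<integral>w. F w * hinner z w ^ k \<partial>ball_measure \<alpha>))
    sums (\<integral>w. F w * kern s (hinner z w) \<partial>ball_measure \<alpha>)"
proof -
  let ?M = "ball_measure \<alpha> :: (complex ^ 'n) measure"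
  define f where "f k w = F w * (of_real (kern_coeff s k) * hinner z w ^ k)" for k w
  have b: "cmod (of_real (kern_coeff s k) * hinner z w ^ k) \<le> kern_coeff s k * norm z ^ k" if "norm w < 1" for k w
    using hinner_le_left[OF that, of z] kern_coeff_nonneg[OF s, of k]
    by (simp add: norm_mult norm_power mult_left_mono power_mono)
  have int: "integrable ?M (f k)" for k
    unfolding f_def by (rule integrable_ball_mult_bounded[OF F _ b]) (intro continuous_intros, simp)
  have le: "norm (f k w) \<le> norm (F w) * (kern_coeff s k * norm z ^ k)" if "norm w < 1" for k w
    using b[OF that] by (simp add: f_def norm_mult mult_left_mono)
  have sm: "summable (\<lambda>k. kern_coeff s k * norm z ^ k)"
    using kern_sums_real[of "norm z" s] z by (auto simp: sums_iff)
  have sums: "(\<lambda>k. f k w) sums (F w * kern s (hinner z w))" if "norm w < 1" for w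
    unfolding f_def by (intro sums_mult kern_sums norm_hinner_less_1 z that)
  have "(\<lambda>k. \<integral>w. f k w \<partial>?M) sums (\<integral>w. (\<Sum>k. f k w) \<partial>?M)"
  proof (rule sums_integral[OF int])
    show "AE w in ?M. summable (\<lambda>k. norm (f k w))"
    proof (rule AE_I2)
      fix w assume "w \<in> space ?M"
      then show "summable (\<lambda>k. norm (f k w))"
        using le[of w] by (intro summable_comparison_test'[OF summable_mult[OF sm, of "norm (F w)"], of 0])
          (simp add: space_ball_measure)
    qed
    show "summable (\<lambda>k. \<integral>w. norm (f k w) \<partial>?M)"
    proof (rule summable_comparison_test'[OF summable_mult[OF sm, of "\<integral>w. norm (F w) \<partial>?M"], of 0])
      fix k
      have "(\<integral>w. norm (f k w) \<partial>?M) \<le> (\<integral>w. norm (F w) * (kern_coeff s k * norm z ^ k) \<partial>?M)"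
        using le F int by (intro integral_mono_AE AE_I2) (auto simp: space_ball_measure)
      then show "norm (\<integral>w. norm (f k w) \<partial>?M) \<le> (\<integral>w. norm (F w) \<partial>?M) * (kern_coeff s k * norm z ^ k)"
        by simp
    qed
  qed
  moreover have "(\<integral>w. (\<Sum>k. f k w) \<partial>?M) = (\<integral>w. F w * kern s (hinner z w) \<partial>?M)"
    by (intro Bochner_Integration.integral_cong refl) (simp add: space_ball_measure sums_unique[OF sums, symmetric])
  moreover have "(\<integral>w. f k w \<partial>?M) = of_real (kern_coeff s k) * (\<integral>w. F w * hinner z w ^ k \<partial>?M)" for k
    unfolding f_def mult.left_commute[of "F _"] by (rule integral_mult_right_zero)
  ultimately show ?thesis
    by simp
qed

lemma unit_direction:
  fixes z :: "complex ^ 'n"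
  obtains e where "norm e = 1" "z = norm z *\<^sub>R e"
proof (cases "z = 0")
  case True
  then show ?thesis using unit_vector that by (metis norm_zero scaleR_zero_left)
next
  case False
  then show ?thesis by (intro that[of "(1 / norm z) *\<^sub>R z"]) auto
qed

text \<open>The integral of |<w,e>|^(2k) for any unit vector e.\<close>

definition moment :: "'n::finite itself \<Rightarrow> real \<Rightarrow> nat \<Rightarrow> real"
  where "moment _ \<alpha> k = fact k * Gamma (real CARD('n) + 1 + \<alpha>) / Gamma (real CARD('n) + 1 + \<alpha> + real k)"

text \<open>Expanding the kernel and using orthogonality leaves a one-variable power series. It is
  used twice: for s = n + 1 + \<alpha> the numbers \<open>kern_coeff\<close> and
  \<open>moment\<close> are reciprocal and the Taylor series of G at r remains; with G itself a
  kernel it yields integrals of squared kernels.\<close>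

lemma kern_pairing_sums:
  fixes e :: "complex ^ 'n"
  assumes e: "norm e = 1" and \<alpha>: "-1 < \<alpha>" and G: "G holomorphic_on ball 0 1"
    and int: "integrable (ball_measure \<alpha>) (\<lambda>w. G (hinner w e))" and r: "0 \<le> r" "r < 1" and s: "0 \<le> s"
  shows "(\<lambda>k. of_real (kern_coeff s k * moment TYPE('n) \<alpha> k * r ^ k) * ((deriv ^^ k) G 0 / fact k))
    sums (\<integral>w. G (hinner w e) * kern s (hinner (r *\<^sub>R e) w) \<partial>ball_measure \<alpha>)"
proof -
  have "(\<integral>w. G (hinner w e) * hinner (r *\<^sub>R e) w ^ k \<partial>ball_measure \<alpha>)
      = of_real (moment TYPE('n) \<alpha> k * r ^ k) * ((deriv ^^ k) G 0 / fact k)" for k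
  proof -
    have "(\<integral>w. G (hinner w e) * hinner (r *\<^sub>R e) w ^ k \<partial>ball_measure \<alpha>)
        = (\<integral>w. of_real (r ^ k) * (G (hinner w e) * cnj (hinner w e) ^ k) \<partial>ball_measure \<alpha>)"
      by (intro Bochner_Integration.integral_cong refl)
        (simp add: hinner_scaleR_left hinner_commute[of e] power_mult_distrib)
    also have "\<dots> = of_real (r ^ k) * (\<integral>w. G (hinner w e) * cnj (hinner w e) ^ k \<partial>ball_measure \<alpha>)"
      by (rule integral_mult_right_zero)
    finally show ?thesis
      unfolding moment_coefficient[OF e \<alpha> G int] moment_def
      by (simp only: of_real_mult mult_ac)
  qed
  then show ?thesis
    using kern_integral_sums[OF int, of "r *\<^sub>R e" s] e r s by (simp add: mult.assoc)
qed

section \<open>The Forelli--Rudin estimates\<close>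

text \<open>Log-convexity of Gamma at the midpoint. It compares series coefficients with explicit
  constants, in place of asymptotics of Gamma quotients.\<close>

lemma Gamma_midpoint:
  assumes "0 < x" "0 < (y :: real)"
  shows "(Gamma ((x + y) / 2))\<^sup>2 \<le> Gamma x * Gamma y"
proof -
  have pos: "0 < Gamma x" "0 < Gamma y" "0 < Gamma ((x + y) / 2)"
    using assms by (simp_all add: Gamma_real_pos)
  have "(ln \<circ> Gamma) ((1 - 1 / 2) *\<^sub>R x + (1 / 2) *\<^sub>R y) \<le> (1 - 1 / 2) * (ln \<circ> Gamma) x + (1 / 2) * (ln \<circ> Gamma) y"
    using assms by (intro convex_onD[OF log_convex_Gamma_real]) auto
  then have "2 * ln (Gamma ((x + y) / 2)) \<le> ln (Gamma x) + ln (Gamma y)"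
    by (simp add: field_simps)
  then have "ln ((Gamma ((x + y) / 2))\<^sup>2) \<le> ln (Gamma x * Gamma y)"
    using pos by (simp add: ln_mult ln_realpow)
  then show ?thesis
    using pos by (subst (asm) ln_le_cancel_iff) auto
qed

text \<open>The modulus of the kernel with exponent 2\<sigma> is the kernel with exponent \<sigma>
  times its own conjugate, so its integral is a pairing of two kernels and has an explicit series in
  |z|^2.\<close>

lemma kern_norm_sums:
  fixes z :: "complex ^ 'n"
  assumes z: "norm z < 1" and \<alpha>: "-1 < \<alpha>" and \<sigma>: "0 < \<sigma>"
  shows "(\<lambda>k. (kern_coeff \<sigma> k)\<^sup>2 * moment TYPE('n) \<alpha> k * ((norm z)\<^sup>2) ^ k)
    sums (\<integral>w. 1 / cmod (1 - hinner z w) powr (2 * \<sigma>) \<partial>ball_measure \<alpha>)"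
proof -
  obtain e where e: "norm e = 1" "z = norm z *\<^sub>R e"
    by (rule unit_direction)
  define r where "r = norm z"
  have r: "0 \<le> r" "r < 1" using z by (auto simp: r_def)
  \<comment> \<open>Chosen so that G (<w,e>) is the conjugate of the kernel at <z,w>, while G is
    holomorphic in one variable and falls under the pairing formula.\<close>
  define G where "G u = kern \<sigma> (of_real r * u)" for u
  have ru: "cmod (of_real r * u) < 1" if "cmod u < 1" for u
    using mult_strict_mono'[of r 1 "cmod u" 1] r that by (simp add: norm_mult)
  have hol: "G holomorphic_on ball 0 1"
    unfolding G_def using ru
    by (intro holomorphic_on_compose_gen[OF _ holomorphic_kern, unfolded o_def] holomorphic_intros) auto
  have Gw: "G (hinner w e) = cnj (kern \<sigma> (hinner z w))" if "norm w < 1" for w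
  proof -
    have "of_real r * hinner w e = cnj (hinner z w)"
      by (subst e(2), subst hinner_commute) (simp add: hinner_scaleR_left r_def hinner_commute[of w e])
    then show ?thesis
      by (simp add: G_def cnj_kern norm_hinner_less_1 z that)
  qed
  have "integrable (ball_measure \<alpha>) (\<lambda>w. cnj (kern \<sigma> (hinner z w)))"
    using z \<sigma> by (intro integrable_ball_bounded[OF \<alpha>, where B = "1 / (1 - norm z) powr \<sigma>"] continuous_intros
        continuous_on_kern_hinner) (auto intro: kern_hinner_le)
  then have int: "integrable (ball_measure \<alpha>) (\<lambda>w. G (hinner w e))"
    by (rule Bochner_Integration.integrable_cong[THEN iffD1, rotated 2]) (auto simp: Gw space_ball_measure)
  have "(deriv ^^ k) G 0 / fact k = of_real (kern_coeff \<sigma> k * r ^ k)" for k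
  proof (rule deriv_of_power_series)
    fix u :: complex assume "cmod u < 1"
    then show "(\<lambda>k. of_real (kern_coeff \<sigma> k * r ^ k) * u ^ k) sums G u"
      using kern_sums[OF ru] by (simp add: G_def power_mult_distrib mult.assoc)
  qed
  then have 1: "(\<lambda>k. complex_of_real ((kern_coeff \<sigma> k)\<^sup>2 * moment TYPE('n) \<alpha> k * ((norm z)\<^sup>2) ^ k))
      sums (\<integral>w. G (hinner w e) * kern \<sigma> (hinner (r *\<^sub>R e) w) \<partial>ball_measure \<alpha>)"
    using kern_pairing_sums[OF e(1) \<alpha> hol int r less_imp_le[OF \<sigma>]]
    by (simp add: r_def power2_eq_square power_mult_distrib mult_ac)
  have "(\<integral>w. G (hinner w e) * kern \<sigma> (hinner (r *\<^sub>R e) w) \<partial>ball_measure \<alpha>)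
      = (\<integral>w. complex_of_real (1 / cmod (1 - hinner z w) powr (2 * \<sigma>)) \<partial>ball_measure \<alpha>)"
  proof (intro Bochner_Integration.integral_cong refl)
    fix w assume "w \<in> space (ball_measure \<alpha> :: (complex ^ 'n) measure)"
    then have w: "norm w < 1" by (simp add: space_ball_measure)
    have "1 / cmod (1 - hinner z w) powr (2 * \<sigma>) = (cmod (kern \<sigma> (hinner z w)))\<^sup>2"
      by (simp add: norm_kern power_divide powr_power power2_eq_square powr_add[symmetric])
    then show "G (hinner w e) * kern \<sigma> (hinner (r *\<^sub>R e) w) = of_real (1 / cmod (1 - hinner z w) powr (2 * \<sigma>))"
      unfolding Gw[OF w] r_def e(2)[symmetric] by (simp only: complex_norm_square mult.commute)
  qed
  also have "\<dots> = of_real (\<integral>w. 1 / cmod (1 - hinner z w) powr (2 * \<sigma>) \<partial>ball_measure \<alpha>)"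
    by (rule integral_complex_of_real)
  finally show ?thesis
    using 1 by (simp only: sums_of_real_iff)
qed

lemma integrable_kern_norm:
  fixes z :: "complex ^ 'n"
  assumes z: "norm z < 1" and \<alpha>: "-1 < \<alpha>" and \<sigma>: "0 \<le> \<sigma>"
  shows "integrable (ball_measure \<alpha>) (\<lambda>w. 1 / cmod (1 - hinner z w) powr \<sigma>)"
  unfolding norm_kern[symmetric] using z \<sigma>
  by (intro integrable_ball_bounded[OF \<alpha>, where B = "1 / (1 - norm z) powr \<sigma>"] continuous_on_norm
      continuous_on_kern_hinner) (auto intro: kern_hinner_le)

text \<open>Here \<sigma> is the mean of s and c, so \<open>Gamma_midpoint\<close> bounds the k-th
  coefficient of the integral by a constant times that of (1 - x) powr (- c) at x = |z|^2. The
  constant C is what the Gamma factors leave behind.\<close>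

lemma forelli_rudin:
  assumes \<alpha>: "-1 < \<alpha>" and c: "0 < c"
  obtains C where "0 < C" "\<And>z :: complex ^ 'n. norm z < 1 \<Longrightarrow>
    (\<integral>w. 1 / cmod (1 - hinner z w) powr (real CARD('n) + 1 + \<alpha> + c) \<partial>ball_measure \<alpha>) \<le> C * (1 - (norm z)\<^sup>2) powr (- c)"
proof
  define s where "s = real CARD('n) + 1 + \<alpha>"
  define \<sigma> where "\<sigma> = (s + c) / 2"
  have s: "0 < s" and \<sigma>: "0 < \<sigma>" using \<alpha> c by (auto simp: s_def \<sigma>_def)
  define C where "C = Gamma s * Gamma c / (Gamma \<sigma>)\<^sup>2"
  show "0 < C"
    unfolding C_def using Gamma_real_pos[OF s] Gamma_real_pos[OF \<sigma>] Gamma_real_pos[OF c]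
    by (intro divide_pos_pos mult_pos_pos zero_less_power)
  fix z :: "complex ^ 'n" assume z: "norm z < 1"
  have x: "0 \<le> (norm z)\<^sup>2" "(norm z)\<^sup>2 < 1"
    using z norm_sq_less_1 by auto
  have le: "(kern_coeff \<sigma> k)\<^sup>2 * moment TYPE('n) \<alpha> k \<le> C * kern_coeff c k" for k
  proof -
    have pos: "0 < Gamma (s + real k)" "0 < Gamma \<sigma>" "0 < Gamma s" "0 < Gamma c" "0 < Gamma (c + real k)"
      using s \<sigma> c by (simp_all add: Gamma_real_pos add_pos_nonneg)
    have "(Gamma (((s + real k) + (c + real k)) / 2))\<^sup>2 \<le> Gamma (s + real k) * Gamma (c + real k)"
      using s c by (intro Gamma_midpoint) auto
    moreover have "((s + real k) + (c + real k)) / 2 = \<sigma> + real k"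
      by (simp add: \<sigma>_def field_simps)
    ultimately have "(Gamma (\<sigma> + real k))\<^sup>2 \<le> Gamma (s + real k) * Gamma (c + real k)"
      by (simp only:)
    then have g: "(Gamma (\<sigma> + real k))\<^sup>2 / Gamma (s + real k) \<le> Gamma (c + real k)"
      using pos by (simp add: divide_le_eq mult.commute)
    have "(kern_coeff \<sigma> k)\<^sup>2 * moment TYPE('n) \<alpha> k
        = (Gamma s / ((Gamma \<sigma>)\<^sup>2 * fact k)) * ((Gamma (\<sigma> + real k))\<^sup>2 / Gamma (s + real k))"
      by (simp add: kern_coeff_Gamma[OF \<sigma>] moment_def s_def[symmetric] power_divide power_mult_distrib power2_eq_square mult_ac)
    also have "\<dots> \<le> (Gamma s / ((Gamma \<sigma>)\<^sup>2 * fact k)) * Gamma (c + real k)"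
      using pos by (intro mult_left_mono g) auto
    also have "\<dots> = C * kern_coeff c k"
      using pos by (simp add: C_def kern_coeff_Gamma[OF c])
    finally show ?thesis .
  qed
  have "(\<integral>w. 1 / cmod (1 - hinner z w) powr (2 * \<sigma>) \<partial>ball_measure \<alpha>) \<le> C * (1 - (norm z)\<^sup>2) powr (- c)"
    using le x by (intro sums_le[OF _ kern_norm_sums[OF z \<alpha> \<sigma>] sums_mult[OF kern_sums_real[OF x]]])
      (simp add: mult.assoc[symmetric] mult_right_mono)
  moreover have "2 * \<sigma> = real CARD('n) + 1 + \<alpha> + c"
    by (simp add: \<sigma>_def s_def)
  ultimately show "(\<integral>w. 1 / cmod (1 - hinner z w) powr (real CARD('n) + 1 + \<alpha> + c) \<partial>ball_measure \<alpha>) \<le> C * (1 - (norm z)\<^sup>2) powr (- c)"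
    by (simp only:)
qed

text \<open>The limiting case c = 0. For k \<ge> 1 the midpoint inequality with Gamma k = (k - 1)!
  leaves C / k, the coefficients of the logarithm. The term k = 0, where Gamma has a pole, is
  treated apart and equals 1.\<close>

lemma forelli_rudin_log:
  assumes \<alpha>: "-1 < \<alpha>"
  obtains C where "0 < C" "\<And>z :: complex ^ 'n. norm z < 1 \<Longrightarrow>
    (\<integral>w. 1 / cmod (1 - hinner z w) powr (real CARD('n) + 1 + \<alpha>) \<partial>ball_measure \<alpha>) \<le> 1 + C * ln (1 / (1 - (norm z)\<^sup>2))"
proof
  define s where "s = real CARD('n) + 1 + \<alpha>"
  define \<sigma> where "\<sigma> = s / 2"
  have s: "0 < s" and \<sigma>: "0 < \<sigma>" using \<alpha> by (auto simp: s_def \<sigma>_def)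
  define C where "C = Gamma s / (Gamma \<sigma>)\<^sup>2"
  show "0 < C"
    unfolding C_def using Gamma_real_pos[OF s] Gamma_real_pos[OF \<sigma>]
    by (intro divide_pos_pos zero_less_power)
  fix z :: "complex ^ 'n" assume z: "norm z < 1"
  define x where "x = (norm z)\<^sup>2"
  have x: "0 \<le> x" "x < 1"
    using z norm_sq_less_1 by (auto simp: x_def)
  have le: "(kern_coeff \<sigma> k)\<^sup>2 * moment TYPE('n) \<alpha> k * x ^ k \<le> (if k = 0 then 1 else 0) + C * (x ^ k / real k)" for k
  proof (cases k)
    case 0
    have "Gamma s \<noteq> 0" using Gamma_real_pos[OF s] by simp
    with 0 show ?thesis by (simp add: kern_coeff_def moment_def s_def[symmetric])
  next
    case (Suc m)
    have pos: "0 < Gamma (s + real k)" "0 < Gamma \<sigma>" "0 < Gamma s"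
      using s \<sigma> by (simp_all add: Gamma_real_pos add_pos_nonneg)
    have "(Gamma (((s + real k) + real k) / 2))\<^sup>2 \<le> Gamma (s + real k) * Gamma (real k)"
      using s Suc by (intro Gamma_midpoint) auto
    moreover have "((s + real k) + real k) / 2 = \<sigma> + real k"
      by (simp add: \<sigma>_def field_simps)
    moreover have "Gamma (real k) = fact m"
      using Suc by (simp add: Gamma_fact[symmetric] add.commute)
    ultimately have "(Gamma (\<sigma> + real k))\<^sup>2 \<le> Gamma (s + real k) * fact m"
      by (simp only:)
    then have g: "(Gamma (\<sigma> + real k))\<^sup>2 / Gamma (s + real k) \<le> fact m"
      using pos by (simp add: divide_le_eq mult.commute)
    have "(kern_coeff \<sigma> k)\<^sup>2 * moment TYPE('n) \<alpha> k
        = (Gamma s / ((Gamma \<sigma>)\<^sup>2 * fact k)) * ((Gamma (\<sigma> + real k))\<^sup>2 / Gamma (s + real k))"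
      by (simp add: kern_coeff_Gamma[OF \<sigma>] moment_def s_def[symmetric] power_divide power_mult_distrib power2_eq_square mult_ac)
    also have "\<dots> \<le> (Gamma s / ((Gamma \<sigma>)\<^sup>2 * fact k)) * fact m"
      using pos by (intro mult_left_mono g) auto
    also have "\<dots> = C / real k"
      using pos Suc by (simp add: C_def)
    finally have "(kern_coeff \<sigma> k)\<^sup>2 * moment TYPE('n) \<alpha> k * x ^ k \<le> C / real k * x ^ k"
      using x by (intro mult_right_mono) auto
    then show ?thesis using Suc by simp
  qed
  have "(\<lambda>k. - ((- (- x)) ^ k) / real k) sums ln (1 + (- x))"
    using x by (intro ln_series') auto
  then have "(\<lambda>k. - (- (x ^ k) / real k)) sums (- ln (1 - x))"
    by (intro sums_minus) simp
  then have "(\<lambda>k. C * (x ^ k / real k)) sums (C * ln (1 / (1 - x)))"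
    using x by (intro sums_mult) (simp add: ln_div)
  then have "(\<lambda>k. (if k = 0 then 1 else 0) + C * (x ^ k / real k)) sums (1 + C * ln (1 / (1 - x)))"
    by (intro sums_add) (use sums_single[of 0 "\<lambda>_. 1 :: real"] in simp)
  from sums_le[OF le kern_norm_sums[OF z \<alpha> \<sigma>, folded x_def] this]
  have "(\<integral>w. 1 / cmod (1 - hinner z w) powr (2 * \<sigma>) \<partial>ball_measure \<alpha>) \<le> 1 + C * ln (1 / (1 - x))" .
  moreover have "2 * \<sigma> = real CARD('n) + 1 + \<alpha>"
    by (simp add: \<sigma>_def s_def)
  ultimately show "(\<integral>w. 1 / cmod (1 - hinner z w) powr (real CARD('n) + 1 + \<alpha>) \<partial>ball_measure \<alpha>) \<le> 1 + C * ln (1 / (1 - (norm z)\<^sup>2))"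
    unfolding x_def by (simp only:)
qed

section \<open>The reproducing formula\<close>

text \<open>Complex linearity of the derivative is what makes the chain rule along a complex line
  give one-variable complex differentiability.\<close>

lemma holomorphic_ball_slice:
  fixes g :: "complex ^ 'n \<Rightarrow> complex"
  assumes g: "holomorphic_ball g" and "p + c *s q \<in> ball 0 1"
  shows "(\<lambda>c. g (p + c *s q)) field_differentiable (at c)"
proof -
  obtain g' where g': "(g has_derivative g') (at (p + c *s q))" and lin: "\<And>c v. g' (c *s v) = c *\<^sub>C g' v"
    using assms unfolding holomorphic_ball_def by blast
  have "((\<lambda>c. p + c *s q) has_derivative (\<lambda>h. h *s q)) (at c)"
  proof -
    have "bounded_linear (\<lambda>h :: complex. h *s q)"
    proof (rule bounded_linear_intro)
      show "(h + k) *s q = h *s q + k *s q" for h k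
        by (rule vector_sadd_rdistrib)
      show "(r *\<^sub>R h) *s q = r *\<^sub>R (h *s q)" for r and h :: complex
        by (simp only: scaleR_eq_scale vector_smult_assoc scaleR_conv_of_real)
      show "norm (h *s q) \<le> norm h * norm q" for h
        by (simp add: norm_scale_vec)
    qed
    then show ?thesis
      by (intro has_derivative_add[OF has_derivative_const, simplified] bounded_linear_imp_has_derivative)
  qed
  from diff_chain_at[OF this g']
  have "((\<lambda>c. g (p + c *s q)) has_derivative (\<lambda>h. g' (h *s q))) (at c)"
    by (simp add: o_def)
  then have "((\<lambda>c. g (p + c *s q)) has_field_derivative g' q) (at c)"
    by (simp add: has_field_derivative_def lin scaleC_complex_def mult_commute_abs)
  then show ?thesis
    using field_differentiable_def by blast
qed

lemma holomorphic_ball_continuous: "holomorphic_ball f \<Longrightarrow> continuous_on (ball 0 1) f"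
  unfolding holomorphic_ball_def
  by (intro continuous_at_imp_continuous_on ballI) (blast dest: has_derivative_continuous)

lemma projection_in_ball:
  assumes e: "norm e = 1" and w: "norm w < 1" and c: "cmod c \<le> 1"
  shows "hinner w e *s e + c *s (w - hinner w e *s e) \<in> ball 0 1"
proof -
  have *: "norm x < 1 \<Longrightarrow> x \<in> ball 0 1" for x :: "complex ^ 'n"
    by simp
  show ?thesis
    by (rule *, rule le_less_trans[OF norm_decomposition(1)[OF e c] w])
qed

text \<open>
  Averaging over the rotations about the direction of \<open>z\<close>, which do not affect the kernel, replaces
  \<open>g w\<close> by the value of \<open>g\<close> at the projection of \<open>w\<close>; this reduces the claim to one variable.
\<close>

lemma reproducing:
  fixes g :: "complex ^ 'n \<Rightarrow> complex"
  assumes g: "holomorphic_ball g" and int: "integrable (ball_measure \<alpha>) g" and \<alpha>: "-1 < \<alpha>" and z: "norm z < 1"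
  shows "(\<integral>w. g w * kern (real CARD('n) + 1 + \<alpha>) (hinner z w) \<partial>ball_measure \<alpha>) = g z"
proof -
  let ?M = "ball_measure \<alpha> :: (complex ^ 'n) measure"
  define s where "s = real CARD('n) + 1 + \<alpha>"
  have s: "0 < s" using \<alpha> by (simp add: s_def)
  obtain e where e: "norm e = 1" "z = norm z *\<^sub>R e"
    by (rule unit_direction)
  define r where "r = norm z"
  have r: "0 \<le> r" "r < 1" using z by (auto simp: r_def)
  have ze: "r *\<^sub>R e = z"
    unfolding r_def by (rule e(2)[symmetric])
  define G where "G c = g (c *s e)" for c
  have hol: "G holomorphic_on ball 0 1"
    unfolding holomorphic_on_def G_def
    using holomorphic_ball_slice[OF g, of 0 _ e] e
    by (auto simp: norm_scale_vec intro: field_differentiable_at_within)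
  have hrot: "hinner z (rotate_about e t w) = hinner z w" for t w
  proof -
    have "hinner e (rotate_about e t w) = hinner e w"
      unfolding rotate_about_def hinner_add_right hinner_scale_right hinner_projection(2)[OF e(1)] hinner_self
      by (simp add: e(1) hinner_commute[of e w])
    then have "hinner (r *\<^sub>R e) (rotate_about e t w) = hinner (r *\<^sub>R e) w"
      unfolding hinner_scaleR_left by (rule arg_cong)
    then show ?thesis
      unfolding r_def e(2)[symmetric] .
  qed
  have mean: "((\<lambda>t. g (rotate_about e t w)) has_integral G (hinner w e)) {0..1}" if w: "norm w < 1" for w
  proof -
    have "(\<lambda>c. g (hinner w e *s e + c *s (w - hinner w e *s e))) holomorphic_on cball 0 1"
      unfolding holomorphic_on_def
    proof
      fix c :: complex assume "c \<in> cball 0 1"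
      then have "cmod c \<le> 1" by simp
      from projection_in_ball[OF e(1) w this]
      show "(\<lambda>c. g (hinner w e *s e + c *s (w - hinner w e *s e))) field_differentiable (at c within cball 0 1)"
        by (rule field_differentiable_at_within[OF holomorphic_ball_slice[OF g]])
    qed
    from circle_mean[OF this]
    have "((\<lambda>t. g (rotate_about e t w)) has_integral g (hinner w e *s e + 0 *s (w - hinner w e *s e))) {0..1}"
      unfolding rotate_about_def .
    then show ?thesis
      unfolding G_def vector_smult_lzero add_0_right .
  qed
  have gc: "continuous_on {0..1} (\<lambda>t. g (rotate_about e t w))" if "norm w < 1" for w
    using that norm_rotate_about[OF e(1)]
    by (intro continuous_on_compose2[OF holomorphic_ball_continuous[OF g]])
      (auto simp: rotate_about_def intro!: continuous_intros)
  note rot = isometry_measurable_ball[OF continuous_rotation(2) norm_rotate_about[OF e(1)]]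
    distr_ball_measure_isometry[OF linear_rotate_about norm_rotate_about[OF e(1)] \<alpha>]
  have Gint: "integrable ?M (\<lambda>w. G (hinner w e))"
    by (rule rotation_average(1)[OF sigma_finite_ball_measure[OF \<alpha>] rot int])
      (simp_all add: space_ball_measure gc mean)
  have Kint: "integrable ?M (\<lambda>w. g w * kern s (hinner z w))"
    by (rule integrable_ball_mult_bounded[OF int continuous_on_kern_hinner(1)[OF z]
        kern_hinner_le[OF z _ less_imp_le[OF s]]])
  have eq: "(\<integral>w. G (hinner w e) * kern s (hinner z w) \<partial>?M) = (\<integral>w. g w * kern s (hinner z w) \<partial>?M)"
  proof (rule rotation_average(2)[OF sigma_finite_ball_measure[OF \<alpha>] rot Kint])
    fix w assume "w \<in> space ?M"
    then have w: "norm w < 1" by (simp add: space_ball_measure)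
    show "continuous_on {0..1} (\<lambda>t. g (rotate_about e t w) * kern s (hinner z (rotate_about e t w)))"
      unfolding hrot by (intro continuous_intros gc w)
    show "((\<lambda>t. g (rotate_about e t w) * kern s (hinner z (rotate_about e t w)))
        has_integral G (hinner w e) * kern s (hinner z w)) {0..1}"
      unfolding hrot by (intro has_integral_mult_left mean w)
  qed
  have sums1: "(\<lambda>k. (deriv ^^ k) G 0 / fact k * (of_real r) ^ k) sums (\<integral>w. G (hinner w e) * kern s (hinner z w) \<partial>?M)"
  proof -
    \<comment> \<open>Exactly for s = n + 1 + \<alpha> the binomial coefficient of the kernel
      inverts the moment; this makes the kernel reproducing.\<close>
    have "kern_coeff s k * moment TYPE('n) \<alpha> k = 1" for k
    proof -
      have "0 < Gamma s" "0 < Gamma (s + real k)"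
        using s by (simp_all add: Gamma_real_pos add_pos_nonneg)
      then show ?thesis
        unfolding kern_coeff_Gamma[OF s] moment_def s_def[symmetric] by simp
    qed
    then have *: "complex_of_real (kern_coeff s k * moment TYPE('n) \<alpha> k * r ^ k) * a = a * of_real r ^ k" for k a
      by (simp only: mult_1_left of_real_power mult.commute)
    show ?thesis
      using kern_pairing_sums[OF e(1) \<alpha> hol Gint r less_imp_le[OF s]]
      unfolding * by (simp only: ze)
  qed
  have sums2: "(\<lambda>k. (deriv ^^ k) G 0 / fact k * (of_real r) ^ k) sums g z"
  proof -
    have "(\<lambda>k. (deriv ^^ k) G 0 / fact k * (of_real r - 0) ^ k) sums G (of_real r)"
      using r by (intro holomorphic_power_series[OF hol]) auto
    moreover have "of_real r *s e = z"
      using scaleR_eq_scale[of r e] ze by (rule trans[OF sym])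
    ultimately show ?thesis
      unfolding G_def by (simp only: diff_zero)
  qed
  show ?thesis
    unfolding s_def[symmetric] eq[symmetric] by (rule sums_unique2[OF sums1 sums2])
qed

section \<open>Vector-valued integrals\<close>

text \<open>
  The approximating simple functions pick the nearest among the first \<open>j + 1\<close> points of a sequence
  that is dense in the range and starts with \<open>0\<close>, so that the error is dominated by \<open>norm (G w)\<close>.
\<close>

lemma has_vec_integral_ex:
  fixes G :: "complex ^ 'n \<Rightarrow> 'b::banach"
  assumes \<alpha>: "-1 < \<alpha>" and G: "continuous_on (ball 0 1) G" and int: "integrable (ball_measure \<alpha>) (\<lambda>w. norm (G w))"
  obtains x where "has_vec_integral (ball_measure \<alpha>) G x"
proof -
  let ?M = "ball_measure \<alpha> :: (complex ^ 'n) measure"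
  interpret finite_measure ?M
    by (rule finite_ball_measure[OF \<alpha>])
  \<comment> \<open>Separability is taken from the domain: G is continuous, so the image of a
    countable dense subset of the ball is dense in the range of G, whatever the target space
    is.\<close>
  obtain D :: "(complex ^ 'n) set" where D: "countable D" "\<And>X. open X \<Longrightarrow> X \<noteq> {} \<Longrightarrow> \<exists>d\<in>D. d \<in> X"
    by (rule countable_dense_setE) blast
  define E where "E = insert 0 (G ` (D \<inter> ball 0 1))"
  have E: "countable E" "E \<noteq> {}"
    using D(1) by (auto simp: E_def)
  define d where "d i = (case i of 0 \<Rightarrow> 0 | Suc k \<Rightarrow> from_nat_into E k)" for i
  have dense: "\<exists>i. norm (G w - d i) < \<epsilon>" if w: "w \<in> ball 0 1" and \<epsilon>: "0 < \<epsilon>" for w \<epsilon>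
  proof -
    obtain X where X: "open X" "ball 0 1 \<inter> G -` ball (G w) \<epsilon> = ball 0 1 \<inter> X"
      using continuous_openin_preimage_gen[OF G open_ball] unfolding openin_open by blast
    have "w \<in> ball 0 1 \<inter> X"
      unfolding X(2)[symmetric] using w \<epsilon> by simp
    then have "ball 0 1 \<inter> X \<noteq> {}" by blast
    moreover have "open (ball 0 1 \<inter> X)"
      using X(1) by (intro open_Int open_ball)
    ultimately obtain v where "v \<in> D" "v \<in> ball 0 1 \<inter> X"
      using D(2) by blast
    then have v: "G v \<in> E" "dist (G w) (G v) < \<epsilon>"
      unfolding X(2)[symmetric] by (auto simp: E_def)
    from v(1) obtain k where "from_nat_into E k = G v"
      using from_nat_into_surj[OF E(1)] by blast
    with v(2) show ?thesis
      by (intro exI[of _ "Suc k"]) (simp add: d_def dist_norm)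
  qed
  have Gm: "G \<in> borel_measurable ?M"
    by (rule measurable_ball_continuous[OF G])
  have dm [measurable]: "(\<lambda>w. norm (G w - c)) \<in> borel_measurable ?M" for c
    by (intro measurable_ball_continuous continuous_intros G)
  define P where "P j w i \<longleftrightarrow> i \<le> j \<and> (\<forall>k\<le>j. norm (G w - d i) \<le> norm (G w - d k))" for j w i
  \<comment> \<open>Several of the first points may be nearest to \<open>G w\<close>. Taking the
    least index makes the choice measurable and finitely valued.\<close>
  define h where "h j w = (LEAST i. P j w i)" for j :: nat and w
  have ex: "\<exists>i. P j w i" for j w
  proof -
    have "\<exists>i\<in>{..j}. \<forall>k\<in>{..j}. norm (G w - d i) \<le> norm (G w - d k)"
      using arg_min_least[of "{..j}" _ "\<lambda>i. norm (G w - d i)"] arg_min_if_finite(1)[of "{..j}" "\<lambda>i. norm (G w - d i)"]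
      by (intro bexI[of _ "arg_min_on (\<lambda>i. norm (G w - d i)) {..j}"]) auto
    then show ?thesis
      unfolding P_def by blast
  qed
  have h: "h j w \<le> j" "\<And>k. k \<le> j \<Longrightarrow> norm (G w - d (h j w)) \<le> norm (G w - d k)" for j w
    using LeastI_ex[OF ex[of j w]] unfolding P_def h_def by auto
  have hm [measurable]: "h j \<in> ?M \<rightarrow>\<^sub>M count_space UNIV" for j
    unfolding h_def P_def by measurable
  define s where "s j w = d (h j w)" for j w
  have simple: "Bochner_Integration.simple_bochner_integrable ?M (s j)" for j
  proof
    have "simple_function ?M (h j)"
      unfolding simple_function_def
    proof (intro conjI ballI)
      show "finite (h j ` space ?M)"
        using h(1) by (intro finite_subset[OF _ finite_atMost[of j]]) auto
      show "h j -` {x} \<inter> space ?M \<in> sets ?M" for x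
        by (rule measurable_sets[OF hm]) simp
    qed
    from simple_function_compose[OF this, of d] show "simple_function ?M (s j)"
      by (simp add: s_def[abs_def] o_def)
  qed simp
  have um [measurable]: "(\<lambda>w. norm (G w - s j w)) \<in> borel_measurable ?M" for j
    unfolding s_def by (rule measurable_compose_countable[OF dm hm])
  have lim: "(\<lambda>j. \<integral>\<^sup>+w. ennreal (norm (G w - s j w)) \<partial>?M) \<longlonglongrightarrow> (\<integral>\<^sup>+w. 0 \<partial>?M)"
  proof (rule nn_integral_dominated_convergence[where w = "\<lambda>w. ennreal (norm (G w))"])
    show "AE w in ?M. ennreal (norm (G w - s j w)) \<le> ennreal (norm (G w))" for j
      using h(2)[of 0 j] by (intro AE_I2 ennreal_leI) (simp add: s_def d_def)
    show "(\<integral>\<^sup>+w. ennreal (norm (G w)) \<partial>?M) < \<infinity>"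
      using int by (simp add: integrable_iff_bounded)
    show "AE w in ?M. (\<lambda>j. ennreal (norm (G w - s j w))) \<longlonglongrightarrow> 0"
    proof (rule AE_I2)
      fix w assume "w \<in> space ?M"
      then have w: "w \<in> ball 0 1" by (simp add: space_ball_measure)
      have "(\<lambda>j. norm (G w - s j w)) \<longlonglongrightarrow> 0"
      proof (rule LIMSEQ_I)
        fix \<epsilon> :: real assume "0 < \<epsilon>"
        from dense[OF w this] obtain i where i: "norm (G w - d i) < \<epsilon>" by blast
        have "norm (norm (G w - s j w) - 0) < \<epsilon>" if "i \<le> j" for j
          using h(2)[OF that, of w] i by (simp add: s_def)
        then show "\<exists>N. \<forall>j\<ge>N. norm (norm (G w - s j w) - 0) < \<epsilon>" by blast
      qed
      from tendsto_ennrealI[OF this] show "(\<lambda>j. ennreal (norm (G w - s j w))) \<longlonglongrightarrow> 0" by simp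
    qed
  qed (use dm[of 0] in \<open>simp_all\<close>)
  define u where "u j = (\<integral>\<^sup>+w. ennreal (norm (G w - s j w)) \<partial>?M)" for j
  have u: "u \<longlonglongrightarrow> 0"
    using lim by (simp add: u_def[abs_def])
  let ?S = "\<lambda>j. Bochner_Integration.simple_bochner_integral ?M (s j)"
  \<comment> \<open>Comparing two simple functions through G shows that their integrals form a
    Cauchy sequence; completeness of the target then provides the value of the integral.\<close>
  have diff: "ennreal (norm (?S i - ?S j)) \<le> u i + u j" for i j
  proof -
    have si: "Bochner_Integration.simple_bochner_integrable ?M (\<lambda>w. s i w - s j w)"
      by (rule simple_bochner_integrable_compose2[where p = "\<lambda>x y. x - y"]) (simp_all add: simple)
    have sn: "Bochner_Integration.simple_bochner_integrable ?M (\<lambda>w. norm (s i w - s j w))"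
      by (rule simple_bochner_integrable_compose2[where p = "\<lambda>x y. norm (x - y)"]) (simp_all add: simple)
    have "norm (?S i - ?S j) \<le> Bochner_Integration.simple_bochner_integral ?M (\<lambda>w. norm (s i w - s j w))"
      using simple_bochner_integral_norm_bound[OF si] by (simp add: simple_bochner_integral_diff simple)
    then have "ennreal (norm (?S i - ?S j)) \<le> (\<integral>\<^sup>+w. ennreal (norm (s i w - s j w)) \<partial>?M)"
      by (subst simple_bochner_integral_eq_nn_integral[OF sn, symmetric]) (auto intro: ennreal_leI)
    also have "\<dots> \<le> (\<integral>\<^sup>+w. ennreal (norm (G w - s i w)) + ennreal (norm (G w - s j w)) \<partial>?M)"
    proof (rule nn_integral_mono)
      fix w
      have "norm (s i w - s j w) \<le> norm (G w - s i w) + norm (G w - s j w)"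
        using norm_triangle_ineq4[of "G w - s j w" "G w - s i w"] by (simp add: algebra_simps)
      then show "ennreal (norm (s i w - s j w)) \<le> ennreal (norm (G w - s i w)) + ennreal (norm (G w - s j w))"
        by (simp add: ennreal_plus[symmetric] del: ennreal_plus)
    qed
    also have "\<dots> = u i + u j"
      unfolding u_def by (rule nn_integral_add) measurable
    finally show ?thesis .
  qed
  have "Cauchy ?S"
  proof (rule metric_CauchyI)
    fix \<epsilon> :: real assume \<epsilon>: "0 < \<epsilon>"
    have "eventually (\<lambda>j. u j < ennreal (\<epsilon> / 3)) sequentially"
      using u \<epsilon> by (intro order_tendstoD) auto
    then obtain N where N: "\<And>j. j \<ge> N \<Longrightarrow> u j < ennreal (\<epsilon> / 3)"
      by (auto simp: eventually_sequentially)
    have "dist (?S i) (?S j) < \<epsilon>" if "i \<ge> N" "j \<ge> N" for i j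
    proof -
      have "ennreal (norm (?S i - ?S j)) \<le> ennreal (\<epsilon> / 3) + ennreal (\<epsilon> / 3)"
        using diff[of i j] add_mono[OF less_imp_le[OF N[OF that(1)]] less_imp_le[OF N[OF that(2)]]]
        by (rule order_trans)
      then show ?thesis
        using \<epsilon> by (simp add: ennreal_plus[symmetric] dist_norm del: ennreal_plus)
    qed
    then show "\<exists>N. \<forall>i\<ge>N. \<forall>j\<ge>N. dist (?S i) (?S j) < \<epsilon>" by blast
  qed
  then obtain x where "?S \<longlonglongrightarrow> x"
    using convergent_eq_Cauchy by blast
  then have "has_vec_integral ?M G x"
    unfolding has_vec_integral_def using Gm simple u by (auto simp: u_def[abs_def])
  then show ?thesis by (rule that)
qed

text \<open>T maps an approximating sequence of simple functions to another one, since the errors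
  grow at most by the factor K. The scalar values make the standard integral available.\<close>

lemma has_vec_integral_linear:
  fixes T :: "'b::real_normed_vector \<Rightarrow> complex"
  assumes T: "bounded_linear T" and f: "has_vec_integral M f x"
  shows "has_bochner_integral M (\<lambda>w. T (f w)) (T x)"
proof -
  obtain K where K: "0 < K" "\<And>x. norm (T x) \<le> norm x * K"
    using bounded_linear.pos_bounded[OF T] by blast
  obtain s where s: "\<And>i. Bochner_Integration.simple_bochner_integrable M (s i)"
      "(\<lambda>i. \<integral>\<^sup>+w. ennreal (norm (f w - s i w)) \<partial>M) \<longlonglongrightarrow> 0"
      "(\<lambda>i. Bochner_Integration.simple_bochner_integral M (s i)) \<longlonglongrightarrow> x"
    and fm: "f \<in> borel_measurable M"
    using f unfolding has_vec_integral_def by blast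
  have Tf [measurable]: "(\<lambda>w. T (f w)) \<in> borel_measurable M"
    using measurable_compose[OF fm borel_measurable_continuous_onI[OF linear_continuous_on[OF T]]] by simp
  have Ts: "Bochner_Integration.simple_bochner_integrable M (\<lambda>w. T (s i w))" for i
    using s(1)[of i] by (intro simple_bochner_integrable_compose2[where p = "\<lambda>x y. T x"])
      (simp_all add: linear_simps(3)[OF T])
  \<comment> \<open>In a non-separable space a difference of measurable functions need not be
    measurable. Here \<open>s i\<close> has finitely many values, and for each fixed value the
    expression is a continuous function of \<open>f w\<close>.\<close>
  have [measurable]: "(\<lambda>w. norm (f w - s i w)) \<in> borel_measurable M" for i
  proof -
    have sf: "simple_function M (s i)"
      using s(1)[of i] by (rule Bochner_Integration.simple_bochner_integrable.cases) auto
    have fin: "finite (s i ` space M)"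
      using sf by (rule simple_functionD)
    have "(\<lambda>w. norm (f w - c)) \<in> borel_measurable M" for c
    proof -
      have "continuous_on UNIV (\<lambda>y. norm (y - c))"
        by (intro continuous_intros)
      from measurable_compose[OF fm borel_measurable_continuous_onI[OF this]] show ?thesis .
    qed
    moreover have "s i \<in> M \<rightarrow>\<^sub>M count_space (s i ` space M)"
      using simple_functionD(2)[OF sf] by (subst measurable_count_space_eq2[OF fin]) auto
    ultimately show ?thesis
      by (rule measurable_compose_countable'[where g = "s i"]) (rule countable_finite[OF fin])
  qed
  show ?thesis
  proof (rule has_bochner_integral.intros[OF Tf Ts])
    show "(\<lambda>i. \<integral>\<^sup>+w. ennreal (norm (T (f w) - T (s i w))) \<partial>M) \<longlonglongrightarrow> 0"
    proof (rule tendsto_sandwich[OF _ _ tendsto_const])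
      have "(\<lambda>i. ennreal K * (\<integral>\<^sup>+w. ennreal (norm (f w - s i w)) \<partial>M)) \<longlonglongrightarrow> ennreal K * 0"
        by (intro ennreal_tendsto_cmult s(2)) simp
      then show "(\<lambda>i. ennreal K * (\<integral>\<^sup>+w. ennreal (norm (f w - s i w)) \<partial>M)) \<longlonglongrightarrow> 0"
        by simp
      have "(\<integral>\<^sup>+w. ennreal (norm (T (f w) - T (s i w))) \<partial>M) \<le> (\<integral>\<^sup>+w. ennreal K * ennreal (norm (f w - s i w)) \<partial>M)" for i
        using K(2) K(1) by (intro nn_integral_mono)
          (simp add: linear_simps(2)[OF T, symmetric] ennreal_mult'[symmetric] mult.commute ennreal_leI)
      also have "(\<integral>\<^sup>+w. ennreal K * ennreal (norm (f w - s i w)) \<partial>M) = ennreal K * (\<integral>\<^sup>+w. ennreal (norm (f w - s i w)) \<partial>M)" for i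
        by (rule nn_integral_cmult) measurable
      finally show "\<forall>\<^sub>F i in sequentially. (\<integral>\<^sup>+w. ennreal (norm (T (f w) - T (s i w))) \<partial>M) \<le> ennreal K * (\<integral>\<^sup>+w. ennreal (norm (f w - s i w)) \<partial>M)"
        by simp
    qed simp
    have "Bochner_Integration.simple_bochner_integral M (\<lambda>w. T (s i w)) = T (Bochner_Integration.simple_bochner_integral M (s i))" for i
      using simple_bochner_integral_linear[OF bounded_linear.linear[OF T] s(1)] .
    then show "(\<lambda>i. Bochner_Integration.simple_bochner_integral M (\<lambda>w. T (s i w))) \<longlonglongrightarrow> T x"
      by (simp add: bounded_linear.tendsto[OF T s(3)])
  qed
qed

text \<open>Functionals separate points, so at most one vector can be an integral and the definite
  description inside \<open>vec_integral\<close> denotes the value constructed before.\<close>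

lemma vec_integral_functional:
  fixes G :: "complex ^ 'n \<Rightarrow> 'b::complex_banach"
  assumes \<alpha>: "-1 < \<alpha>" and G: "continuous_on (ball 0 1) G" and int: "integrable (ball_measure \<alpha>) (\<lambda>w. norm (G w))"
    and T: "bounded_linear (T :: 'b \<Rightarrow> complex)"
  shows "has_bochner_integral (ball_measure \<alpha>) (\<lambda>w. T (G w)) (T (vec_integral (ball_measure \<alpha>) G))"
proof -
  let ?M = "ball_measure \<alpha> :: (complex ^ 'n) measure"
  obtain x where x: "has_vec_integral ?M G x"
    by (rule has_vec_integral_ex[OF \<alpha> G int])
  have unique: "y = x" if y: "has_vec_integral ?M G y" for y
    by (rule eq_functional) (rule has_bochner_integral_eq[OF has_vec_integral_linear[OF bounded_linear_cblinfun_apply y]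
      has_vec_integral_linear[OF bounded_linear_cblinfun_apply x]])
  have "vec_integral ?M G = x"
    unfolding vec_integral_def if_P[OF exI[of "has_vec_integral ?M G", OF x]]
    by (rule the_equality[of "has_vec_integral ?M G", OF x unique])
  with has_vec_integral_linear[OF T x] show ?thesis by (simp only:)
qed

lemma norm_integral_functional_le:
  fixes G :: "complex ^ 'n \<Rightarrow> complex"
  assumes "integrable (ball_measure \<alpha>) h" and "\<And>w. norm w < 1 \<Longrightarrow> cmod (G w) \<le> h w"
  shows "cmod (\<integral>w. G w \<partial>ball_measure \<alpha>) \<le> (\<integral>w. h w \<partial>ball_measure \<alpha>)"
  using assms by (intro order_trans[OF integral_norm_bound] integral_mono_AE' AE_I2)
    (auto simp: space_ball_measure intro: order_trans[OF norm_ge_zero])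

section \<open>Kernel transforms of operator-valued functions\<close>

text \<open>The standing condition on b under which every bounded continuous scalar weight can be
  integrated against it; the bound on \<alpha> is included because it makes the measure
  finite.\<close>

definition ball_integrand :: "real \<Rightarrow> (complex ^ 'n \<Rightarrow> 'b::complex_banach) \<Rightarrow> bool"
  where "ball_integrand \<alpha> b \<longleftrightarrow> -1 < \<alpha> \<and> continuous_on (ball 0 1) b \<and> integrable (ball_measure \<alpha>) (\<lambda>w. norm (b w))"

definition weighted_integral :: "real \<Rightarrow> (complex ^ 'n \<Rightarrow> complex) \<Rightarrow> (complex ^ 'n \<Rightarrow> 'b::complex_banach) \<Rightarrow> 'b"
  where "weighted_integral \<alpha> k b = vec_integral (ball_measure \<alpha>) (\<lambda>w. k w *\<^sub>C b w)"

lemma weighted_integral_functional: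
  fixes b :: "complex ^ 'n \<Rightarrow> 'b::complex_banach"
  assumes b: "ball_integrand \<alpha> b" and k: "continuous_on (ball 0 1) k" "\<And>w. norm w < 1 \<Longrightarrow> cmod (k w) \<le> B"
  shows "has_bochner_integral (ball_measure \<alpha>) (\<lambda>w. k w * cblinfun_apply \<phi> (b w)) (cblinfun_apply \<phi> (weighted_integral \<alpha> k b))"
proof -
  have \<alpha>: "-1 < \<alpha>" and bc: "continuous_on (ball 0 1) b" and bi: "integrable (ball_measure \<alpha>) (\<lambda>w. norm (b w))"
    using b by (auto simp: ball_integrand_def)
  have c: "continuous_on (ball 0 1) (\<lambda>w. k w *\<^sub>C b w)"
    by (rule continuous_on_scaleC[OF k(1) bc])
  have "integrable (ball_measure \<alpha>) (\<lambda>w. norm (k w *\<^sub>C b w))"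
  proof (rule Bochner_Integration.integrable_bound[OF integrable_mult_right[OF bi, of B]])
    show "(\<lambda>w. norm (k w *\<^sub>C b w)) \<in> borel_measurable (ball_measure \<alpha>)"
      by (rule measurable_ball_continuous[OF continuous_on_norm[OF c]])
    show "AE w in ball_measure \<alpha>. norm (norm (k w *\<^sub>C b w)) \<le> norm (B * norm (b w))"
    proof (rule AE_I2)
      fix w assume "w \<in> space (ball_measure \<alpha> :: (complex ^ 'n) measure)"
      then have "cmod (k w) \<le> \<bar>B\<bar>"
        using k(2)[of w] by (simp add: space_ball_measure)
      then show "norm (norm (k w *\<^sub>C b w)) \<le> norm (B * norm (b w))"
        by (simp add: norm_scaleC abs_mult mult_right_mono)
    qed
  qed
  from vec_integral_functional[OF \<alpha> c this bounded_linear_cblinfun_apply[of \<phi>]]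
  show ?thesis
    by (simp add: weighted_integral_def cblinfun_apply_scaleC_right scaleC_complex_def)
qed

lemma functional_norm_le: "(\<And>y. cmod (cblinfun_apply \<phi> y) \<le> norm y) \<Longrightarrow> cmod (k * cblinfun_apply \<phi> x) \<le> cmod k * norm x"
  by (simp add: norm_mult mult_left_mono)

text \<open>Only the functionals of x have to be integrals against k. Thus x may be any linear
  combination of vector integrals, and additivity of the vector integral itself is never invoked:
  the weights are combined on the scalar side.\<close>

lemma norm_weighted_integral_diff_le:
  fixes b :: "complex ^ 'n \<Rightarrow> 'b::complex_banach"
  assumes b: "ball_integrand \<alpha> b"
    and k: "continuous_on (ball 0 1) k" "\<And>w. norm w < 1 \<Longrightarrow> cmod (k w) \<le> B"
    and x: "\<And>\<phi>. has_bochner_integral (ball_measure \<alpha>) (\<lambda>w. k w * cblinfun_apply \<phi> (b w)) (cblinfun_apply \<phi> x)"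
  shows "norm x \<le> B * (\<integral>w. norm (b w) \<partial>ball_measure \<alpha>)"
proof (rule norm_le_functional)
  fix \<phi> :: "('b, complex) cblinfun"
  assume \<phi>: "\<And>y. cmod (cblinfun_apply \<phi> y) \<le> norm y"
  have bi: "integrable (ball_measure \<alpha>) (\<lambda>w. norm (b w))"
    using b by (auto simp: ball_integrand_def)
  have "cmod (\<integral>w. k w * cblinfun_apply \<phi> (b w) \<partial>ball_measure \<alpha>) \<le> (\<integral>w. B * norm (b w) \<partial>ball_measure \<alpha>)"
    using k(2) by (intro norm_integral_functional_le integrable_mult_right bi)
      (auto intro!: order_trans[OF functional_norm_le[OF \<phi>]] mult_right_mono)
  then show "cmod (cblinfun_apply \<phi> x) \<le> B * (\<integral>w. norm (b w) \<partial>ball_measure \<alpha>)"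
    using has_bochner_integral_integral_eq[OF x[of \<phi>]] by simp
qed

definition kern_transform :: "real \<Rightarrow> real \<Rightarrow> (complex ^ 'n \<Rightarrow> 'b::complex_banach) \<Rightarrow> complex ^ 'n \<Rightarrow> 'b"
  where "kern_transform \<alpha> s b z = weighted_integral \<alpha> (\<lambda>w. kern s (hinner z w)) b"

lemma kern_transform_functional:
  fixes b :: "complex ^ 'n \<Rightarrow> 'b::complex_banach"
  assumes "ball_integrand \<alpha> b" "norm z < 1" "0 \<le> s"
  shows "has_bochner_integral (ball_measure \<alpha>) (\<lambda>w. kern s (hinner z w) * cblinfun_apply \<phi> (b w))
    (cblinfun_apply \<phi> (kern_transform \<alpha> s b z))"
  unfolding kern_transform_def
  by (rule weighted_integral_functional[OF assms(1) continuous_on_kern_hinner(1)[OF assms(2)] kern_hinner_le[OF assms(2) _ assms(3)]])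

text \<open>The constant bounds the second derivative s (s + 1) \<open>kern (s + 2)\<close> on the
  disc of radius \<rho>. Uniformity on that disc permits differentiation under the integral
  sign.\<close>

lemma kern_taylor:
  assumes u: "cmod u \<le> \<rho>" "cmod v \<le> \<rho>" "\<rho> < 1" and s: "0 \<le> s"
  shows "cmod (kern s v - kern s u - of_real s * kern (s + 1) u * (v - u)) \<le> s * (s + 1) / (1 - \<rho>) powr (s + 2) * (cmod (v - u))\<^sup>2"
proof -
  define f where "f i x = of_real (pochhammer s i) * kern (s + real i) x" for i x
  have "cmod (f 0 v - (\<Sum>i\<le>1. f i u * (v - u) ^ i / fact i)) \<le> s * (s + 1) / (1 - \<rho>) powr (s + 2) * cmod (v - u) ^ Suc 1 / fact 1"
  proof (rule complex_Taylor[where S = "cball 0 \<rho>"])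
    fix i :: nat and x :: complex assume x: "x \<in> cball 0 \<rho>"
    then have x1: "cmod x < 1" using u by simp
    have "((\<lambda>x. of_real (pochhammer s i) * kern (s + real i) x) has_field_derivative
        of_real (pochhammer s i) * (of_real (s + real i) * kern (s + real i + 1) x)) (at x)"
      by (rule DERIV_cmult[OF kern_has_field_derivative[OF x1]])
    moreover have "f (Suc i) x = of_real (pochhammer s i) * (of_real (s + real i) * kern (s + real i + 1) x)"
      by (simp add: f_def pochhammer_rec' mult_ac add_ac)
    ultimately show "(f i has_field_derivative f (Suc i) x) (at x within cball 0 \<rho>)"
      unfolding f_def[of i, abs_def] by (simp add: has_field_derivative_at_within)
  next
    fix x :: complex assume "x \<in> cball 0 \<rho>"
    then have "cmod (kern (s + 2) x) \<le> 1 / (1 - \<rho>) powr (s + 2)"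
      using u s by (intro norm_kern_le) auto
    then have "s * (s + 1) * cmod (kern (s + 2) x) \<le> s * (s + 1) * (1 / (1 - \<rho>) powr (s + 2))"
      using s by (intro mult_left_mono) auto
    moreover have "cmod (f (Suc 1) x) = s * (s + 1) * cmod (kern (s + 2) x)"
      using s by (simp add: f_def norm_mult pochhammer_Suc mult.commute)
    ultimately show "cmod (f (Suc 1) x) \<le> s * (s + 1) / (1 - \<rho>) powr (s + 2)"
      by simp
  qed (use u in auto)
  then show ?thesis
    by (simp add: f_def power2_eq_square algebra_simps)
qed

definition kern_transform_deriv :: "real \<Rightarrow> real \<Rightarrow> (complex ^ 'n \<Rightarrow> 'b::complex_banach) \<Rightarrow> complex ^ 'n \<Rightarrow> complex ^ 'n \<Rightarrow> 'b"
  where "kern_transform_deriv \<alpha> s b z v = weighted_integral \<alpha> (\<lambda>w. of_real s * kern (s + 1) (hinner z w) * hinner v w) b"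

lemma kern_transform_deriv_weight:
  fixes z v :: "complex ^ 'n"
  assumes z: "norm z < 1" and s: "0 \<le> s"
  shows "continuous_on (ball 0 1) (\<lambda>w. of_real s * kern (s + 1) (hinner z w) * hinner v w)"
    "norm w < 1 \<Longrightarrow> cmod (of_real s * kern (s + 1) (hinner z w) * hinner v w) \<le> s * (1 / (1 - norm z) powr (s + 1)) * norm v"
proof -
  show "continuous_on (ball 0 1) (\<lambda>w. of_real s * kern (s + 1) (hinner z w) * hinner v w)"
    using z by (intro continuous_intros continuous_on_kern_hinner)
  assume w: "norm w < 1"
  have "cmod (of_real s * kern (s + 1) (hinner z w) * hinner v w) = s * cmod (kern (s + 1) (hinner z w)) * cmod (hinner v w)"
    using s by (simp add: norm_mult)
  also have "\<dots> \<le> s * (1 / (1 - norm z) powr (s + 1)) * norm v"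
    using z w s by (intro mult_mono mult_nonneg_nonneg kern_hinner_le hinner_le_left) auto
  finally show "cmod (of_real s * kern (s + 1) (hinner z w) * hinner v w) \<le> s * (1 / (1 - norm z) powr (s + 1)) * norm v" .
qed

lemma kern_transform_deriv_functional:
  fixes b :: "complex ^ 'n \<Rightarrow> 'b::complex_banach"
  assumes b: "ball_integrand \<alpha> b" and z: "norm z < 1" and s: "0 \<le> s"
  shows "has_bochner_integral (ball_measure \<alpha>) (\<lambda>w. of_real s * kern (s + 1) (hinner z w) * hinner v w * cblinfun_apply \<phi> (b w))
    (cblinfun_apply \<phi> (kern_transform_deriv \<alpha> s b z v))"
  unfolding kern_transform_deriv_def
  by (rule weighted_integral_functional[OF b kern_transform_deriv_weight[OF z s]])

text \<open>The first-order Taylor remainder of the kernel is at most a constant times |y - z|^2,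
  uniformly in w. Integrated against b it is at most that bound times the integral of |b|, which is
  o(|y - z|).\<close>

lemma kern_transform_has_derivative:
  fixes b :: "complex ^ 'n \<Rightarrow> 'b::complex_banach"
  assumes b: "ball_integrand \<alpha> b" and z: "norm z < 1" and s: "0 \<le> s"
  shows "(kern_transform \<alpha> s b has_derivative kern_transform_deriv \<alpha> s b z) (at z)"
    "kern_transform_deriv \<alpha> s b z (c *s v) = c *\<^sub>C kern_transform_deriv \<alpha> s b z v"
proof -
  let ?M = "ball_measure \<alpha> :: (complex ^ 'n) measure" and ?D = "kern_transform_deriv \<alpha> s b z"
  define I where "I = (\<integral>w. norm (b w) \<partial>?M)"
  have I0: "0 \<le> I" unfolding I_def by simp
  note Df = kern_transform_deriv_functional[OF b z s]
  have add: "?D (u + v) = ?D u + ?D v" for u v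
  proof (rule eq_functional)
    fix \<phi> :: "('b, complex) cblinfun"
    show "cblinfun_apply \<phi> (?D (u + v)) = cblinfun_apply \<phi> (?D u + ?D v)"
      using has_bochner_integral_add[OF Df[where v = u and \<phi> = \<phi>] Df[where v = v and \<phi> = \<phi>]] Df[where v = "u + v" and \<phi> = \<phi>]
      by (intro has_bochner_integral_eq[of ?M]) (simp_all add: cblinfun_apply_add_right hinner_add_left ring_distribs)
  qed
  have scale: "?D (c *s v) = c *\<^sub>C ?D v" for c v
  proof (rule eq_functional)
    fix \<phi> :: "('b, complex) cblinfun"
    have fe: "(\<lambda>w. of_real s * kern (s + 1) (hinner z w) * hinner (c *s v) w * cblinfun_apply \<phi> (b w))
        = (\<lambda>w. c * (of_real s * kern (s + 1) (hinner z w) * hinner v w * cblinfun_apply \<phi> (b w)))"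
      by (simp add: hinner_scale_left fun_eq_iff)
    have "cblinfun_apply \<phi> (?D (c *s v)) = c * cblinfun_apply \<phi> (?D v)"
      by (rule has_bochner_integral_eq[OF Df[where v = "c *s v" and \<phi> = \<phi>, unfolded fe]
            has_bochner_integral_mult_right[OF Df[where v = v and \<phi> = \<phi>]]])
    then show "cblinfun_apply \<phi> (?D (c *s v)) = cblinfun_apply \<phi> (c *\<^sub>C ?D v)"
      by (simp only: cblinfun_apply_scaleC_right scaleC_complex_def)
  qed
  show "?D (c *s v) = c *\<^sub>C ?D v"
    by (rule scale)
  have bl: "bounded_linear ?D"
  proof (rule bounded_linear_intro[OF add])
    show "?D (r *\<^sub>R v) = r *\<^sub>R ?D v" for r v
      unfolding scaleR_eq_scale scaleR_scaleC by (rule scale)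
    show "norm (?D v) \<le> norm v * (s * (1 / (1 - norm z) powr (s + 1)) * I)" for v
      using norm_weighted_integral_diff_le[OF b kern_transform_deriv_weight(1)[OF z s, where v = v]
          kern_transform_deriv_weight(2)[OF z s, where v = v] Df[where v = v]]
      by (simp add: I_def mult_ac)
  qed
  \<comment> \<open>Halfway between |z| and 1: all y close to z, and all products <y,w>, stay in one
    disc of radius \<rho> < 1.\<close>
  define \<rho> where "\<rho> = (1 + norm z) / 2"
  define B where "B = s * (s + 1) / (1 - \<rho>) powr (s + 2)"
  have \<rho>: "norm z < \<rho>" "\<rho> < 1" using z by (auto simp: \<rho>_def field_simps)
  have B: "0 \<le> B" using s by (simp add: B_def)
  show "(kern_transform \<alpha> s b has_derivative ?D) (at z)"
  proof (rule has_derivativeI_sandwich[OF _ bl])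
    show "0 < \<rho> - norm z" using \<rho> by simp
    fix y assume y: "y \<noteq> z" "dist y z < \<rho> - norm z"
    have ny: "norm y < \<rho>"
      using y(2) norm_triangle_sub[of y z] by (simp add: dist_norm)
    then have y1: "norm y < 1" using \<rho> by simp
    define k where "k w = kern s (hinner y w) - kern s (hinner z w) - of_real s * kern (s + 1) (hinner z w) * hinner (y - z) w" for w
    have kc: "continuous_on (ball 0 1) k"
      unfolding k_def using z y1 by (intro continuous_intros continuous_on_kern_hinner)
    have kb: "cmod (k w) \<le> B * (norm (y - z))\<^sup>2" if w: "norm w < 1" for w
    proof -
      have "cmod (k w) \<le> B * (cmod (hinner y w - hinner z w))\<^sup>2"
        unfolding k_def B_def hinner_diff_left
        using ny \<rho> by (intro kern_taylor s) (auto intro: order_trans[OF hinner_le_left[OF w]])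
      also have "\<dots> \<le> B * (norm (y - z))\<^sup>2"
        unfolding hinner_diff_left[symmetric] using B w
        by (intro mult_left_mono power_mono hinner_le_left) auto
      finally show ?thesis .
    qed
    have "norm (kern_transform \<alpha> s b y - kern_transform \<alpha> s b z - ?D (y - z)) \<le> B * (norm (y - z))\<^sup>2 * I"
      unfolding I_def
    proof (rule norm_weighted_integral_diff_le[OF b kc kb])
      fix \<phi> :: "('b, complex) cblinfun"
      show "has_bochner_integral ?M (\<lambda>w. k w * cblinfun_apply \<phi> (b w))
          (cblinfun_apply \<phi> (kern_transform \<alpha> s b y - kern_transform \<alpha> s b z - ?D (y - z)))"
        unfolding k_def cblinfun_apply_diff_right left_diff_distrib
        by (intro has_bochner_integral_diff kern_transform_functional[OF b] y1 z s Df)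
    qed
    then show "norm ((kern_transform \<alpha> s b y - kern_transform \<alpha> s b z) - ?D (y - z)) / norm (y - z) \<le> B * I * norm (y - z)"
      using y(1) by (simp add: divide_le_eq power2_eq_square mult_ac)
  next
    have "((\<lambda>y. B * I * norm (y - z)) \<longlongrightarrow> B * I * norm (z - z)) (at z)"
      by (intro tendsto_intros)
    then show "((\<lambda>y. B * I * norm (y - z)) \<longlongrightarrow> 0) (at z)" by simp
  qed
qed

lemma holomorphic_kern_transform:
  assumes "ball_integrand \<alpha> b" "0 \<le> s"
  shows "holomorphic_ball (kern_transform \<alpha> s b)"
  unfolding holomorphic_ball_def
  using kern_transform_has_derivative[OF assms(1) _ assms(2)] by (meson mem_ball_0)

section \<open>Homogeneous expansions and fractional derivatives\<close>

lemma finite_multi_indices: "finite {m :: 'n::finite \<Rightarrow> nat. sum m UNIV = k}"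
proof (rule finite_subset)
  show "{m :: 'n \<Rightarrow> nat. sum m UNIV = k} \<subseteq> PiE UNIV (\<lambda>_. {..k})"
    using member_le_sum[of _ "UNIV :: 'n set"] by (auto simp: PiE_def extensional_def)
  show "finite (PiE (UNIV :: 'n set) (\<lambda>_. {..k}))"
    by (intro finite_PiE) auto
qed

text \<open>The multinomial theorem, obtained by expanding the power over words of length k and
  grouping them by letter counts; the multinomial coefficient appears as the number of words.
  Continuity of the coefficient functions is recorded because they will be integrated.\<close>

lemma hinner_power_expansion:
  "\<exists>A :: ('n::finite \<Rightarrow> nat) \<Rightarrow> complex ^ 'n \<Rightarrow> complex. (\<forall>m. continuous_on UNIV (A m)) \<and>
    (\<forall>z w. hinner z w ^ k = (\<Sum>m | sum m UNIV = k. (\<Prod>j\<in>UNIV. (z $ j) ^ m j) * A m w))"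
proof -
  define S where "S = PiE {..<k} (\<lambda>_. UNIV :: 'n set)"
  have S: "finite S"
    unfolding S_def by (intro finite_PiE) auto
  define idx where "idx g j = card {i \<in> {..<k}. g i = j}" for g :: "nat \<Rightarrow> 'n" and j
  have idx: "sum (idx g) UNIV = k" for g
    using sum.group[of "{..<k}" "UNIV :: 'n set" g "\<lambda>_. 1 :: nat"] by (simp add: idx_def)
  define A where "A m w = of_nat (card {g \<in> S. idx g = m}) * (\<Prod>j\<in>UNIV. cnj (w $ j) ^ m j)" for m and w :: "complex ^ 'n"
  have "hinner z w ^ k = (\<Sum>m | sum m UNIV = k. (\<Prod>j\<in>UNIV. (z $ j) ^ m j) * A m w)" for z w
  proof -
    define x where "x j = z $ j * cnj (w $ j)" for j
    have "hinner z w ^ k = (\<Prod>i<k. \<Sum>j\<in>UNIV. x j)"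
      by (simp add: hinner_def x_def)
    also have "\<dots> = (\<Sum>g\<in>S. \<Prod>i<k. x (g i))"
      unfolding S_def by (rule prod_sum_PiE) auto
    also have "\<dots> = (\<Sum>g\<in>S. \<Prod>j\<in>UNIV. x j ^ idx g j)"
    proof (rule sum.cong[OF refl])
      fix g
      have "(\<Prod>i<k. x (g i)) = (\<Prod>j\<in>UNIV. \<Prod>i\<in>{i \<in> {..<k}. g i = j}. x (g i))"
        by (rule prod.group[symmetric]) auto
      then show "(\<Prod>i<k. x (g i)) = (\<Prod>j\<in>UNIV. x j ^ idx g j)"
        by (simp add: idx_def)
    qed
    also have "\<dots> = (\<Sum>m | sum m UNIV = k. \<Sum>g\<in>{g \<in> S. idx g = m}. \<Prod>j\<in>UNIV. x j ^ idx g j)"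
      using idx by (intro sum.group[symmetric] S finite_multi_indices) auto
    also have "\<dots> = (\<Sum>m | sum m UNIV = k. of_nat (card {g \<in> S. idx g = m}) * (\<Prod>j\<in>UNIV. x j ^ m j))"
      by (intro sum.cong refl) simp
    also have "\<dots> = (\<Sum>m | sum m UNIV = k. (\<Prod>j\<in>UNIV. (z $ j) ^ m j) * A m w)"
      by (intro sum.cong refl) (simp add: A_def x_def power_mult_distrib prod.distrib)
    finally show ?thesis .
  qed
  moreover have "continuous_on UNIV (A m)" for m
    unfolding A_def by (intro continuous_intros)
  ultimately show ?thesis
    by (intro exI[of _ A]) simp
qed

lemma cblinfun_apply_sum: "cblinfun_apply F (\<Sum>i\<in>I. f i) = (\<Sum>i\<in>I. cblinfun_apply F (f i))"
  by (rule linear_sum[OF bounded_linear.linear[OF bounded_linear_cblinfun_apply]])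

lemma homogeneous_poly_scale:
  assumes "homogeneous_poly k P"
  shows "P (c *s z) = c ^ k *\<^sub>C P z"
proof -
  obtain a where a: "\<And>z. P z = (\<Sum>m | sum m UNIV = k. (\<Prod>j\<in>UNIV. (z $ j) ^ m j) *\<^sub>C a m)"
    using assms unfolding homogeneous_poly_def by blast
  have lin: "c ^ k *\<^sub>C (\<Sum>m\<in>T. f m) = (\<Sum>m\<in>T. c ^ k *\<^sub>C f m)" for T and f :: "_ \<Rightarrow> 'b"
    by (rule linear_sum[OF bounded_linear.linear[OF bounded_linear_scaleC]])
  show ?thesis
    unfolding a lin
  proof (rule sum.cong[OF refl])
    fix m :: "'a \<Rightarrow> nat" assume "m \<in> {m. sum m UNIV = k}"
    then have "c ^ k = (\<Prod>j\<in>UNIV. c ^ m j)"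
      by (auto simp: power_sum)
    then show "(\<Prod>j\<in>UNIV. ((c *s z) $ j) ^ m j) *\<^sub>C a m = c ^ k *\<^sub>C (\<Prod>j\<in>UNIV. (z $ j) ^ m j) *\<^sub>C a m"
      by (simp add: power_mult_distrib prod.distrib scaleC_scaleC)
  qed
qed

lemma homogeneous_expansion_unique:
  fixes f :: "complex ^ 'n \<Rightarrow> 'b::complex_normed_vector"
  assumes F: "homogeneous_expansion f F" and F': "homogeneous_expansion f F'"
  shows "F = F'"
proof (intro ext)
  fix k and z :: "complex ^ 'n"
  have ball: "H k v = H' k v" if v: "norm v < 1" and H: "homogeneous_expansion f H" and H': "homogeneous_expansion f H'" for H H' v
  proof (rule eq_functional)
    fix \<phi> :: "('b, complex) cblinfun"
    have coeff: "(deriv ^^ k) (\<lambda>c. cblinfun_apply \<phi> (f (c *s v))) 0 / fact k = cblinfun_apply \<phi> (H k v)"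
      if H: "homogeneous_expansion f H" for H
    proof (rule deriv_of_power_series[where a = "\<lambda>k. cblinfun_apply \<phi> (H k v)"])
      fix c :: complex assume c: "cmod c < 1"
      have "norm (c *s v) < 1"
        using mult_strict_mono'[of "cmod c" 1 "norm v" 1] c v by (simp add: norm_scale_vec)
      then have "(\<lambda>k. H k (c *s v)) sums f (c *s v)"
        using H by (simp add: homogeneous_expansion_def)
      from bounded_linear.sums[OF bounded_linear_cblinfun_apply[of \<phi>] this]
      have sums: "(\<lambda>k. cblinfun_apply \<phi> (H k (c *s v))) sums cblinfun_apply \<phi> (f (c *s v))" .
      have "homogeneous_poly k (H k)" for k
        using H by (simp add: homogeneous_expansion_def)
      then have "H k (c *s v) = c ^ k *\<^sub>C H k v" for k
        by (rule homogeneous_poly_scale)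
      then have "cblinfun_apply \<phi> (H k (c *s v)) = cblinfun_apply \<phi> (H k v) * c ^ k" for k
        by (simp only: cblinfun_apply_scaleC_right scaleC_complex_def mult.commute)
      with sums show "(\<lambda>k. cblinfun_apply \<phi> (H k v) * c ^ k) sums cblinfun_apply \<phi> (f (c *s v))"
        by (simp only:)
    qed
    show "cblinfun_apply \<phi> (H k v) = cblinfun_apply \<phi> (H' k v)"
      using coeff[OF H] coeff[OF H'] by simp
  qed
  \<comment> \<open>This scalar moves an arbitrary z into the ball; homogeneity carries the equality
    back to z.\<close>
  define c where "c = complex_of_real (1 / (norm z + 1))"
  have nz: "0 < norm z + 1"
    by (rule add_nonneg_pos) simp_all
  then have "0 < 1 / (norm z + 1)" by simp
  then have c: "c \<noteq> 0"
    unfolding c_def of_real_eq_0_iff by (rule less_imp_neq[THEN not_sym])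
  have "norm (c *s z) = norm z / (norm z + 1)"
    unfolding norm_scale_vec c_def norm_of_real using nz by simp
  also have "\<dots> < 1"
    unfolding divide_less_eq_1_pos[OF nz] by (rule less_add_one)
  finally have "F k (c *s z) = F' k (c *s z)"
    by (rule ball[OF _ F F'])
  moreover have "homogeneous_poly k (F k)" "homogeneous_poly k (F' k)"
    using F F' by (simp_all add: homogeneous_expansion_def)
  note this[THEN homogeneous_poly_scale, of c z]
  ultimately have "c ^ k *\<^sub>C F k z = c ^ k *\<^sub>C F' k z"
    by (simp only:)
  then have "inverse (c ^ k) *\<^sub>C c ^ k *\<^sub>C F k z = inverse (c ^ k) *\<^sub>C c ^ k *\<^sub>C F' k z"
    by (rule arg_cong)
  then show "F k z = F' k z"
    using c by (simp add: scaleC_scaleC)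
qed

section \<open>Expansion of kernel transforms into homogeneous parts\<close>

definition power_integral :: "real \<Rightarrow> (complex ^ 'n \<Rightarrow> 'b::complex_banach) \<Rightarrow> nat \<Rightarrow> complex ^ 'n \<Rightarrow> 'b"
  where "power_integral \<alpha> b k z = weighted_integral \<alpha> (\<lambda>w. hinner z w ^ k) b"

lemma power_integral_functional:
  fixes b :: "complex ^ 'n \<Rightarrow> 'b::complex_banach"
  assumes b: "ball_integrand \<alpha> b"
  shows "has_bochner_integral (ball_measure \<alpha>) (\<lambda>w. hinner z w ^ k * cblinfun_apply \<phi> (b w)) (cblinfun_apply \<phi> (power_integral \<alpha> b k z))"
  unfolding power_integral_def
proof (rule weighted_integral_functional[OF b])
  show "continuous_on (ball 0 1) (\<lambda>w. hinner z w ^ k)"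
    by (intro continuous_intros)
  show "cmod (hinner z w ^ k) \<le> norm z ^ k" if "norm w < 1" for w
    using hinner_le_left[OF that, of z] by (simp add: norm_power power_mono)
qed

text \<open>After expanding <z,w>^k the monomials in z come out of the integral; the coefficients
  are the integrals of b against the functions \<open>A m\<close>.\<close>

lemma homogeneous_poly_power_integral:
  fixes b :: "complex ^ 'n \<Rightarrow> 'b::complex_banach"
  assumes b: "ball_integrand \<alpha> b"
  shows "homogeneous_poly k (\<lambda>z. c *\<^sub>C power_integral \<alpha> b k z)"
proof -
  from hinner_power_expansion[of k, where 'n = 'n]
  obtain A :: "('n \<Rightarrow> nat) \<Rightarrow> complex ^ 'n \<Rightarrow> complex" where A': "\<forall>m. continuous_on UNIV (A m)"
    "\<forall>z w. hinner z w ^ k = (\<Sum>m | sum m UNIV = k. (\<Prod>j\<in>UNIV. (z $ j) ^ m j) * A m w)"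
    by (elim exE conjE)
  note A = A'(1)[rule_format] A'(2)[rule_format]
  have Af: "has_bochner_integral (ball_measure \<alpha>) (\<lambda>w. A m w * cblinfun_apply \<phi> (b w)) (cblinfun_apply \<phi> (weighted_integral \<alpha> (A m) b))" for m \<phi>
  proof -
    have "compact (A m ` cball 0 1)"
      by (intro compact_continuous_image continuous_on_subset[OF A(1)]) auto
    then obtain B where B: "\<And>w. w \<in> cball 0 1 \<Longrightarrow> cmod (A m w) \<le> B"
      using compact_imp_bounded bounded_iff by (metis (no_types, lifting) imageI)
    show ?thesis
      by (rule weighted_integral_functional[OF b continuous_on_subset[OF A(1)] B]) auto
  qed
  have "c *\<^sub>C power_integral \<alpha> b k z = (\<Sum>m | sum m UNIV = k. (\<Prod>j\<in>UNIV. (z $ j) ^ m j) *\<^sub>C (c *\<^sub>C weighted_integral \<alpha> (A m) b))" for z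
  proof (rule eq_functional)
    fix \<phi> :: "('b, complex) cblinfun"
    have "has_bochner_integral (ball_measure \<alpha>) (\<lambda>w. \<Sum>m | sum m UNIV = k. (\<Prod>j\<in>UNIV. (z $ j) ^ m j) * (A m w * cblinfun_apply \<phi> (b w)))
        (\<Sum>m | sum m UNIV = k. (\<Prod>j\<in>UNIV. (z $ j) ^ m j) * cblinfun_apply \<phi> (weighted_integral \<alpha> (A m) b))"
      by (intro has_bochner_integral_sum has_bochner_integral_mult_right Af)
    moreover have "(\<lambda>w. \<Sum>m | sum m UNIV = k. (\<Prod>j\<in>UNIV. (z $ j) ^ m j) * (A m w * cblinfun_apply \<phi> (b w)))
        = (\<lambda>w. hinner z w ^ k * cblinfun_apply \<phi> (b w))"
      by (simp add: A(2) sum_distrib_right mult.assoc fun_eq_iff)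
    ultimately have "cblinfun_apply \<phi> (power_integral \<alpha> b k z)
        = (\<Sum>m | sum m UNIV = k. (\<Prod>j\<in>UNIV. (z $ j) ^ m j) * cblinfun_apply \<phi> (weighted_integral \<alpha> (A m) b))"
      using has_bochner_integral_eq[OF power_integral_functional[OF b]] by simp
    then show "cblinfun_apply \<phi> (c *\<^sub>C power_integral \<alpha> b k z)
        = cblinfun_apply \<phi> (\<Sum>m | sum m UNIV = k. (\<Prod>j\<in>UNIV. (z $ j) ^ m j) *\<^sub>C (c *\<^sub>C weighted_integral \<alpha> (A m) b))"
      by (simp add: cblinfun_apply_sum cblinfun_apply_scaleC_right scaleC_complex_def sum_distrib_left mult.left_commute)
  qed
  then show ?thesis
    unfolding homogeneous_poly_def
    by (intro exI[of _ "\<lambda>m. c *\<^sub>C weighted_integral \<alpha> (A m) b"] allI)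
qed

text \<open>The tail of the complex series is dominated by the tail of the real series at r, so the
  error does not depend on u and tends to 0.\<close>

lemma kern_partial_sum:
  assumes u: "cmod u \<le> r" "r < 1" and t: "0 \<le> t"
  shows "cmod ((\<Sum>k<N. of_real (kern_coeff t k) * u ^ k) - kern t u) \<le> (1 - r) powr (- t) - (\<Sum>k<N. kern_coeff t k * r ^ k)"
proof -
  have r: "0 \<le> r" using u norm_ge_zero order_trans by blast
  have u1: "cmod u < 1" using u by simp
  have 1: "(\<lambda>k. of_real (kern_coeff t (k + N)) * u ^ (k + N)) sums (kern t u - (\<Sum>k<N. of_real (kern_coeff t k) * u ^ k))"
    by (rule sums_split_initial_segment[OF kern_sums[OF u1]])
  have 2: "(\<lambda>k. kern_coeff t (k + N) * r ^ (k + N)) sums ((1 - r) powr (- t) - (\<Sum>k<N. kern_coeff t k * r ^ k))"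
    by (rule sums_split_initial_segment[OF kern_sums_real[OF r u(2)]])
  have "cmod (\<Sum>k. of_real (kern_coeff t (k + N)) * u ^ (k + N)) \<le> (\<Sum>k. kern_coeff t (k + N) * r ^ (k + N))"
    using kern_coeff_nonneg[OF t] u
    by (intro norm_suminf_le sums_summable[OF 2]) (auto simp: norm_mult norm_power intro!: mult_left_mono power_mono)
  then show ?thesis
    by (simp add: sums_unique[OF 1, symmetric] sums_unique[OF 2, symmetric] norm_minus_commute)
qed

text \<open>The binomial series converges uniformly in w for fixed z. The difference between a
  partial sum and the transform is an integral of b against a uniformly small weight.\<close>

lemma kern_transform_sums:
  fixes b :: "complex ^ 'n \<Rightarrow> 'b::complex_banach"
  assumes b: "ball_integrand \<alpha> b" and z: "norm z < 1" and t: "0 \<le> t"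
  shows "(\<lambda>k. of_real (kern_coeff t k) *\<^sub>C power_integral \<alpha> b k z) sums kern_transform \<alpha> t b z"
  unfolding sums_def
proof (rule LIM_zero_cancel, rule Lim_null_comparison)
  let ?I = "\<integral>w. norm (b w) \<partial>ball_measure \<alpha>"
  define \<tau> where "\<tau> N = (1 - norm z) powr (- t) - (\<Sum>k<N. kern_coeff t k * norm z ^ k)" for N
  have "(\<lambda>k. kern_coeff t k * norm z ^ k) sums ((1 - norm z) powr (- t))"
    using z by (intro kern_sums_real) auto
  then have "\<tau> \<longlonglongrightarrow> (1 - norm z) powr (- t) - (1 - norm z) powr (- t)"
    unfolding \<tau>_def sums_def by (intro tendsto_intros)
  then have "(\<lambda>N. \<tau> N * ?I) \<longlonglongrightarrow> ((1 - norm z) powr (- t) - (1 - norm z) powr (- t)) * ?I"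
    by (intro tendsto_intros)
  then show "(\<lambda>N. \<tau> N * ?I) \<longlonglongrightarrow> 0" by simp
  have "norm ((\<Sum>k<N. of_real (kern_coeff t k) *\<^sub>C power_integral \<alpha> b k z) - kern_transform \<alpha> t b z) \<le> \<tau> N * ?I" for N
  proof (rule norm_weighted_integral_diff_le[OF b])
    show "continuous_on (ball 0 1) (\<lambda>w. (\<Sum>k<N. of_real (kern_coeff t k) * hinner z w ^ k) - kern t (hinner z w))"
      using z by (intro continuous_intros continuous_on_kern_hinner)
    show "cmod ((\<Sum>k<N. of_real (kern_coeff t k) * hinner z w ^ k) - kern t (hinner z w)) \<le> \<tau> N" if "norm w < 1" for w
      unfolding \<tau>_def by (rule kern_partial_sum[OF hinner_le_left[OF that] z t])
    fix \<phi> :: "('b, complex) cblinfun"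
    have "has_bochner_integral (ball_measure \<alpha>)
        (\<lambda>w. (\<Sum>k<N. of_real (kern_coeff t k) * (hinner z w ^ k * cblinfun_apply \<phi> (b w))) - kern t (hinner z w) * cblinfun_apply \<phi> (b w))
        ((\<Sum>k<N. of_real (kern_coeff t k) * cblinfun_apply \<phi> (power_integral \<alpha> b k z)) - cblinfun_apply \<phi> (kern_transform \<alpha> t b z))"
      by (intro has_bochner_integral_diff has_bochner_integral_sum has_bochner_integral_mult_right
          power_integral_functional[OF b] kern_transform_functional[OF b z t])
    then show "has_bochner_integral (ball_measure \<alpha>)
        (\<lambda>w. ((\<Sum>k<N. of_real (kern_coeff t k) * hinner z w ^ k) - kern t (hinner z w)) * cblinfun_apply \<phi> (b w))
        (cblinfun_apply \<phi> ((\<Sum>k<N. of_real (kern_coeff t k) *\<^sub>C power_integral \<alpha> b k z) - kern_transform \<alpha> t b z))"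
      by (simp add: cblinfun_apply_diff_right cblinfun_apply_sum cblinfun_apply_scaleC_right scaleC_complex_def
          left_diff_distrib sum_distrib_right mult.assoc)
  qed
  then show "\<forall>\<^sub>F N in sequentially. norm ((\<Sum>k<N. of_real (kern_coeff t k) *\<^sub>C power_integral \<alpha> b k z) - kern_transform \<alpha> t b z) \<le> \<tau> N * ?I"
    by (rule always_eventually[OF allI])
qed

lemma holomorphic_ball_functional:
  fixes b :: "complex ^ 'n \<Rightarrow> 'b::complex_normed_vector"
  assumes "holomorphic_ball b"
  shows "holomorphic_ball (\<lambda>w. cblinfun_apply \<phi> (b w))"
  unfolding holomorphic_ball_def
proof
  fix z :: "complex ^ 'n" assume "z \<in> ball 0 1"
  then obtain b' where b': "(b has_derivative b') (at z)" "\<And>c v. b' (c *s v) = c *\<^sub>C b' v"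
    using assms unfolding holomorphic_ball_def by blast
  then show "\<exists>f'. ((\<lambda>w. cblinfun_apply \<phi> (b w)) has_derivative f') (at z) \<and> (\<forall>c v. f' (c *s v) = c *\<^sub>C f' v)"
    by (intro exI[of _ "\<lambda>v. cblinfun_apply \<phi> (b' v)"])
      (simp add: bounded_linear.has_derivative[OF bounded_linear_cblinfun_apply] cblinfun_apply_scaleC_right)
qed

lemma kern_transform_reproducing:
  fixes b :: "complex ^ 'n \<Rightarrow> 'b::complex_banach"
  assumes b: "ball_integrand \<alpha> b" and hol: "holomorphic_ball b" and z: "norm z < 1"
  shows "kern_transform \<alpha> (real CARD('n) + 1 + \<alpha>) b z = b z"
proof (rule eq_functional)
  fix \<phi> :: "('b, complex) cblinfun"
  have \<alpha>: "-1 < \<alpha>" and bc: "continuous_on (ball 0 1) b"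
    using b by (auto simp: ball_integrand_def)
  have "integrable (ball_measure \<alpha>) (\<lambda>w. cblinfun_apply \<phi> (b w))"
    using weighted_integral_functional[OF b, of "\<lambda>_. 1" 1 \<phi>] by (auto simp: has_bochner_integral_iff)
  from reproducing[OF holomorphic_ball_functional[OF hol] this \<alpha> z]
  show "cblinfun_apply \<phi> (kern_transform \<alpha> (real CARD('n) + 1 + \<alpha>) b z) = cblinfun_apply \<phi> (b z)"
    using has_bochner_integral_integral_eq[OF kern_transform_functional[OF b z, of "real CARD('n) + 1 + \<alpha>" \<phi>]] \<alpha>
    by (simp add: mult.commute)
qed

text \<open>Expanding the reproducing kernel in \<open>kern_transform_reproducing\<close> produces a
  homogeneous expansion of b, and uniqueness identifies it with the one chosen by the definite
  description.\<close>

lemma homogeneous_part_eq: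
  fixes b :: "complex ^ 'n \<Rightarrow> 'b::complex_banach"
  assumes b: "ball_integrand \<alpha> b" and hol: "holomorphic_ball b"
  shows "homogeneous_part b = (\<lambda>k z. of_real (kern_coeff (real CARD('n) + 1 + \<alpha>) k) *\<^sub>C power_integral \<alpha> b k z)"
  unfolding homogeneous_part_def
proof (rule the_equality)
  have \<alpha>: "-1 < \<alpha>" using b by (simp add: ball_integrand_def)
  show *: "homogeneous_expansion b (\<lambda>k z. of_real (kern_coeff (real CARD('n) + 1 + \<alpha>) k) *\<^sub>C power_integral \<alpha> b k z)"
    unfolding homogeneous_expansion_def
  proof (intro conjI allI ballI homogeneous_poly_power_integral[OF b])
    fix z :: "complex ^ 'n" assume "z \<in> ball 0 1"
    then have z: "norm z < 1" by simp
    show "(\<lambda>k. of_real (kern_coeff (real CARD('n) + 1 + \<alpha>) k) *\<^sub>C power_integral \<alpha> b k z) sums b z"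
      using kern_transform_sums[OF b z, of "real CARD('n) + 1 + \<alpha>"] \<alpha>
      by (simp add: kern_transform_reproducing[OF b hol z])
  qed
  show "F = (\<lambda>k z. of_real (kern_coeff (real CARD('n) + 1 + \<alpha>) k) *\<^sub>C power_integral \<alpha> b k z)"
    if "homogeneous_expansion b F" for F
    by (rule homogeneous_expansion_unique[OF that *])
qed

text \<open>The Gamma quotient in \<open>frac_deriv\<close> is the ratio of the k-th binomial
  coefficients for the exponents s + t and s, where s = n + 1 + \<alpha>. Multiplying the expansion
  by it raises the exponent of the reproducing kernel by t.\<close>

lemma frac_deriv_eq:
  fixes b :: "complex ^ 'n \<Rightarrow> 'b::complex_banach"
  assumes b: "ball_integrand \<alpha> b" and hol: "holomorphic_ball b" and z: "norm z < 1" and t: "0 \<le> t"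
  shows "frac_deriv \<alpha> t b z = kern_transform \<alpha> (real CARD('n) + 1 + \<alpha> + t) b z"
proof -
  define s where "s = real CARD('n) + 1 + \<alpha>"
  have s: "0 < s" using b by (simp add: s_def ball_integrand_def)
  have "(Gamma (real CARD('n) + 1 + \<alpha>) * Gamma (real CARD('n) + 1 + real k + \<alpha> + t)
         / (Gamma (real CARD('n) + 1 + \<alpha> + t) * Gamma (real CARD('n) + 1 + real k + \<alpha>)))
       *\<^sub>R homogeneous_part b k z = of_real (kern_coeff (s + t) k) *\<^sub>C power_integral \<alpha> b k z" for k
  proof -
    have pos: "0 < Gamma s" "0 < Gamma (s + real k)"
      using s by (simp_all add: Gamma_real_pos add_pos_nonneg)
    have "Gamma s * Gamma (s + t + real k) / (Gamma (s + t) * Gamma (s + real k)) * kern_coeff s k = kern_coeff (s + t) k"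
      using s t pos(1)[THEN less_imp_neq, THEN not_sym] pos(2)[THEN less_imp_neq, THEN not_sym]
      by (simp add: kern_coeff_Gamma)
    moreover have "real CARD('n) + 1 + real k + \<alpha> + t = s + t + real k" "real CARD('n) + 1 + \<alpha> + t = s + t"
      "real CARD('n) + 1 + real k + \<alpha> = s + real k"
      by (simp_all add: s_def)
    ultimately show ?thesis
      unfolding homogeneous_part_eq[OF b hol] s_def[symmetric] scaleR_scaleC scaleC_scaleC of_real_mult[symmetric]
      by (simp only:)
  qed
  then have "frac_deriv \<alpha> t b z = (\<Sum>k. of_real (kern_coeff (s + t) k) *\<^sub>C power_integral \<alpha> b k z)"
    unfolding frac_deriv_def by (simp only:)
  also have "\<dots> = kern_transform \<alpha> (s + t) b z"
    using s t by (intro sums_unique[symmetric] kern_transform_sums[OF b z]) simp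
  finally show ?thesis
    by (simp add: s_def)
qed

section \<open>Lowering the order of the derivative\<close>

lemma kern_step: "cmod u < 1 \<Longrightarrow> kern c u + u * kern (c + 1) u = kern (c + 1) u"
proof -
  assume u: "cmod u < 1"
  then have "kern (-1) u = 1 - u"
    by (auto simp: kern_powr)
  then have "kern c u = (1 - u) * kern (c + 1) u"
    using kern_mult[of "-1" u "c + 1"] by simp
  then show ?thesis
    by (simp add: algebra_simps)
qed

text \<open>The kernel identity says that \<open>r powr c *\<^sub>R kern_transform \<alpha> c b (r z)\<close> has derivative
  \<open>c r powr (c - 1) *\<^sub>R kern_transform \<alpha> (c + 1) b (r z)\<close>.\<close>

lemma kern_transform_descent:
  fixes b :: "complex ^ 'n \<Rightarrow> 'b::complex_banach"
  assumes b: "ball_integrand \<alpha> b" and c: "1 \<le> c" and \<kappa>: "0 < \<kappa>" and M: "0 \<le> M"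
    and bound: "\<And>z. norm z < 1 \<Longrightarrow> norm (kern_transform \<alpha> (c + 1) b z) \<le> M * (1 - (norm z)\<^sup>2) powr (- (\<kappa> + 1))"
    and z: "norm z < 1"
  shows "norm (kern_transform \<alpha> c b z) \<le> c * 2 powr (2 * \<kappa> + 1) / \<kappa> * M * (1 - (norm z)\<^sup>2) powr (- \<kappa>)"
proof -
  define \<delta> where "\<delta> = 1 - norm z"
  have \<delta>: "0 < \<delta>" "\<delta> \<le> 1" using z by (auto simp: \<delta>_def)
  define A where "A = c * 2 powr (\<kappa> + 1) / \<kappa> * M"
  have A: "0 \<le> A" using c \<kappa> M by (simp add: A_def)
  define f where "f r = r powr c *\<^sub>R kern_transform \<alpha> c b (r *\<^sub>R z)" for r
  \<comment> \<open>An antiderivative of the majorant of the derivative of f; integrating gains one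
    power. The base combines 1 - r with \<delta> = 1 - |z| and stays positive up to r = 1. As c > 0,
    f vanishes at 0, so the increment of f over the unit interval is the value sought.\<close>
  define \<psi> where "\<psi> r = A * (1 - r + \<delta>) powr (- \<kappa>)" for r
  have rz: "norm (r *\<^sub>R z) < 1" if "0 \<le> r" "r \<le> 1" for r
    using mult_left_mono[of r 1 "norm z"] that z by (simp add: mult.commute)
  have "norm (f 1 - f 0) \<le> \<psi> 1 - \<psi> 0"
  proof (rule differentiable_bound_general[where f' = "\<lambda>r. (c * r powr (c - 1)) *\<^sub>R kern_transform \<alpha> (c + 1) b (r *\<^sub>R z)"
        and \<phi>' = "\<lambda>r. A * (\<kappa> * (1 - r + \<delta>) powr (- \<kappa> - 1))"])
    have kc: "continuous_on (ball 0 1) (kern_transform \<alpha> c b)"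
      using c by (intro holomorphic_ball_continuous holomorphic_kern_transform b) simp
    show "continuous_on {0..1} f"
      unfolding f_def using c rz
      by (intro continuous_intros continuous_on_powr' continuous_on_compose2[OF kc]) auto
    show "continuous_on {0..1} \<psi>"
      unfolding \<psi>_def using \<delta> by (intro continuous_intros) auto
    fix x :: real assume x: "0 < x" "x < 1"
    have xz: "norm (x *\<^sub>R z) < 1"
      using rz x by simp
    have "((\<lambda>r. kern_transform \<alpha> c b (r *\<^sub>R z)) has_derivative
        (\<lambda>h. kern_transform_deriv \<alpha> c b (x *\<^sub>R z) (h *\<^sub>R z))) (at x)"
    proof -
      have "((\<lambda>r. r *\<^sub>R z) has_derivative (\<lambda>h. h *\<^sub>R z)) (at x)"
        by (auto intro!: derivative_eq_intros)
      from diff_chain_at[OF this kern_transform_has_derivative(1)[OF b xz]] c show ?thesis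
        by (simp add: o_def)
    qed
    then have D1: "((\<lambda>r. kern_transform \<alpha> c b (r *\<^sub>R z)) has_vector_derivative kern_transform_deriv \<alpha> c b (x *\<^sub>R z) z) (at x)"
      unfolding has_vector_derivative_def
      using kern_transform_has_derivative(2)[OF b xz, of c] c by (simp add: scaleR_eq_scale scaleR_scaleC)
    have D2: "((\<lambda>r. r powr c) has_real_derivative c * x powr (c - 1)) (at x)"
      using x by (intro has_real_derivative_powr)
    have "(f has_vector_derivative (x powr c *\<^sub>R kern_transform_deriv \<alpha> c b (x *\<^sub>R z) z
        + (c * x powr (c - 1)) *\<^sub>R kern_transform \<alpha> c b (x *\<^sub>R z))) (at x)"
      unfolding f_def by (rule has_vector_derivative_scaleR[OF D2 D1])
    moreover have "x powr c *\<^sub>R kern_transform_deriv \<alpha> c b (x *\<^sub>R z) z + (c * x powr (c - 1)) *\<^sub>R kern_transform \<alpha> c b (x *\<^sub>R z)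
        = (c * x powr (c - 1)) *\<^sub>R kern_transform \<alpha> (c + 1) b (x *\<^sub>R z)" (is "?L = ?R")
    proof (rule eq_functional)
      fix \<phi> :: "('b, complex) cblinfun"
      have c0: "0 \<le> c" "0 \<le> c + 1" using c by auto
      define u where "u w = hinner (x *\<^sub>R z) w" for w
      have xc: "x powr c = x * x powr (c - 1)"
        using x by (simp add: powr_diff)
      have int: "has_bochner_integral (ball_measure \<alpha>)
          (\<lambda>w. of_real (x powr c) * (of_real c * kern (c + 1) (u w) * hinner z w * cblinfun_apply \<phi> (b w))
            + of_real (c * x powr (c - 1)) * (kern c (u w) * cblinfun_apply \<phi> (b w))) (cblinfun_apply \<phi> ?L)"
        unfolding u_def cblinfun_apply_add_right scaleR_scaleC cblinfun_apply_scaleC_right scaleC_complex_def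
        by (intro has_bochner_integral_add has_bochner_integral_mult_right kern_transform_functional[OF b xz c0(1)]
            kern_transform_deriv_functional[OF b xz c0(1)])
      have int': "has_bochner_integral (ball_measure \<alpha>)
          (\<lambda>w. of_real (c * x powr (c - 1)) * (kern (c + 1) (u w) * cblinfun_apply \<phi> (b w))) (cblinfun_apply \<phi> ?R)"
        unfolding u_def scaleR_scaleC cblinfun_apply_scaleC_right scaleC_complex_def
        by (intro has_bochner_integral_mult_right kern_transform_functional[OF b xz c0(2)])
      have "of_real (x powr c) * (of_real c * kern (c + 1) (u w) * hinner z w * cblinfun_apply \<phi> (b w))
            + of_real (c * x powr (c - 1)) * (kern c (u w) * cblinfun_apply \<phi> (b w))
          = of_real (c * x powr (c - 1)) * (kern (c + 1) (u w) * cblinfun_apply \<phi> (b w))" if "norm w < 1" for w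
      proof -
        have uw: "u w = of_real x * hinner z w"
          by (simp add: u_def hinner_scaleR_left)
        have "cmod (u w) < 1"
          unfolding u_def by (rule norm_hinner_less_1[OF xz that])
        from kern_step[OF this, of c]
        have k: "kern (c + 1) (u w) * X = kern c (u w) * X + of_real x * hinner z w * kern (c + 1) (u w) * X" for X
          unfolding uw[symmetric] by (metis distrib_right)
        show ?thesis
          unfolding xc of_real_mult by (subst k) (simp add: algebra_simps)
      qed
      then have "(\<integral>w. of_real (x powr c) * (of_real c * kern (c + 1) (u w) * hinner z w * cblinfun_apply \<phi> (b w))
            + of_real (c * x powr (c - 1)) * (kern c (u w) * cblinfun_apply \<phi> (b w)) \<partial>ball_measure \<alpha>)
          = (\<integral>w. of_real (c * x powr (c - 1)) * (kern (c + 1) (u w) * cblinfun_apply \<phi> (b w)) \<partial>ball_measure \<alpha>)"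
        by (intro Bochner_Integration.integral_cong refl) (simp add: space_ball_measure)
      then show "cblinfun_apply \<phi> ?L = cblinfun_apply \<phi> ?R"
        using has_bochner_integral_integral_eq[OF int] has_bochner_integral_integral_eq[OF int'] by simp
    qed
    ultimately show "(f has_vector_derivative (c * x powr (c - 1)) *\<^sub>R kern_transform \<alpha> (c + 1) b (x *\<^sub>R z)) (at x)"
      by simp
    show "(\<psi> has_vector_derivative A * (\<kappa> * (1 - x + \<delta>) powr (- \<kappa> - 1))) (at x)"
      unfolding \<psi>_def has_real_derivative_iff_has_vector_derivative[symmetric]
      using x \<delta> by (auto intro!: derivative_eq_intros simp: powr_diff)
    \<comment> \<open>The number x |z| is at most both x and |z|, so 1 - |x z|^2 is at least their
      complements 1 - x and \<delta>, hence at least the mean of these.\<close>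
    have "((1 - x + \<delta>) / 2) \<le> 1 - (norm (x *\<^sub>R z))\<^sup>2"
    proof -
      have arith: "(1 - a + (1 - b)) / 2 \<le> 1 - q" if "p \<le> a" "p \<le> b" "q \<le> p" for a b p q :: real
        using that by (simp add: field_simps)
      have "x * norm z \<le> x" "x * norm z \<le> norm z" "(x * norm z)\<^sup>2 \<le> x * norm z"
        using x z by (simp_all add: mult_left_le mult_left_le_one_le power2_eq_square mult_le_one)
      moreover have "norm (x *\<^sub>R z) = x * norm z"
        using x by simp
      ultimately show ?thesis
        unfolding \<delta>_def using arith[of "x * norm z" x "norm z" "(x * norm z)\<^sup>2"] by metis
    qed
    then have "(1 - (norm (x *\<^sub>R z))\<^sup>2) powr (- (\<kappa> + 1)) \<le> ((1 - x + \<delta>) / 2) powr (- (\<kappa> + 1))"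
      using x \<delta> \<kappa> by (intro powr_mono2') auto
    also have "\<dots> = 2 powr (\<kappa> + 1) * (1 - x + \<delta>) powr (- \<kappa> - 1)"
    proof -
      have "0 < 1 - x + \<delta>" using x \<delta> by linarith
      then have "((1 - x + \<delta>) / 2) powr (- (\<kappa> + 1)) = (1 - x + \<delta>) powr (- (\<kappa> + 1)) / 2 powr (- (\<kappa> + 1))"
        by (simp add: powr_divide)
      also have "\<dots> = (1 - x + \<delta>) powr (- (\<kappa> + 1)) * 2 powr (\<kappa> + 1)"
        unfolding powr_minus[of 2] divide_inverse inverse_inverse_eq ..
      finally have eq: "((1 - x + \<delta>) / 2) powr (- (\<kappa> + 1)) = (1 - x + \<delta>) powr (- (\<kappa> + 1)) * 2 powr (\<kappa> + 1)" .
      have "- (\<kappa> + 1) = - \<kappa> - 1" by simp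
      with eq show ?thesis by (simp only: mult.commute)
    qed
    finally have le: "(1 - (norm (x *\<^sub>R z))\<^sup>2) powr (- (\<kappa> + 1)) \<le> 2 powr (\<kappa> + 1) * (1 - x + \<delta>) powr (- \<kappa> - 1)" .
    \<comment> \<open>This is where c \<ge> 1 enters: the factor from differentiating
      \<open>r powr c\<close> stays bounded near r = 0.\<close>
    have "x powr (c - 1) \<le> 1"
      using x c by (intro powr_le1) auto
    then have "norm ((c * x powr (c - 1)) *\<^sub>R kern_transform \<alpha> (c + 1) b (x *\<^sub>R z)) \<le> c * norm (kern_transform \<alpha> (c + 1) b (x *\<^sub>R z))"
      using c by (simp add: mult_right_mono mult_left_le)
    also have "\<dots> \<le> c * (M * (2 powr (\<kappa> + 1) * (1 - x + \<delta>) powr (- \<kappa> - 1)))"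
      using c M by (intro mult_left_mono order_trans[OF bound[OF xz]] le) auto
    also have "\<dots> = A * (\<kappa> * (1 - x + \<delta>) powr (- \<kappa> - 1))"
      using \<kappa> by (simp add: A_def)
    finally show "norm ((c * x powr (c - 1)) *\<^sub>R kern_transform \<alpha> (c + 1) b (x *\<^sub>R z)) \<le> A * (\<kappa> * (1 - x + \<delta>) powr (- \<kappa> - 1))" .
  qed simp
  then have "norm (kern_transform \<alpha> c b z) \<le> A * \<delta> powr (- \<kappa>) - A * (1 + \<delta>) powr (- \<kappa>)"
    using c by (simp add: f_def \<psi>_def)
  also have "\<dots> \<le> A * \<delta> powr (- \<kappa>)"
    using A by simp
  also have "\<dots> \<le> A * (2 powr \<kappa> * (1 - (norm z)\<^sup>2) powr (- \<kappa>))"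
  proof (intro mult_left_mono A)
    have "(1 - (norm z)\<^sup>2) / 2 \<le> \<delta>"
    proof -
      have "1 - (norm z)\<^sup>2 = \<delta> * (1 + norm z)"
        by (simp add: \<delta>_def power2_eq_square algebra_simps)
      also have "\<dots> \<le> \<delta> * 2"
        using \<delta> z by (intro mult_left_mono) auto
      finally show ?thesis by simp
    qed
    then have "\<delta> powr (- \<kappa>) \<le> ((1 - (norm z)\<^sup>2) / 2) powr (- \<kappa>)"
      using norm_sq_less_1[OF z] \<kappa> by (intro powr_mono2') auto
    also have "\<dots> = 2 powr \<kappa> * (1 - (norm z)\<^sup>2) powr (- \<kappa>)"
    proof -
      have "((1 - (norm z)\<^sup>2) / 2) powr (- \<kappa>) = (1 - (norm z)\<^sup>2) powr (- \<kappa>) / 2 powr (- \<kappa>)"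
        using norm_sq_less_1[OF z] by (simp add: powr_divide)
      also have "\<dots> = (1 - (norm z)\<^sup>2) powr (- \<kappa>) * 2 powr \<kappa>"
        unfolding powr_minus[of 2] divide_inverse inverse_inverse_eq ..
      finally show ?thesis by (simp only: mult.commute)
    qed
    finally show "\<delta> powr (- \<kappa>) \<le> 2 powr \<kappa> * (1 - (norm z)\<^sup>2) powr (- \<kappa>)" .
  qed
  \<comment> \<open>The powers of 2 are \<kappa> + 1 from the mean of 1 - x and \<delta>, and
    \<kappa> from replacing \<delta> by (1 - |z|^2) / 2.\<close>
  also have "\<dots> = c * 2 powr (2 * \<kappa> + 1) / \<kappa> * M * (1 - (norm z)\<^sup>2) powr (- \<kappa>)"
  proof -
    have "2 powr (\<kappa> + 1) * 2 powr \<kappa> = 2 powr (2 * \<kappa> + 1)"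
      by (simp add: powr_add[symmetric])
    then show ?thesis
      by (simp add: A_def)
  qed
  finally show ?thesis .
qed

text \<open>Each step lowers the order by one while the exponent k + j - \<gamma> remains positive,
  which is why the descent may stop at any k > \<gamma>. The constant is quantified before b and M,
  so it survives as a constant of the norm equivalence.\<close>

lemma kern_transform_descent_iterated:
  fixes s \<gamma> :: real
  assumes s: "1 \<le> s" and k: "\<gamma> < real k"
  shows "\<exists>C>0. \<forall>b :: complex ^ 'n \<Rightarrow> 'b::complex_banach. \<forall>M\<ge>0. ball_integrand \<alpha> b \<longrightarrow>
    (\<forall>z. norm z < 1 \<longrightarrow> norm (kern_transform \<alpha> (s + real (k + j)) b z) \<le> M * (1 - (norm z)\<^sup>2) powr (- (real (k + j) - \<gamma>))) \<longrightarrow>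
    (\<forall>z. norm z < 1 \<longrightarrow> norm (kern_transform \<alpha> (s + real k) b z) \<le> C * M * (1 - (norm z)\<^sup>2) powr (- (real k - \<gamma>)))"
proof (induction j)
  case 0
  show ?case by (intro exI[of _ 1]) auto
next
  case (Suc j)
  then obtain C where C: "0 < C" and IH: "\<And>(b :: complex ^ 'n \<Rightarrow> 'b) M z. \<lbrakk>0 \<le> M; ball_integrand \<alpha> b;
      \<forall>z. norm z < 1 \<longrightarrow> norm (kern_transform \<alpha> (s + real (k + j)) b z) \<le> M * (1 - (norm z)\<^sup>2) powr (- (real (k + j) - \<gamma>));
      norm z < 1\<rbrakk> \<Longrightarrow> norm (kern_transform \<alpha> (s + real k) b z) \<le> C * M * (1 - (norm z)\<^sup>2) powr (- (real k - \<gamma>))"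
    by blast
  define c where "c = s + real (k + j)"
  define \<kappa> where "\<kappa> = real (k + j) - \<gamma>"
  have c: "1 \<le> c" and \<kappa>: "0 < \<kappa>" using s k by (auto simp: c_def \<kappa>_def)
  have Sc: "s + real (k + Suc j) = c + 1" "real (k + Suc j) - \<gamma> = \<kappa> + 1"
    by (simp_all add: c_def \<kappa>_def)
  define C' where "C' = c * 2 powr (2 * \<kappa> + 1) / \<kappa>"
  have C': "0 < C'" using c \<kappa> by (simp add: C'_def)
  show ?case
  proof (intro exI[of _ "C * C'"] conjI allI impI)
    show "0 < C * C'" using C C' by simp
    fix b :: "complex ^ 'n \<Rightarrow> 'b" and M and z :: "complex ^ 'n"
    assume M: "0 \<le> M" and b: "ball_integrand \<alpha> b" and z: "norm z < 1"
      and bound: "\<forall>z. norm z < 1 \<longrightarrow> norm (kern_transform \<alpha> (s + real (k + Suc j)) b z) \<le> M * (1 - (norm z)\<^sup>2) powr (- (real (k + Suc j) - \<gamma>))"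
    have "norm (kern_transform \<alpha> (s + real (k + j)) b z) \<le> C' * M * (1 - (norm z)\<^sup>2) powr (- (real (k + j) - \<gamma>))" if "norm z < 1" for z
      unfolding c_def[symmetric] \<kappa>_def[symmetric] C'_def
      using bound unfolding Sc by (intro kern_transform_descent[OF b c \<kappa> M _ that]) blast
    then show "norm (kern_transform \<alpha> (s + real k) b z) \<le> C * C' * M * (1 - (norm z)\<^sup>2) powr (- (real k - \<gamma>))"
      using IH[of "C' * M" b z] M C' b z by (simp add: mult.assoc)
  qed
qed

section \<open>Integral inequalities\<close>

text \<open>Young's inequality pointwise: directly for integrability, and after normalizing both
  factors for the estimate. If one of the integrals is zero, the product vanishes almost
  everywhere.\<close>

lemma holder_inequality:
  fixes f g :: "'a \<Rightarrow> real"
  assumes pq: "1 < p" "1 < q" "1 / p + 1 / q = 1"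
    and m: "f \<in> borel_measurable M" "g \<in> borel_measurable M"
    and nn: "\<And>x. 0 \<le> f x" "\<And>x. 0 \<le> g x"
    and int: "integrable M (\<lambda>x. f x powr p)" "integrable M (\<lambda>x. g x powr q)"
  shows "integrable M (\<lambda>x. f x * g x)"
    "(\<integral>x. f x * g x \<partial>M) \<le> (\<integral>x. f x powr p \<partial>M) powr (1 / p) * (\<integral>x. g x powr q \<partial>M) powr (1 / q)"
proof -
  have young: "x * y \<le> x powr p / p + y powr q / q" if "0 \<le> x" "0 \<le> y" for x y
    using Youngs_inequality[OF pq(1,2,3) that] .
  show intfg: "integrable M (\<lambda>x. f x * g x)"
  proof (rule Bochner_Integration.integrable_bound)
    show "integrable M (\<lambda>x. f x powr p / p + g x powr q / q)"
      using int by (intro Bochner_Integration.integrable_add integrable_divide) auto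
    show "AE x in M. norm (f x * g x) \<le> norm (f x powr p / p + g x powr q / q)"
      using young[OF nn] nn pq by (intro AE_I2) (simp add: abs_mult)
  qed (use m in measurable)
  define A where "A = (\<integral>x. f x powr p \<partial>M)"
  define B where "B = (\<integral>x. g x powr q \<partial>M)"
  have AB: "0 \<le> A" "0 \<le> B" by (simp_all add: A_def B_def)
  consider "A = 0" | "B = 0" | "0 < A" "0 < B" using AB by linarith
  then have "(\<integral>x. f x * g x \<partial>M) \<le> A powr (1 / p) * B powr (1 / q)"
  proof cases
    case 1
    then have "AE x in M. f x powr p = 0"
      unfolding A_def using integral_nonneg_eq_0_iff_AE[OF int(1)] by simp
    then have "AE x in M. f x * g x = 0"
      by eventually_elim simp
    then have "(\<integral>x. f x * g x \<partial>M) = 0"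
      using integral_cong_AE[of "\<lambda>x. f x * g x" M "\<lambda>_. 0"] m by simp
    then show ?thesis by simp
  next
    case 2
    then have "AE x in M. g x powr q = 0"
      unfolding B_def using integral_nonneg_eq_0_iff_AE[OF int(2)] by simp
    then have "AE x in M. f x * g x = 0"
      by eventually_elim simp
    then have "(\<integral>x. f x * g x \<partial>M) = 0"
      using integral_cong_AE[of "\<lambda>x. f x * g x" M "\<lambda>_. 0"] m by simp
    then show ?thesis by simp
  next
    case 3
    define a where "a = A powr (1 / p)"
    define b where "b = B powr (1 / q)"
    have ab: "0 < a" "0 < b" using 3 by (simp_all add: a_def b_def)
    have pw: "a powr p = A" "b powr q = B"
      using 3 pq by (simp_all add: a_def b_def powr_powr)
    have "f x * g x / (a * b) \<le> f x powr p / A / p + g x powr q / B / q" for x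
    proof -
      have "f x / a * (g x / b) \<le> (f x / a) powr p / p + (g x / b) powr q / q"
        using nn ab by (intro young) auto
      moreover have "(f x / a) powr p = f x powr p / A" "(g x / b) powr q = g x powr q / B"
        using nn ab by (simp_all add: powr_divide pw)
      ultimately show ?thesis by simp
    qed
    then have "(\<integral>x. f x * g x / (a * b) \<partial>M) \<le> (\<integral>x. f x powr p / A / p + g x powr q / B / q \<partial>M)"
      using int intfg by (intro integral_mono) auto
    also have "\<dots> = A / A / p + B / B / q"
      using int by (simp add: A_def B_def)
    also have "\<dots> = 1"
      using 3 pq by simp
    finally have "(\<integral>x. f x * g x \<partial>M) / (a * b) \<le> 1"
      by simp
    then show ?thesis
      using ab unfolding a_def[symmetric] b_def[symmetric] by (simp add: divide_le_eq)
  qed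
  then show "(\<integral>x. f x * g x \<partial>M) \<le> (\<integral>x. f x powr p \<partial>M) powr (1 / p) * (\<integral>x. g x powr q \<partial>M) powr (1 / q)"
    unfolding A_def B_def .
qed

section \<open>Weighted kernel integrals, Schur's test and point evaluation\<close>

lemma measurable_ball_pair:
  fixes Q :: "(complex ^ 'n) \<times> (complex ^ 'n) \<Rightarrow> 'b::topological_space"
  assumes "continuous_on (ball 0 1 \<times> ball 0 1) Q"
  shows "Q \<in> borel_measurable (ball_measure \<alpha> \<Otimes>\<^sub>M ball_measure \<beta>)"
proof -
  have id: "(\<lambda>x. x) \<in> ball_measure \<alpha> \<rightarrow>\<^sub>M (borel :: (complex ^ 'n) measure)" for \<alpha>
    by (rule measurable_ball_borel) simp
  have "(\<lambda>p. (fst p, snd p)) \<in> (ball_measure \<alpha> :: (complex ^ 'n) measure) \<Otimes>\<^sub>M (ball_measure \<beta> :: (complex ^ 'n) measure) \<rightarrow>\<^sub>M borel \<Otimes>\<^sub>M borel"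
    by (intro measurable_Pair measurable_compose[OF measurable_fst id] measurable_compose[OF measurable_snd id])
  then have "(\<lambda>p. p) \<in> (ball_measure \<alpha> :: (complex ^ 'n) measure) \<Otimes>\<^sub>M (ball_measure \<beta> :: (complex ^ 'n) measure) \<rightarrow>\<^sub>M borel"
    by (simp add: borel_prod)
  then have "(\<lambda>p. p) \<in> (ball_measure \<alpha> :: (complex ^ 'n) measure) \<Otimes>\<^sub>M (ball_measure \<beta> :: (complex ^ 'n) measure)
      \<rightarrow>\<^sub>M restrict_space borel (ball 0 1 \<times> ball 0 1)"
    by (intro measurable_restrict_space2) (auto simp: space_pair_measure space_ball_measure)
  from measurable_compose[OF this borel_measurable_continuous_on_restrict[OF assms]]
  show ?thesis .
qed

lemma continuous_on_weight: "continuous_on (ball 0 1) (\<lambda>w :: 'a::real_normed_vector. (1 - (norm w)\<^sup>2) powr \<delta>)"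
  using norm_sq_less_1 by (intro continuous_intros) force

lemma continuous_on_kern_norm:
  fixes f g :: "'a::topological_space \<Rightarrow> complex ^ 'n"
  assumes "continuous_on S f" "continuous_on S g" "\<And>x. x \<in> S \<Longrightarrow> norm (f x) < 1 \<and> norm (g x) < 1"
  shows "continuous_on S (\<lambda>x. 1 / cmod (1 - hinner (f x) (g x)) powr s)"
  unfolding norm_kern[symmetric] using assms
  by (intro continuous_on_norm continuous_on_compose2[OF continuous_on_kern] continuous_on_hinner)
    (auto intro!: norm_hinner_less_1)

lemma norm_one_minus_hinner_commute: "cmod (1 - hinner z w) = cmod (1 - hinner w z)"
proof -
  have "1 - hinner z w = cnj (1 - hinner w z)"
    by (simp add: hinner_commute[of z w])
  then show ?thesis by (simp only: complex_mod_cnj)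
qed

text \<open>Absorbing the weight into the measure turns \<alpha> into \<alpha> - \<delta>, for which
  the exponent n + 1 + \<alpha> exceeds the critical one by exactly \<delta>. The upper bound on
  \<delta> keeps the new weight integrable.\<close>

lemma forelli_rudin_weighted:
  assumes \<alpha>: "-1 < \<alpha>" and \<delta>: "0 < \<delta>" "\<delta> < \<alpha> + 1"
  obtains C where "0 < C" "\<And>z :: complex ^ 'n. norm z < 1 \<Longrightarrow>
    (\<integral>\<^sup>+w. ennreal (1 / cmod (1 - hinner z w) powr (real CARD('n) + 1 + \<alpha>)) * ennreal ((1 - (norm w)\<^sup>2) powr (- \<delta>)) \<partial>ball_measure \<alpha>)
      \<le> ennreal (C * (1 - (norm z)\<^sup>2) powr (- \<delta>))"
proof -
  have a: "-1 < \<alpha> - \<delta>" "-1 < \<alpha> + (- \<delta>)" using \<delta> by auto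
  obtain C where C: "0 < C" "\<And>z :: complex ^ 'n. norm z < 1 \<Longrightarrow>
      (\<integral>w. 1 / cmod (1 - hinner z w) powr (real CARD('n) + 1 + (\<alpha> - \<delta>) + \<delta>) \<partial>ball_measure (\<alpha> - \<delta>)) \<le> C * (1 - (norm z)\<^sup>2) powr (- \<delta>)"
    using forelli_rudin[OF a(1) \<delta>(1), where 'n = 'n] by blast
  define v where "v = weight_const TYPE('n) \<alpha> / weight_const TYPE('n) (\<alpha> + (- \<delta>))"
  have v: "0 < v"
    unfolding v_def by (intro divide_pos_pos weight_const_pos \<alpha> a)
  show ?thesis
  proof (rule that[of "v * C"])
    show "0 < v * C" using v C by simp
    fix z :: "complex ^ 'n" assume z: "norm z < 1"
    let ?K = "\<lambda>w. 1 / cmod (1 - hinner z w) powr (real CARD('n) + 1 + \<alpha>)"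
    have Km: "(\<lambda>w. ennreal (?K w)) \<in> borel_measurable (ball_measure \<alpha>)"
      using z by (intro measurable_compose[OF _ measurable_ennreal] measurable_ball_continuous continuous_on_kern_norm)
        (auto intro: continuous_intros)
    have "(\<integral>\<^sup>+w. ennreal (?K w) * ennreal ((1 - (norm w)\<^sup>2) powr (- \<delta>)) \<partial>ball_measure \<alpha>)
        = ennreal v * (\<integral>\<^sup>+w. ennreal (?K w) \<partial>ball_measure (\<alpha> + (- \<delta>)))"
      unfolding v_def by (rule nn_integral_ball_measure_shift[OF Km \<alpha> a(2)])
    also have "(\<integral>\<^sup>+w. ennreal (?K w) \<partial>ball_measure (\<alpha> + (- \<delta>))) = ennreal (\<integral>w. ?K w \<partial>ball_measure (\<alpha> + (- \<delta>)))"
      using \<alpha> by (intro nn_integral_eq_integral integrable_kern_norm z a) auto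
    also have "\<dots> \<le> ennreal (C * (1 - (norm z)\<^sup>2) powr (- \<delta>))"
    proof (rule ennreal_leI)
      have "real CARD('n) + 1 + (\<alpha> - \<delta>) + \<delta> = real CARD('n) + 1 + \<alpha>" "\<alpha> - \<delta> = \<alpha> + (- \<delta>)"
        by simp_all
      then show "(\<integral>w. ?K w \<partial>ball_measure (\<alpha> + (- \<delta>))) \<le> C * (1 - (norm z)\<^sup>2) powr (- \<delta>)"
        using C(2)[OF z] by (simp only:)
    qed
    finally show "(\<integral>\<^sup>+w. ennreal (?K w) * ennreal ((1 - (norm w)\<^sup>2) powr (- \<delta>)) \<partial>ball_measure \<alpha>)
        \<le> ennreal (v * C * (1 - (norm z)\<^sup>2) powr (- \<delta>))"
      using v by (simp add: mult_left_mono ennreal_mult' mult.assoc)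
  qed
qed

text \<open>Schur's test with the power weight \<open>(1 - |w|\<^sup>2) powr (- \<epsilon>)\<close>.\<close>

lemma positive_bergman_projection_bounded:
  assumes \<alpha>: "-1 < \<alpha>" and q: "1 < q"
  obtains C where "0 < C" "\<And>(G :: complex ^ 'n \<Rightarrow> real) B. continuous_on (ball 0 1) G \<Longrightarrow> (\<And>w. 0 \<le> G w) \<Longrightarrow>
      (\<And>w. norm w < 1 \<Longrightarrow> G w \<le> B) \<Longrightarrow>
      (\<integral>\<^sup>+z. ennreal ((\<integral>w. G w * (1 / cmod (1 - hinner z w) powr (real CARD('n) + 1 + \<alpha>)) \<partial>ball_measure \<alpha>) powr q) \<partial>ball_measure \<alpha>)
      \<le> ennreal C * (\<integral>\<^sup>+w. ennreal (G w powr q) \<partial>ball_measure \<alpha>)"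
proof -
  let ?M = "ball_measure \<alpha> :: (complex ^ 'n) measure"
  define s where "s = real CARD('n) + 1 + \<alpha>"
  have s: "0 < s" using \<alpha> by (simp add: s_def)
  define q' where "q' = q / (q - 1)"
  have q': "1 < q'" "1 / q' + 1 / q = 1"
    using q by (simp_all add: q'_def field_simps)
  \<comment> \<open>Any positive \<epsilon> for which both \<epsilon> q and \<epsilon> q' stay below
    \<alpha> + 1 would do; both weighted kernel estimates need this.\<close>
  define \<epsilon> where "\<epsilon> = (\<alpha> + 1) / (2 * (q + q'))"
  have \<epsilon>: "0 < \<epsilon>" using \<alpha> q q' by (simp add: \<epsilon>_def)
  have qq: "\<epsilon> * q < \<alpha> + 1" "\<epsilon> * q' < \<alpha> + 1"
  proof -
    have half: "(\<alpha> + 1) / (2 * t) * u < \<alpha> + 1" if "0 < u" "u \<le> t" for t u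
    proof -
      have "(\<alpha> + 1) * u < (\<alpha> + 1) * (2 * t)"
        using \<alpha> that by (intro mult_strict_left_mono) auto
      then show ?thesis
        using that by (simp add: divide_less_eq)
    qed
    show "\<epsilon> * q < \<alpha> + 1" "\<epsilon> * q' < \<alpha> + 1"
      unfolding \<epsilon>_def by (rule half; use q q'(1) in auto)+
  qed
  have eq: "0 < \<epsilon> * q" "0 < \<epsilon> * q'"
    using \<epsilon> q q'(1) by simp_all
  obtain C1 where C1: "0 < C1" "\<And>z :: complex ^ 'n. norm z < 1 \<Longrightarrow>
    (\<integral>\<^sup>+w. ennreal (1 / cmod (1 - hinner z w) powr s) * ennreal ((1 - (norm w)\<^sup>2) powr (- (\<epsilon> * q'))) \<partial>?M)
      \<le> ennreal (C1 * (1 - (norm z)\<^sup>2) powr (- (\<epsilon> * q')))"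
    unfolding s_def using forelli_rudin_weighted[OF \<alpha> eq(2) qq(2), where 'n = 'n] by blast
  obtain C2 where C2: "0 < C2" "\<And>z :: complex ^ 'n. norm z < 1 \<Longrightarrow>
    (\<integral>\<^sup>+w. ennreal (1 / cmod (1 - hinner z w) powr s) * ennreal ((1 - (norm w)\<^sup>2) powr (- (\<epsilon> * q))) \<partial>?M)
      \<le> ennreal (C2 * (1 - (norm z)\<^sup>2) powr (- (\<epsilon> * q)))"
    unfolding s_def using forelli_rudin_weighted[OF \<alpha> eq(1) qq(1), where 'n = 'n] by blast
  define K where "K z w = 1 / cmod (1 - hinner z w) powr s" for z w :: "complex ^ 'n"
  have K0: "0 \<le> K z w" for z w by (simp add: K_def)
  have Kc: "continuous_on (ball 0 1) (K z)" if "norm z < 1" for z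
    unfolding K_def using that by (intro continuous_on_kern_norm) (auto intro: continuous_intros)
  have K2c: "continuous_on (ball 0 1 \<times> ball 0 1) (\<lambda>p. K (fst p) (snd p))"
    unfolding K_def by (intro continuous_on_kern_norm) (auto intro!: continuous_intros)
  define C where "C = C1 powr (q / q') * C2"
  show ?thesis
  proof (rule that[of C])
    show "0 < C" using C1 C2 by (simp add: C_def)
    fix G :: "complex ^ 'n \<Rightarrow> real" and B
    assume G: "continuous_on (ball 0 1) G" "\<And>w. 0 \<le> G w" "\<And>w. norm w < 1 \<Longrightarrow> G w \<le> B"
    define \<rho> where "\<rho> d w = (1 - (norm w)\<^sup>2) powr d" for d and w :: "complex ^ 'n"
    have \<rho>0: "0 \<le> \<rho> d w" for d w by (simp add: \<rho>_def)
    have \<rho>c: "continuous_on (ball 0 1) (\<rho> d)" for d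
      unfolding \<rho>_def by (rule continuous_on_weight)
    have Gq: "continuous_on (ball 0 1) (\<lambda>w. G w powr q)"
      using G q by (intro continuous_on_powr' continuous_intros) auto
    define T where "T z = (\<integral>w. G w * K z w \<partial>?M)" for z
    have T: "ennreal (T z powr q) \<le> ennreal (C1 powr (q / q')) *
        (\<integral>\<^sup>+w. ennreal (\<rho> (- (\<epsilon> * q)) z * K z w * (\<rho> (\<epsilon> * q) w * G w powr q)) \<partial>?M)" if z: "norm z < 1" for z
    proof -
      \<comment> \<open>The kernel is split as K^(1/q') K^(1/q), with the weight inserted and
        removed, so that Hoelder's inequality meets one Forelli--Rudin integral in w. Raised to the
        power q / q', the resulting factor in z has exponent - \<epsilon> q, which suits the second
        integral, in z.\<close>
      define f where "f w = K z w powr (1 / q') * \<rho> (- \<epsilon>) w" for w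
      define g where "g w = K z w powr (1 / q) * \<rho> \<epsilon> w * G w" for w
      have fc: "continuous_on (ball 0 1) f" and gc: "continuous_on (ball 0 1) g"
        unfolding f_def g_def using K0 q q'
        by (intro continuous_intros continuous_on_powr' Kc[OF z] \<rho>c G(1); simp)+
      have f0: "0 \<le> f w" and g0: "0 \<le> g w" for w
        using K0 \<rho>0 G(2) by (simp_all add: f_def g_def)
      have fq: "f w powr q' = K z w * \<rho> (- (\<epsilon> * q')) w" for w
        using K0 q' by (simp add: f_def powr_mult powr_powr \<rho>_def)
      have gq: "g w powr q = K z w * (\<rho> (\<epsilon> * q) w * G w powr q)" for w
        using K0 G(2) q by (simp add: g_def powr_mult powr_powr \<rho>_def)
      have fg: "f w * g w = G w * K z w" if "norm w < 1" for w
      proof -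
        have "K z w powr (1 / q') * K z w powr (1 / q) = K z w"
          using K0 q' by (simp add: powr_add[symmetric])
        moreover have "\<rho> (- \<epsilon>) w * \<rho> \<epsilon> w = 1"
          using norm_sq_less_1[OF that] by (simp add: \<rho>_def powr_add[symmetric])
        ultimately have "f w * g w = (K z w powr (1 / q') * K z w powr (1 / q)) * (\<rho> (- \<epsilon>) w * \<rho> \<epsilon> w) * G w"
          by (simp only: f_def g_def mult_ac)
        then show ?thesis
          unfolding \<open>K z w powr (1 / q') * K z w powr (1 / q) = K z w\<close> \<open>\<rho> (- \<epsilon>) w * \<rho> \<epsilon> w = 1\<close> by (simp add: mult.commute)
      qed
      have fnn: "(\<integral>\<^sup>+w. ennreal (f w powr q') \<partial>?M) \<le> ennreal (C1 * \<rho> (- (\<epsilon> * q')) z)"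
      proof -
        have "ennreal (f w powr q') = ennreal (1 / cmod (1 - hinner z w) powr s) * ennreal ((1 - (norm w)\<^sup>2) powr (- (\<epsilon> * q')))" for w
          unfolding fq K_def \<rho>_def by (rule ennreal_mult) simp_all
        then show ?thesis
          using C1(2)[OF z] by (simp only: \<rho>_def)
      qed
      have fi: "integrable ?M (\<lambda>w. f w powr q')"
      proof (rule integrableI_bounded)
        show "(\<lambda>w. f w powr q') \<in> borel_measurable ?M"
          using f0 q' by (intro measurable_ball_continuous continuous_on_powr' fc continuous_intros) auto
        show "(\<integral>\<^sup>+w. ennreal (norm (f w powr q')) \<partial>?M) < \<infinity>"
          using fnn by (simp add: le_less_trans)
      qed
      have fI: "(\<integral>w. f w powr q' \<partial>?M) \<le> C1 * \<rho> (- (\<epsilon> * q')) z"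
      proof -
        have "ennreal (\<integral>w. f w powr q' \<partial>?M) \<le> ennreal (C1 * \<rho> (- (\<epsilon> * q')) z)"
          using fnn by (subst nn_integral_eq_integral[OF fi, symmetric]) auto
        then show ?thesis
          using C1(1) \<rho>0 by (subst (asm) ennreal_le_iff) auto
      qed
      define bz where "bz = 1 / (1 - norm z) powr s"
      \<comment> \<open>The bound B guarantees integrability here and does not enter the
        constant.\<close>
      have gi: "integrable ?M (\<lambda>w. g w powr q)"
      proof (rule integrable_ball_bounded[OF \<alpha>])
        show "continuous_on (ball 0 1) (\<lambda>w. g w powr q)"
          using g0 q by (intro continuous_on_powr' gc continuous_intros) auto
        fix w :: "complex ^ 'n" assume w: "norm w < 1"
        have "K z w \<le> bz"
          unfolding K_def bz_def norm_kern[symmetric] using s by (intro kern_hinner_le z w) simp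
        moreover have "\<rho> (\<epsilon> * q) w \<le> 1"
          unfolding \<rho>_def using norm_sq_less_1[OF w] \<epsilon> q by (intro powr_le1) auto
        moreover have "G w powr q \<le> B powr q"
          using G w q by (intro powr_mono2) auto
        ultimately have "g w powr q \<le> bz * (1 * B powr q)"
          unfolding gq using K0 \<rho>0 order_trans[OF K0] by (intro mult_mono) auto
        then show "norm (g w powr q) \<le> bz * (1 * B powr q)" by simp
      qed
      have "T z = (\<integral>w. f w * g w \<partial>?M)"
        unfolding T_def by (intro Bochner_Integration.integral_cong refl) (simp add: fg space_ball_measure)
      also have "\<dots> \<le> (\<integral>w. f w powr q' \<partial>?M) powr (1 / q') * (\<integral>w. g w powr q \<partial>?M) powr (1 / q)"
        by (rule holder_inequality(2)[OF q'(1) q q'(2) measurable_ball_continuous[OF fc] measurable_ball_continuous[OF gc] f0 g0 fi gi])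
      also have "\<dots> \<le> (C1 * \<rho> (- (\<epsilon> * q')) z) powr (1 / q') * (\<integral>w. g w powr q \<partial>?M) powr (1 / q)"
        using fI q' by (intro mult_right_mono powr_mono2) auto
      finally have Tz: "T z \<le> (C1 * \<rho> (- (\<epsilon> * q')) z) powr (1 / q') * (\<integral>w. g w powr q \<partial>?M) powr (1 / q)" .
      have "0 \<le> T z"
        unfolding T_def using G(2) K0 by (intro Bochner_Integration.integral_nonneg) simp
      then have "T z powr q \<le> ((C1 * \<rho> (- (\<epsilon> * q')) z) powr (1 / q') * (\<integral>w. g w powr q \<partial>?M) powr (1 / q)) powr q"
        using Tz q by (intro powr_mono2) auto
      also have "\<dots> = (C1 * \<rho> (- (\<epsilon> * q')) z) powr (q / q') * (\<integral>w. g w powr q \<partial>?M)"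
        using q C1(1) \<rho>0 by (simp add: powr_mult powr_powr)
      also have "(C1 * \<rho> (- (\<epsilon> * q')) z) powr (q / q') = C1 powr (q / q') * \<rho> (- (\<epsilon> * q)) z"
        using q' C1(1) \<rho>0 by (simp add: powr_mult powr_powr \<rho>_def)
      finally have "ennreal (T z powr q) \<le> ennreal (C1 powr (q / q') * \<rho> (- (\<epsilon> * q)) z * (\<integral>w. g w powr q \<partial>?M))"
        by (rule ennreal_leI)
      also have "\<dots> = ennreal (C1 powr (q / q')) * (ennreal (\<rho> (- (\<epsilon> * q)) z) * (\<integral>\<^sup>+w. ennreal (g w powr q) \<partial>?M))"
        using \<rho>0 by (subst nn_integral_eq_integral[OF gi]) (simp_all add: ennreal_mult mult.assoc)
      also have "ennreal (\<rho> (- (\<epsilon> * q)) z) * (\<integral>\<^sup>+w. ennreal (g w powr q) \<partial>?M)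
          = (\<integral>\<^sup>+w. ennreal (\<rho> (- (\<epsilon> * q)) z) * ennreal (g w powr q) \<partial>?M)"
        using gi by (intro nn_integral_cmult[symmetric]) auto
      also have "\<dots> = (\<integral>\<^sup>+w. ennreal (\<rho> (- (\<epsilon> * q)) z * K z w * (\<rho> (\<epsilon> * q) w * G w powr q)) \<partial>?M)"
        using \<rho>0 by (intro nn_integral_cong) (simp add: gq ennreal_mult'[symmetric] mult.assoc)
      finally show ?thesis .
    qed
    define Q where "Q p = \<rho> (- (\<epsilon> * q)) (fst p) * K (fst p) (snd p) * (\<rho> (\<epsilon> * q) (snd p) * G (snd p) powr q)" for p
    have "continuous_on (ball 0 1 \<times> ball 0 1) Q"
      unfolding Q_def
      by (intro continuous_intros K2c continuous_on_compose2[OF \<rho>c] continuous_on_compose2[OF Gq]) auto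
    then have Qm [measurable]: "(\<lambda>p. ennreal (Q p)) \<in> borel_measurable (?M \<Otimes>\<^sub>M ?M)"
      by (intro measurable_compose[OF _ measurable_ennreal] measurable_ball_pair)
    interpret sigma_finite_measure ?M
      by (rule sigma_finite_ball_measure[OF \<alpha>])
    interpret P: pair_sigma_finite ?M ?M ..
    have Qm': "(\<lambda>(z, w). ennreal (\<rho> (- (\<epsilon> * q)) z * K z w * (\<rho> (\<epsilon> * q) w * G w powr q))) \<in> borel_measurable (?M \<Otimes>\<^sub>M ?M)"
      using Qm by (simp add: Q_def case_prod_beta')
    have "(\<integral>\<^sup>+z. ennreal (T z powr q) \<partial>?M)
        \<le> (\<integral>\<^sup>+z. ennreal (C1 powr (q / q')) * (\<integral>\<^sup>+w. ennreal (\<rho> (- (\<epsilon> * q)) z * K z w * (\<rho> (\<epsilon> * q) w * G w powr q)) \<partial>?M) \<partial>?M)"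
      using T by (intro nn_integral_mono) (simp add: space_ball_measure)
    also have "\<dots> = ennreal (C1 powr (q / q')) * (\<integral>\<^sup>+z. (\<integral>\<^sup>+w. ennreal (\<rho> (- (\<epsilon> * q)) z * K z w * (\<rho> (\<epsilon> * q) w * G w powr q)) \<partial>?M) \<partial>?M)"
      using Qm' by (intro nn_integral_cmult borel_measurable_nn_integral)
    also have "(\<integral>\<^sup>+z. (\<integral>\<^sup>+w. ennreal (\<rho> (- (\<epsilon> * q)) z * K z w * (\<rho> (\<epsilon> * q) w * G w powr q)) \<partial>?M) \<partial>?M)
        = (\<integral>\<^sup>+w. (\<integral>\<^sup>+z. ennreal (\<rho> (- (\<epsilon> * q)) z * K z w * (\<rho> (\<epsilon> * q) w * G w powr q)) \<partial>?M) \<partial>?M)"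
      by (rule P.Fubini'[symmetric, OF Qm'])
    \<comment> \<open>By symmetry of the modulus of the kernel, the inner integral over z is again a
      weighted kernel integral; its power - \<epsilon> q of 1 - |w|^2 cancels against the weight
      kept in the factor of w.\<close>
    also have "\<dots> \<le> (\<integral>\<^sup>+w. ennreal C2 * ennreal (G w powr q) \<partial>?M)"
    proof (rule nn_integral_mono)
      fix w assume "w \<in> space ?M"
      then have w: "norm w < 1" by (simp add: space_ball_measure)
      have Kw: "K z w = K w z" for z
        unfolding K_def by (simp only: norm_one_minus_hinner_commute[of z w])
      have m: "(\<lambda>z. ennreal (K w z) * ennreal (\<rho> (- (\<epsilon> * q)) z)) \<in> borel_measurable ?M"
        by (intro borel_measurable_times_ennreal measurable_compose[OF _ measurable_ennreal] measurable_ball_continuous Kc w \<rho>c)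
      have "(\<integral>\<^sup>+z. ennreal (\<rho> (- (\<epsilon> * q)) z * K z w * (\<rho> (\<epsilon> * q) w * G w powr q)) \<partial>?M)
          = (\<integral>\<^sup>+z. ennreal (\<rho> (\<epsilon> * q) w * G w powr q) * (ennreal (K w z) * ennreal (\<rho> (- (\<epsilon> * q)) z)) \<partial>?M)"
        using \<rho>0 K0 by (intro nn_integral_cong) (simp add: Kw ennreal_mult'[symmetric] mult_ac)
      also have "\<dots> = ennreal (\<rho> (\<epsilon> * q) w * G w powr q) * (\<integral>\<^sup>+z. ennreal (K w z) * ennreal (\<rho> (- (\<epsilon> * q)) z) \<partial>?M)"
        by (rule nn_integral_cmult[OF m])
      also have "\<dots> \<le> ennreal (\<rho> (\<epsilon> * q) w * G w powr q) * ennreal (C2 * \<rho> (- (\<epsilon> * q)) w)"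
        unfolding K_def \<rho>_def by (intro mult_left_mono C2(2) w) simp
      also have "\<dots> = ennreal C2 * ennreal (G w powr q)"
      proof -
        have "\<rho> (\<epsilon> * q) w * \<rho> (- (\<epsilon> * q)) w = 1"
          using norm_sq_less_1[OF w] by (simp add: \<rho>_def powr_add[symmetric])
        then have "\<rho> (\<epsilon> * q) w * G w powr q * (C2 * \<rho> (- (\<epsilon> * q)) w) = C2 * G w powr q"
          by algebra
        then show ?thesis
          using C2(1) \<rho>0 by (simp add: ennreal_mult[symmetric])
      qed
      finally show "(\<integral>\<^sup>+z. ennreal (\<rho> (- (\<epsilon> * q)) z * K z w * (\<rho> (\<epsilon> * q) w * G w powr q)) \<partial>?M) \<le> ennreal C2 * ennreal (G w powr q)" .
    qed
    also have "\<dots> = ennreal C2 * (\<integral>\<^sup>+w. ennreal (G w powr q) \<partial>?M)"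
      by (intro nn_integral_cmult measurable_compose[OF _ measurable_ennreal] measurable_ball_continuous Gq)
    finally have "(\<integral>\<^sup>+z. ennreal (T z powr q) \<partial>?M) \<le> ennreal (C1 powr (q / q')) * (ennreal C2 * (\<integral>\<^sup>+w. ennreal (G w powr q) \<partial>?M))"
      by (simp add: mult_left_mono)
    then show "(\<integral>\<^sup>+z. ennreal ((\<integral>w. G w * (1 / cmod (1 - hinner z w) powr (real CARD('n) + 1 + \<alpha>)) \<partial>?M) powr q) \<partial>?M)
        \<le> ennreal C * (\<integral>\<^sup>+w. ennreal (G w powr q) \<partial>?M)"
      unfolding T_def K_def s_def C_def using C2(1) by (simp add: ennreal_mult mult.assoc)
  qed
qed

text \<open>The reproducing formula at z and Hoelder's inequality. The q'-th power of the kernel has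
  exponent s q' = s + c, and the Forelli--Rudin power c / q' equals s / q because 1 / q = 1 - 1 /
  q'.\<close>

lemma bergman_point_evaluation:
  assumes \<alpha>: "-1 < \<alpha>" and q: "1 < q"
  obtains C where "0 < C" "\<And>(g :: complex ^ 'n \<Rightarrow> 'b::complex_banach) z. g \<in> bergman q \<alpha> \<Longrightarrow> norm z < 1 \<Longrightarrow>
    norm (g z) \<le> C * (1 - (norm z)\<^sup>2) powr (- ((real CARD('n) + 1 + \<alpha>) / q)) * bergman_norm q \<alpha> g"
proof -
  let ?M = "ball_measure \<alpha> :: (complex ^ 'n) measure"
  define s where "s = real CARD('n) + 1 + \<alpha>"
  have s: "0 < s" using \<alpha> by (simp add: s_def)
  define q' where "q' = q / (q - 1)"
  have q': "1 < q'" "1 / q + 1 / q' = 1"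
    using q by (simp_all add: q'_def field_simps)
  define c where "c = s * q' - s"
  have c: "0 < c" using s q' by (simp add: c_def)
  obtain C where C: "0 < C" "\<And>z :: complex ^ 'n. norm z < 1 \<Longrightarrow>
      (\<integral>w. 1 / cmod (1 - hinner z w) powr (real CARD('n) + 1 + \<alpha> + c) \<partial>?M) \<le> C * (1 - (norm z)\<^sup>2) powr (- c)"
    using forelli_rudin[OF \<alpha> c, where 'n = 'n] by blast
  have sc: "real CARD('n) + 1 + \<alpha> + c = s * q'"
    by (simp add: c_def s_def)
  show ?thesis
  proof (rule that[of "C powr (1 / q')"])
    show "0 < C powr (1 / q')" using C by simp
    fix g :: "complex ^ 'n \<Rightarrow> 'b" and z :: "complex ^ 'n"
    assume g: "g \<in> bergman q \<alpha>" and z: "norm z < 1"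
    have hol: "holomorphic_ball g" and gi: "integrable ?M (\<lambda>w. norm (g w) powr q)"
      using g by (auto simp: bergman_def)
    have gc: "continuous_on (ball 0 1) g"
      by (rule holomorphic_ball_continuous[OF hol])
    have gm: "(\<lambda>w. norm (g w)) \<in> borel_measurable ?M"
      by (intro measurable_ball_continuous continuous_on_norm gc)
    let ?K = "\<lambda>w. 1 / cmod (1 - hinner z w) powr s"
    have Kc: "continuous_on (ball 0 1) ?K"
      using z by (intro continuous_on_kern_norm) (auto intro: continuous_intros)
    have Kq: "?K w powr q' = 1 / cmod (1 - hinner z w) powr (s * q')" for w
      by (simp add: powr_divide powr_powr)
    have Ki: "integrable ?M (\<lambda>w. ?K w powr q')"
      unfolding Kq using s q' by (intro integrable_kern_norm z \<alpha>) simp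
    have K0: "0 \<le> ?K w" for w by simp
    note H = holder_inequality[OF q q'(1) q'(2) gm measurable_ball_continuous[OF Kc] norm_ge_zero K0 gi Ki]
    \<comment> \<open>Hoelder against the constant 1 on a finite measure: integrability of the norm
      itself is what the reproducing formula asks for.\<close>
    have gint: "integrable ?M (\<lambda>w. norm (g w))"
    proof -
      have one: "integrable ?M (\<lambda>w. (1 :: real) powr q')"
        using finite_measure.integrable_const[OF finite_ball_measure[OF \<alpha>]] by simp
      have "integrable ?M (\<lambda>w. norm (g w) * 1)"
        by (rule holder_inequality(1)[OF q q'(1) q'(2) gm _ norm_ge_zero _ gi one]) simp_all
      then show ?thesis by simp
    qed
    have "norm (g z) \<le> (\<integral>w. norm (g w) * ?K w \<partial>?M)"
    proof (rule norm_le_functional)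
      fix \<phi> :: "('b, complex) cblinfun"
      assume \<phi>: "\<And>y. cmod (cblinfun_apply \<phi> y) \<le> norm y"
      have bi: "ball_integrand \<alpha> g"
        using \<alpha> gc gint by (simp add: ball_integrand_def)
      have "cblinfun_apply \<phi> (g z) = cblinfun_apply \<phi> (kern_transform \<alpha> s g z)"
        unfolding s_def by (simp only: kern_transform_reproducing[OF bi hol z])
      also have "\<dots> = (\<integral>w. kern s (hinner z w) * cblinfun_apply \<phi> (g w) \<partial>?M)"
        using has_bochner_integral_integral_eq[OF kern_transform_functional[OF bi z less_imp_le[OF s]]] by simp
      finally have eq: "cblinfun_apply \<phi> (g z) = (\<integral>w. kern s (hinner z w) * cblinfun_apply \<phi> (g w) \<partial>?M)" .
      show "cmod (cblinfun_apply \<phi> (g z)) \<le> (\<integral>w. norm (g w) * ?K w \<partial>?M)"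
        unfolding eq
      proof (rule norm_integral_functional_le)
        show "integrable ?M (\<lambda>w. norm (g w) * ?K w)"
          by (rule H(1))
        show "cmod (kern s (hinner z w) * cblinfun_apply \<phi> (g w)) \<le> norm (g w) * ?K w" for w
          using functional_norm_le[OF \<phi>, of "kern s (hinner z w)" "g w"] by (simp add: norm_kern mult.commute)
      qed
    qed
    also have "\<dots> \<le> (\<integral>w. norm (g w) powr q \<partial>?M) powr (1 / q) * (\<integral>w. ?K w powr q' \<partial>?M) powr (1 / q')"
      by (rule H(2))
    also have "\<dots> \<le> (\<integral>w. norm (g w) powr q \<partial>?M) powr (1 / q) * (C * (1 - (norm z)\<^sup>2) powr (- c)) powr (1 / q')"
      using C(2)[OF z] q' unfolding sc Kq by (intro mult_left_mono powr_mono2) auto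
    also have "(C * (1 - (norm z)\<^sup>2) powr (- c)) powr (1 / q') = C powr (1 / q') * (1 - (norm z)\<^sup>2) powr (- (s / q))"
    proof -
      have "1 / q = 1 - 1 / q'" using q' by simp
      moreover have "(- c) * (1 / q') = - (s * (1 - 1 / q'))"
        using q' by (simp add: c_def field_simps)
      moreover have "s / q = s * (1 / q)" by simp
      ultimately have "(- c) * (1 / q') = - (s / q)"
        by (simp only:)
      then show ?thesis
        using C(1) by (simp add: powr_mult powr_powr)
    qed
    finally show "norm (g z) \<le> C powr (1 / q') * (1 - (norm z)\<^sup>2) powr (- ((real CARD('n) + 1 + \<alpha>) / q)) * bergman_norm q \<alpha> g"
      by (simp add: bergman_norm_def s_def mult_ac)
  qed
qed

section \<open>Little Hankel operators\<close>

text \<open>Lets an operator-valued integral be tested at a vector v followed by \<phi>: this is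
  again a single functional, now on the operator space.\<close>

lemma evaluation_functional:
  fixes \<phi> :: "('b::complex_normed_vector, complex) cblinfun" and v :: "'a::complex_normed_vector"
  shows "\<exists>\<psi> :: (('a, 'b) cblinfun, complex) cblinfun. \<forall>T. cblinfun_apply \<psi> T = cblinfun_apply \<phi> (cblinfun_apply T v)"
proof -
  have "\<exists>\<psi> :: (('a, 'b) cblinfun, complex) cblinfun. cblinfun_apply \<psi> = (\<lambda>T. cblinfun_apply \<phi> (cblinfun_apply T v))"
  proof (rule ex_cblinfun)
    fix T :: "('a, 'b) cblinfun"
    have "norm (cblinfun_apply \<phi> (cblinfun_apply T v)) \<le> norm \<phi> * (norm T * norm v)"
      by (rule order_trans[OF norm_cblinfun mult_left_mono[OF norm_cblinfun]]) (simp add: norm_cblinfun.rep_eq)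
    then show "norm (cblinfun_apply \<phi> (cblinfun_apply T v)) \<le> norm T * (norm \<phi> * norm v)"
      by (simp only: mult.left_commute)
  qed (simp_all add: cblinfun_apply_add_left cblinfun_apply_add_right cblinfun_apply_scaleC_left cblinfun_apply_scaleC_right)
  then show ?thesis
    by (simp add: fun_eq_iff)
qed

text \<open>Applying T to \<open>bar x\<close> is conjugate-linear in x, and the outer conjugation
  restores linearity. Composed with a holomorphic f the result is holomorphic, so the reproducing
  formula applies to it.\<close>

lemma conjugate_functional:
  fixes \<phi> :: "('b::complex_normed_vector, complex) cblinfun" and T :: "('a::complex_normed_vector conj_space, 'b) cblinfun"
  shows "\<exists>\<psi> :: ('a, complex) cblinfun. \<forall>x. cblinfun_apply \<psi> x = cnj (cblinfun_apply \<phi> (cblinfun_apply T (bar x)))"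
proof -
  have "\<exists>\<psi> :: ('a, complex) cblinfun. cblinfun_apply \<psi> = (\<lambda>x. cnj (cblinfun_apply \<phi> (cblinfun_apply T (bar x))))"
  proof (rule ex_cblinfun)
    fix x :: 'a
    have "norm (cblinfun_apply \<phi> (cblinfun_apply T (bar x))) \<le> norm \<phi> * (norm T * norm (bar x))"
      by (rule order_trans[OF norm_cblinfun mult_left_mono[OF norm_cblinfun]]) (simp add: norm_cblinfun.rep_eq)
    then show "norm (cnj (cblinfun_apply \<phi> (cblinfun_apply T (bar x)))) \<le> norm x * (norm \<phi> * norm T)"
      by (simp add: norm_bar mult_ac)
  qed (simp_all add: bar_add bar_scaleC cblinfun_apply_add_right cblinfun_apply_scaleC_right scaleC_complex_def)
  then show ?thesis
    by (simp add: fun_eq_iff)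
qed

lemma admissible_symbolD:
  fixes b :: "complex ^ 'n \<Rightarrow> ('x::complex_banach conj_space, 'y::complex_banach) cblinfun"
  assumes b: "admissible_symbol \<alpha> b" and \<alpha>: "-1 < \<alpha>"
  shows "ball_integrand \<alpha> b" "holomorphic_ball b"
    "integrable (ball_measure \<alpha>) (\<lambda>z. norm (b z) * ln (1 / (1 - (norm z)\<^sup>2)))"
proof -
  show hol: "holomorphic_ball b" and "integrable (ball_measure \<alpha>) (\<lambda>z. norm (b z) * ln (1 / (1 - (norm z)\<^sup>2)))"
    using b by (simp_all add: admissible_symbol_def)
  \<comment> \<open>At z = 0 the kernel is 1, and the first integrability condition on the symbol
    becomes integrability of its norm.\<close>
  have "0 \<in> ball (0 :: complex ^ 'n) 1" by simp
  then have "integrable (ball_measure \<alpha>) (\<lambda>w. norm (b w) / cmod (1 - hinner 0 w) powr (real CARD('n) + 1 + \<alpha>))"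
    using b unfolding admissible_symbol_def by blast
  then show "ball_integrand \<alpha> b"
    using \<alpha> holomorphic_ball_continuous[OF hol] by (simp add: ball_integrand_def)
qed

lemma hankel_eq_kern_transform:
  fixes b :: "complex ^ 'n \<Rightarrow> ('x::complex_banach conj_space, 'y::complex_banach) cblinfun"
  shows "hankel \<alpha> b f = kern_transform \<alpha> (real CARD('n) + 1 + \<alpha>) (\<lambda>w. cblinfun_apply (b w) (bar (f w)))"
  by (rule ext) (simp only: hankel_def kern_transform_def weighted_integral_def kern_def)

lemma Hinf_bounded:
  assumes "f \<in> Hinf"
  shows "\<exists>B. 0 \<le> B \<and> (\<forall>w. norm w < 1 \<longrightarrow> norm (f w) \<le> B)"
proof -
  obtain B where "\<forall>y\<in>f ` ball 0 1. norm y \<le> B"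
    using assms unfolding Hinf_def bounded_iff by blast
  then have B: "norm (f w) \<le> B" if "norm w < 1" for w
    using that by simp
  from B[of 0] have "norm (f 0) \<le> B"
    by simp
  then have "0 \<le> B"
    by (rule order_trans[OF norm_ge_zero])
  then show ?thesis using B by blast
qed

lemma norm_apply_bar_le:
  fixes T :: "('a::complex_normed_vector conj_space, 'b::complex_normed_vector) cblinfun"
  shows "norm (cblinfun_apply T (bar x)) \<le> norm T * norm x"
  using norm_cblinfun[of T "bar x"] by (simp add: norm_bar)

lemma ball_integrand_hankel:
  fixes b :: "complex ^ 'n \<Rightarrow> ('x::complex_banach conj_space, 'y::complex_banach) cblinfun"
  assumes b: "ball_integrand \<alpha> b" and f: "f \<in> Hinf"
  shows "ball_integrand \<alpha> (\<lambda>w. cblinfun_apply (b w) (bar (f w)))"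
proof -
  from Hinf_bounded[OF f] obtain B where B': "0 \<le> B" "\<forall>w. norm w < 1 \<longrightarrow> norm (f w) \<le> B"
    by (elim exE conjE)
  note B = B'(1) B'(2)[rule_format]
  have bc: "continuous_on (ball 0 1) b" and bi: "integrable (ball_measure \<alpha>) (\<lambda>w. norm (b w))" and \<alpha>: "-1 < \<alpha>"
    using b by (auto simp: ball_integrand_def)
  have fc: "continuous_on (ball 0 1) f"
    using f by (intro holomorphic_ball_continuous) (simp add: Hinf_def)
  have c: "continuous_on (ball 0 1) (\<lambda>w. cblinfun_apply (b w) (bar (f w)))"
    by (intro continuous_on_cblinfun_apply bc continuous_on_bar fc)
  have "integrable (ball_measure \<alpha>) (\<lambda>w. norm (cblinfun_apply (b w) (bar (f w))))"
  proof (rule Bochner_Integration.integrable_bound[OF integrable_mult_left[OF bi, of B]])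
    show "(\<lambda>w. norm (cblinfun_apply (b w) (bar (f w)))) \<in> borel_measurable (ball_measure \<alpha>)"
      by (rule measurable_ball_continuous[OF continuous_on_norm[OF c]])
    show "AE w in ball_measure \<alpha>. norm (norm (cblinfun_apply (b w) (bar (f w)))) \<le> norm (norm (b w) * B)"
    proof (rule AE_I2)
      fix w assume "w \<in> space (ball_measure \<alpha> :: (complex ^ 'n) measure)"
      then have "norm (f w) \<le> B" using B by (simp add: space_ball_measure)
      then have "norm (b w) * norm (f w) \<le> norm (b w) * B"
        by (rule mult_left_mono) (simp add: norm_cblinfun.rep_eq)
      then show "norm (norm (cblinfun_apply (b w) (bar (f w)))) \<le> norm (norm (b w) * B)"
        using norm_apply_bar_le[of "b w" "f w"] by simp
    qed
  qed
  with c \<alpha> show ?thesis by (simp add: ball_integrand_def)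
qed

section \<open>Boundedness of the operator implies the Lipschitz condition\<close>

lemma kern_test_function:
  fixes z :: "complex ^ 'n" and x :: "'a::complex_normed_vector"
  assumes z: "norm z < 1" and m: "0 \<le> m"
  shows "(\<lambda>w. kern m (hinner w z) *\<^sub>C x) \<in> Hinf"
proof -
  have "holomorphic_ball (\<lambda>w. kern m (hinner w z) *\<^sub>C x)"
    unfolding holomorphic_ball_def
  proof
    fix w :: "complex ^ 'n" assume "w \<in> ball 0 1"
    then have "cmod (hinner w z) < 1"
      using z by (intro norm_hinner_less_1) auto
    from kern_has_field_derivative[OF this, of m]
    have k: "(kern m has_derivative (\<lambda>h. of_real m * kern (m + 1) (hinner w z) * h)) (at (hinner w z))"
      by (simp add: has_field_derivative_def)
    have "bounded_linear (\<lambda>v :: complex ^ 'n. hinner v z)"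
    proof (rule bounded_linear_intro[where K = "norm z"])
      show "hinner (r *\<^sub>R v) z = r *\<^sub>R hinner v z" for r and v :: "complex ^ 'n"
        by (simp only: hinner_scaleR_left scaleR_conv_of_real[of r "hinner v z"])
    qed (simp_all add: hinner_add_left norm_hinner_le)
    then have h: "((\<lambda>v. hinner v z) has_derivative (\<lambda>v. hinner v z)) (at w)"
      by (rule bounded_linear_imp_has_derivative)
    have "bounded_linear (\<lambda>c. c *\<^sub>C x)"
      by (rule bounded_bilinear.bounded_linear_left[OF bounded_bilinear_scaleC])
    from bounded_linear.has_derivative[OF this diff_chain_at[OF h k, unfolded o_def]]
    have "((\<lambda>v. kern m (hinner v z) *\<^sub>C x) has_derivative
        (\<lambda>v. (of_real m * kern (m + 1) (hinner w z) * hinner v z) *\<^sub>C x)) (at w)" .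
    moreover have "(of_real m * kern (m + 1) (hinner w z) * hinner (c *s v) z) *\<^sub>C x
        = c *\<^sub>C (of_real m * kern (m + 1) (hinner w z) * hinner v z) *\<^sub>C x" for c v
      by (simp add: hinner_scale_left scaleC_scaleC mult_ac)
    ultimately show "\<exists>f'. ((\<lambda>w. kern m (hinner w z) *\<^sub>C x) has_derivative f') (at w) \<and> (\<forall>c v. f' (c *s v) = c *\<^sub>C f' v)"
      by (intro exI[of _ "\<lambda>v. (of_real m * kern (m + 1) (hinner w z) * hinner v z) *\<^sub>C x"]) blast
  qed
  moreover have "bounded ((\<lambda>w. kern m (hinner w z) *\<^sub>C x) ` ball 0 1)"
    unfolding bounded_iff
  proof (intro exI ballI)
    fix y assume "y \<in> (\<lambda>w. kern m (hinner w z) *\<^sub>C x) ` ball 0 1"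
    then obtain w where w: "norm w < 1" and y: "y = kern m (hinner w z) *\<^sub>C x" by auto
    have "cmod (hinner w z) \<le> norm z"
      using hinner_le_left[OF w, of z] hinner_commute[of w z] by simp
    then have "cmod (kern m (hinner w z)) \<le> 1 / (1 - norm z) powr m"
      by (rule norm_kern_le[OF _ z m])
    then show "norm y \<le> 1 / (1 - norm z) powr m * norm x"
      unfolding y norm_scaleC by (rule mult_right_mono) simp
  qed
  ultimately show ?thesis
    by (simp add: Hinf_def)
qed

text \<open>The conjugate of f turns <w,z> into <z,w>. At the evaluation point z, and only there,
  this factor merges with the kernel of the operator, and the exponents add.\<close>

lemma hankel_kern_test_function:
  fixes b :: "complex ^ 'n \<Rightarrow> ('x::complex_banach conj_space, 'y::complex_banach) cblinfun"
  assumes b: "ball_integrand \<alpha> b" and z: "norm z < 1" and m: "0 \<le> m"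
  shows "hankel \<alpha> b (\<lambda>w. kern m (hinner w z) *\<^sub>C x) z
    = cblinfun_apply (kern_transform \<alpha> (real CARD('n) + 1 + \<alpha> + m) b z) (bar x)"
proof (rule eq_functional)
  let ?M = "ball_measure \<alpha> :: (complex ^ 'n) measure"
  define s where "s = real CARD('n) + 1 + \<alpha>"
  have s: "0 \<le> s" "0 \<le> s + m"
    using b m by (simp_all add: s_def ball_integrand_def)
  fix \<phi> :: "('y, complex) cblinfun"
  from evaluation_functional[of \<phi> "bar x"]
  obtain \<psi> :: "(('x conj_space, 'y) cblinfun, complex) cblinfun"
    where \<psi>': "\<forall>T. cblinfun_apply \<psi> T = cblinfun_apply \<phi> (cblinfun_apply T (bar x))"
    by (elim exE)
  note \<psi> = \<psi>'[rule_format]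
  note 1 = has_bochner_integral_integral_eq[OF kern_transform_functional[OF ball_integrand_hankel[OF b kern_test_function[OF z m, of x]] z s(1), of \<phi>]]
  note 2 = has_bochner_integral_integral_eq[OF kern_transform_functional[OF b z s(2), of \<psi>]]
  have "(\<integral>w. kern s (hinner z w) * cblinfun_apply \<phi> (cblinfun_apply (b w) (bar (kern m (hinner w z) *\<^sub>C x))) \<partial>?M)
      = (\<integral>w. kern (s + m) (hinner z w) * cblinfun_apply \<psi> (b w) \<partial>?M)"
  proof (rule Bochner_Integration.integral_cong[OF refl])
    fix w assume "w \<in> space ?M"
    then have w: "norm w < 1" by (simp add: space_ball_measure)
    have "cnj (kern m (hinner w z)) = kern m (hinner z w)"
      using cnj_kern[OF norm_hinner_less_1[OF w z], of m] hinner_commute[of z w] by simp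
    then show "kern s (hinner z w) * cblinfun_apply \<phi> (cblinfun_apply (b w) (bar (kern m (hinner w z) *\<^sub>C x)))
        = kern (s + m) (hinner z w) * cblinfun_apply \<psi> (b w)"
      by (simp add: bar_scaleC cblinfun_apply_scaleC_right scaleC_complex_def \<psi> kern_mult[symmetric])
  qed
  then show "cblinfun_apply \<phi> (hankel \<alpha> b (\<lambda>w. kern m (hinner w z) *\<^sub>C x) z)
      = cblinfun_apply \<phi> (cblinfun_apply (kern_transform \<alpha> (real CARD('n) + 1 + \<alpha> + m) b z) (bar x))"
    unfolding hankel_eq_kern_transform s_def[symmetric] 1[symmetric] \<psi>[symmetric] 2[symmetric] .
qed

text \<open>The test function for order m has p-norm of size (1 - |z|^2) powr (- (m - s/p)), and
  evaluating its image at z costs a further power - s/q. This bounds the derivative of order m = k +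
  j; j descents then lead to order k.\<close>

lemma hankel_bound_imp_frac_deriv_bound:
  fixes \<alpha> p q \<gamma> :: real
  assumes \<alpha>: "-1 < \<alpha>" and p: "1 < p" and pq: "p \<le> q"
    and \<gamma>: "\<gamma> = (real CARD('n::finite) + 1 + \<alpha>) * (1 / p - 1 / q)" and k: "\<gamma> < real k"
  shows "\<exists>C>0. \<forall>(b :: complex ^ 'n \<Rightarrow> ('x::complex_banach conj_space, 'y::complex_banach) cblinfun) C0.
    admissible_symbol \<alpha> b \<longrightarrow> hankel_bound \<alpha> p q b C0 \<longrightarrow>
    (\<forall>z. norm z < 1 \<longrightarrow> norm (frac_deriv \<alpha> (real k) b z) \<le> C * C0 * (1 - (norm z)\<^sup>2) powr (- (real k - \<gamma>)))"
proof -
  define s where "s = real CARD('n) + 1 + \<alpha>"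
  have "1 \<le> real CARD('n)" by simp
  then have s: "1 \<le> s" using \<alpha> unfolding s_def by linarith
  have q: "1 < q" using p pq by simp
  \<comment> \<open>Since p > 1, an order above s makes m p > s, so the p-th power of the test
    function has an exponent above the critical one, the excess being c = m p - s.\<close>
  obtain j where j: "s < real j"
    using reals_Archimedean2 by blast
  define m where "m = real (k + j)"
  have m: "s < m" "0 \<le> m" using j by (auto simp: m_def)
  define c where "c = m * p - s"
  have "m * 1 \<le> m * p" using m p by (intro mult_left_mono) auto
  then have c: "0 < c" using m by (simp add: c_def)
  obtain C1 where C1: "0 < C1" "\<And>z :: complex ^ 'n. norm z < 1 \<Longrightarrow>
      (\<integral>w. 1 / cmod (1 - hinner z w) powr (real CARD('n) + 1 + \<alpha> + c) \<partial>ball_measure \<alpha>) \<le> C1 * (1 - (norm z)\<^sup>2) powr (- c)"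
    using forelli_rudin[OF \<alpha> c, where 'n = 'n] by blast
  have sc: "real CARD('n) + 1 + \<alpha> + c = m * p"
    by (simp add: c_def s_def)
  obtain C2 where C2: "0 < C2" "\<And>(g :: complex ^ 'n \<Rightarrow> 'y) z. g \<in> bergman q \<alpha> \<Longrightarrow> norm z < 1 \<Longrightarrow>
      norm (g z) \<le> C2 * (1 - (norm z)\<^sup>2) powr (- (s / q)) * bergman_norm q \<alpha> g"
    unfolding s_def using bergman_point_evaluation[OF \<alpha> q, where 'n = 'n and 'b = 'y] by blast
  obtain D where D: "0 < D" "\<And>(b :: complex ^ 'n \<Rightarrow> ('x conj_space, 'y) cblinfun) M z. \<lbrakk>0 \<le> M; ball_integrand \<alpha> b;
      \<forall>z. norm z < 1 \<longrightarrow> norm (kern_transform \<alpha> (s + real (k + j)) b z) \<le> M * (1 - (norm z)\<^sup>2) powr (- (real (k + j) - \<gamma>));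
      norm z < 1\<rbrakk> \<Longrightarrow> norm (kern_transform \<alpha> (s + real k) b z) \<le> D * M * (1 - (norm z)\<^sup>2) powr (- (real k - \<gamma>))"
    using kern_transform_descent_iterated[OF s k, of \<alpha> j, where 'n = 'n and 'b = "('x conj_space, 'y) cblinfun"] by blast
  define E where "E = C2 * C1 powr (1 / p)"
  have E: "0 < E" using C1 C2 by (simp add: E_def)
  show ?thesis
  proof (intro exI[of _ "D * E"] conjI allI impI)
    show "0 < D * E" using D(1) E by simp
    fix b :: "complex ^ 'n \<Rightarrow> ('x conj_space, 'y) cblinfun" and C0 and z :: "complex ^ 'n"
    assume adm: "admissible_symbol \<alpha> b" and bound: "hankel_bound \<alpha> p q b C0" and z: "norm z < 1"
    note b = admissible_symbolD[OF adm \<alpha>]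
    have C0: "0 \<le> C0" using bound by (simp add: hankel_bound_def)
    have main: "norm (kern_transform \<alpha> (s + m) b z) \<le> E * C0 * (1 - (norm z)\<^sup>2) powr (- (m - \<gamma>))"
      if z: "norm z < 1" for z
    proof (rule cblinfun_norm_le)
      define R where "R = 1 - (norm z)\<^sup>2"
      show "0 \<le> E * C0 * (1 - (norm z)\<^sup>2) powr (- (m - \<gamma>))"
        using E C0 by simp
      fix v :: "'x conj_space"
      \<comment> \<open>Every vector of the conjugate space is some \<open>bar x\<close>, so testing
        on functions with values along x controls the full operator norm.\<close>
      obtain x where v: "v = bar x"
        using surj_bar by (meson surjD)
      define f where "f w = kern m (hinner w z) *\<^sub>C x" for w
      have f: "f \<in> Hinf"
        unfolding f_def by (rule kern_test_function[OF z m(2)])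
      have H: "hankel \<alpha> b f z = cblinfun_apply (kern_transform \<alpha> (s + m) b z) v"
        unfolding f_def s_def v by (rule hankel_kern_test_function[OF b(1) z m(2)])
      have hb: "hankel \<alpha> b f \<in> bergman q \<alpha>" "bergman_norm q \<alpha> (hankel \<alpha> b f) \<le> C0 * bergman_norm p \<alpha> f"
        using bound f unfolding hankel_bound_def by blast+
      define I where "I = (\<integral>w. 1 / cmod (1 - hinner z w) powr (m * p) \<partial>ball_measure \<alpha>)"
      have I: "0 \<le> I" "I \<le> C1 * R powr (- c)"
        using C1(2)[OF z] unfolding sc by (simp_all add: I_def R_def)
      have "norm (f w) powr p = norm x powr p * (1 / cmod (1 - hinner z w) powr (m * p))" for w
        unfolding f_def norm_scaleC norm_kern norm_one_minus_hinner_commute[of w z]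
        by (simp add: powr_mult powr_divide powr_powr mult.commute)
      then have "(\<integral>w. norm (f w) powr p \<partial>ball_measure \<alpha>) = norm x powr p * I"
        unfolding I_def by (simp only: integral_mult_right_zero)
      then have "bergman_norm p \<alpha> f = norm x * I powr (1 / p)"
        using p I by (simp add: bergman_norm_def powr_mult powr_powr)
      also have "\<dots> \<le> norm x * (C1 * R powr (- c)) powr (1 / p)"
        using p I by (intro mult_left_mono powr_mono2) auto
      also have "(C1 * R powr (- c)) powr (1 / p) = C1 powr (1 / p) * R powr (- (c / p))"
        using C1(1) by (simp add: powr_mult powr_powr)
      finally have fn: "bergman_norm p \<alpha> f \<le> norm x * (C1 powr (1 / p) * R powr (- (c / p)))" .
      have "norm (hankel \<alpha> b f z) \<le> C2 * R powr (- (s / q)) * bergman_norm q \<alpha> (hankel \<alpha> b f)"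
        unfolding R_def by (rule C2(2)[OF hb(1) z])
      also have "\<dots> \<le> C2 * R powr (- (s / q)) * (C0 * (norm x * (C1 powr (1 / p) * R powr (- (c / p)))))"
        using C2(1) C0 by (intro mult_left_mono order_trans[OF hb(2)] fn) auto
      also have "\<dots> = E * C0 * (R powr (- (s / q)) * R powr (- (c / p))) * norm x"
        by (simp only: E_def mult_ac)
      \<comment> \<open>The exponents add up: s/q + c/p = s/q + m - s/p = m - \<gamma>.\<close>
      also have "R powr (- (s / q)) * R powr (- (c / p)) = R powr (- (m - \<gamma>))"
      proof -
        have "c / p = m - s / p" using p by (simp add: c_def diff_divide_distrib)
        moreover have "\<gamma> = s / p - s / q" by (simp add: \<gamma> s_def right_diff_distrib)
        ultimately have "- (s / q) + - (c / p) = - (m - \<gamma>)" by simp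
        then show ?thesis by (simp only: powr_add[symmetric])
      qed
      finally show "norm (cblinfun_apply (kern_transform \<alpha> (s + m) b z) v) \<le> E * C0 * (1 - (norm z)\<^sup>2) powr (- (m - \<gamma>)) * norm v"
        unfolding H R_def v norm_bar .
    qed
    have "norm (kern_transform \<alpha> (s + real k) b z) \<le> D * (E * C0) * (1 - (norm z)\<^sup>2) powr (- (real k - \<gamma>))"
      using main E C0 unfolding m_def by (intro D(2) b(1) z) auto
    then show "norm (frac_deriv \<alpha> (real k) b z) \<le> D * E * C0 * (1 - (norm z)\<^sup>2) powr (- (real k - \<gamma>))"
      using frac_deriv_eq[OF b(1,2) z, of "real k"] by (simp add: s_def mult.assoc)
  qed
qed

section \<open>The Lipschitz condition implies boundedness of the operator\<close>

lemma holomorphic_ball_mult: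
  fixes f g :: "complex ^ 'n \<Rightarrow> complex"
  assumes "holomorphic_ball f" "holomorphic_ball g"
  shows "holomorphic_ball (\<lambda>w. f w * g w)"
  unfolding holomorphic_ball_def
proof
  fix z :: "complex ^ 'n" assume z: "z \<in> ball 0 1"
  obtain f' where f: "(f has_derivative f') (at z)" "\<And>c v. f' (c *s v) = c *\<^sub>C f' v"
    using assms(1) z unfolding holomorphic_ball_def by blast
  obtain g' where g: "(g has_derivative g') (at z)" "\<And>c v. g' (c *s v) = c *\<^sub>C g' v"
    using assms(2) z unfolding holomorphic_ball_def by blast
  have "f z * g' (c *s v) + f' (c *s v) * g z = c *\<^sub>C (f z * g' v + f' v * g z)" for c v
    by (simp add: f(2) g(2) scaleC_complex_def algebra_simps)
  with has_derivative_mult[OF f(1) g(1)]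
  show "\<exists>h'. ((\<lambda>w. f w * g w) has_derivative h') (at z) \<and> (\<forall>c v. h' (c *s v) = c *\<^sub>C h' v)"
    by (intro exI[of _ "\<lambda>v. f z * g' v + f' v * g z"]) blast
qed

text \<open>
  Inserting the reproducing formula of the weight \<open>\<alpha> + k\<close> for the holomorphic function \<open>f\<close> times the
  kernel and exchanging integrals turns \<open>b\<close> into its fractional derivative. The logarithmic
  condition on \<open>b\<close> is what makes Fubini's theorem applicable.
\<close>

lemma hankel_functional_frac_deriv:
  fixes b :: "complex ^ 'n \<Rightarrow> ('x::complex_banach conj_space, 'y::complex_banach) cblinfun"
  assumes adm: "admissible_symbol \<alpha> b" and \<alpha>: "-1 < \<alpha>" and f: "f \<in> Hinf" and z: "norm z < 1"
    and \<phi>: "\<And>y. cmod (cblinfun_apply \<phi> y) \<le> norm y"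
  shows "cblinfun_apply \<phi> (hankel \<alpha> b f z) = (\<integral>w. kern (real CARD('n) + 1 + \<alpha>) (hinner z w)
      * cblinfun_apply \<phi> (cblinfun_apply (frac_deriv \<alpha> (real k) b w) (bar (f w))) \<partial>ball_measure (\<alpha> + real k))"
proof -
  note b = admissible_symbolD[OF adm \<alpha>]
  define s where "s = real CARD('n) + 1 + \<alpha>"
  define \<beta> where "\<beta> = \<alpha> + real k"
  define t where "t = real CARD('n) + 1 + \<beta>"
  have \<beta>: "-1 < \<beta>" using \<alpha> by (simp add: \<beta>_def)
  have s: "0 \<le> s" and t: "0 \<le> t" using \<alpha> by (simp_all add: s_def t_def \<beta>_def)
  let ?M = "ball_measure \<alpha> :: (complex ^ 'n) measure" and ?N = "ball_measure \<beta> :: (complex ^ 'n) measure"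
  interpret M: sigma_finite_measure ?M by (rule sigma_finite_ball_measure[OF \<alpha>])
  interpret N: sigma_finite_measure ?N by (rule sigma_finite_ball_measure[OF \<beta>])
  interpret P: pair_sigma_finite ?M ?N ..
  from Hinf_bounded[OF f] obtain B where B': "0 \<le> B" "\<forall>w. norm w < 1 \<longrightarrow> norm (f w) \<le> B"
    by (elim exE conjE)
  note B = B'(1) B'(2)[rule_format]
  have bc: "continuous_on (ball 0 1) b"
    by (rule holomorphic_ball_continuous[OF b(2)])
  have fh: "holomorphic_ball f" using f by (simp add: Hinf_def)
  have fc: "continuous_on (ball 0 1) f"
    by (rule holomorphic_ball_continuous[OF fh])
  \<comment> \<open>The double integrand, with u for the weight \<alpha> and w for the weight
    \<beta> = \<alpha> + k. Integrating over w first reproduces the integrand of the operator at u;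
    integrating over u first gives the fractional derivative of b at w.\<close>
  define Q where "Q u w = kern s (hinner z w) * cblinfun_apply \<phi> (cblinfun_apply (b u) (bar (f w))) * kern t (hinner w u)" for u w
  have Qc: "continuous_on (ball 0 1 \<times> ball 0 1) (\<lambda>p. Q (fst p) (snd p))"
    unfolding Q_def
    by (intro continuous_on_mult continuous_on_compose2[OF continuous_on_kern_hinner(1)[OF z]]
        continuous_on_compose2[OF continuous_on_kern] continuous_on_hinner
        bounded_linear.continuous_on[OF bounded_linear_cblinfun_apply]
        continuous_on_cblinfun_apply continuous_on_bar continuous_on_compose2[OF bc] continuous_on_compose2[OF fc]
        continuous_on_fst continuous_on_snd continuous_on_id) (auto intro!: norm_hinner_less_1)
  then have Qm: "(\<lambda>(u, w). Q u w) \<in> borel_measurable (?M \<Otimes>\<^sub>M ?N)"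
    using measurable_ball_pair[OF Qc] by (simp add: case_prod_beta')
  define K where "K = 1 / (1 - norm z) powr s * B"
  have K: "0 \<le> K" using B by (simp add: K_def)
  have Qb: "cmod (Q u w) \<le> K * norm (b u) * (1 / cmod (1 - hinner u w) powr t)" if w: "norm w < 1" for u w
  proof -
    have "cmod (cblinfun_apply \<phi> (cblinfun_apply (b u) (bar (f w)))) \<le> norm (b u) * B"
      by (rule order_trans[OF \<phi> order_trans[OF norm_apply_bar_le mult_left_mono[OF B(2)[OF w]]]]) (simp add: norm_cblinfun.rep_eq)
    then have "cmod (kern s (hinner z w)) * cmod (cblinfun_apply \<phi> (cblinfun_apply (b u) (bar (f w))))
        \<le> 1 / (1 - norm z) powr s * (norm (b u) * B)"
      by (intro mult_mono kern_hinner_le z w s) auto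
    then have "cmod (kern s (hinner z w)) * cmod (cblinfun_apply \<phi> (cblinfun_apply (b u) (bar (f w)))) * cmod (kern t (hinner w u))
        \<le> K * norm (b u) * cmod (kern t (hinner w u))"
      unfolding K_def by (intro mult_right_mono) (simp_all add: mult_ac)
    then show ?thesis
      unfolding Q_def norm_mult norm_kern norm_one_minus_hinner_commute[of w u] .
  qed
  \<comment> \<open>The exponent t is exactly critical for \<beta>, so the integral of the kernel
    over w grows like a logarithm in u; paired with |b| this is what the second condition on the
    symbol controls.\<close>
  obtain Cl where Cl: "0 < Cl" "\<And>u :: complex ^ 'n. norm u < 1 \<Longrightarrow>
      (\<integral>w. 1 / cmod (1 - hinner u w) powr t \<partial>?N) \<le> 1 + Cl * ln (1 / (1 - (norm u)\<^sup>2))"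
    unfolding t_def using forelli_rudin_log[OF \<beta>, where 'n = 'n] by blast
  have Qi: "integrable ?N (Q u)" if u: "norm u < 1" for u
  proof (rule integrable_ball_bounded[OF \<beta>])
    show "continuous_on (ball 0 1) (Q u)"
      using u by (intro continuous_on_compose2[OF Qc, of _ "\<lambda>w. (u, w)", simplified]) (auto intro!: continuous_intros)
    show "norm (Q u w) \<le> K * norm (b u) * (1 / (1 - norm u) powr t)" if w: "norm w < 1" for w
    proof (rule order_trans[OF Qb[OF w] mult_left_mono])
      show "1 / cmod (1 - hinner u w) powr t \<le> 1 / (1 - norm u) powr t"
        unfolding norm_kern[symmetric] by (rule kern_hinner_le[OF u w t])
      show "0 \<le> K * norm (b u)" using K by (simp add: norm_cblinfun.rep_eq)
    qed
  qed
  have Qint: "integrable (?M \<Otimes>\<^sub>M ?N) (\<lambda>(u, w). Q u w)"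
  proof (rule P.Fubini_integrable[OF Qm])
    show "AE u in ?M. integrable ?N (\<lambda>w. case (u, w) of (u, w) \<Rightarrow> Q u w)"
      using Qi by (intro AE_I2) (simp add: space_ball_measure)
    have "integrable ?M (\<lambda>u. \<integral>w. norm (Q u w) \<partial>?N)"
    proof (rule Bochner_Integration.integrable_bound)
      have "integrable ?M (\<lambda>w. norm (b w))" using b(1) by (simp add: ball_integrand_def)
      then show "integrable ?M (\<lambda>u. K * norm (b u) + K * Cl * (norm (b u) * ln (1 / (1 - (norm u)\<^sup>2))))"
        by (intro Bochner_Integration.integrable_add integrable_mult_right b(3))
      have "(\<lambda>(u, w). norm (Q u w)) \<in> borel_measurable (?M \<Otimes>\<^sub>M ?N)"
        using measurable_compose[OF Qm borel_measurable_norm] by (simp add: case_prod_beta')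
      then show "(\<lambda>u. \<integral>w. norm (Q u w) \<partial>?N) \<in> borel_measurable ?M"
        by (rule N.borel_measurable_lebesgue_integral)
      show "AE u in ?M. norm (\<integral>w. norm (Q u w) \<partial>?N) \<le> norm (K * norm (b u) + K * Cl * (norm (b u) * ln (1 / (1 - (norm u)\<^sup>2))))"
      proof (rule AE_I2)
        fix u assume "u \<in> space ?M"
        then have u: "norm u < 1" by (simp add: space_ball_measure)
        have Kb: "0 \<le> K * norm (b u)" using K by (simp add: norm_cblinfun.rep_eq)
        have "(\<integral>w. norm (Q u w) \<partial>?N) \<le> (\<integral>w. K * norm (b u) * (1 / cmod (1 - hinner u w) powr t) \<partial>?N)"
          using Qi[OF u] Qb integrable_kern_norm[OF u \<beta> t]
          by (intro integral_mono_AE AE_I2 integrable_norm integrable_mult_right) (auto simp: space_ball_measure)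
        also have "\<dots> = K * norm (b u) * (\<integral>w. 1 / cmod (1 - hinner u w) powr t \<partial>?N)"
          by (rule integral_mult_right_zero)
        also have "\<dots> \<le> K * norm (b u) * (1 + Cl * ln (1 / (1 - (norm u)\<^sup>2)))"
          by (rule mult_left_mono[OF Cl(2)[OF u] Kb])
        also have "\<dots> = K * norm (b u) + K * Cl * (norm (b u) * ln (1 / (1 - (norm u)\<^sup>2)))"
          by (simp only: distrib_left mult_1_right mult_ac)
        finally have le: "(\<integral>w. norm (Q u w) \<partial>?N) \<le> K * norm (b u) + K * Cl * (norm (b u) * ln (1 / (1 - (norm u)\<^sup>2)))" .
        have "0 \<le> (\<integral>w. norm (Q u w) \<partial>?N)"
          by (rule Bochner_Integration.integral_nonneg) simp
        with le show "norm (\<integral>w. norm (Q u w) \<partial>?N) \<le> norm (K * norm (b u) + K * Cl * (norm (b u) * ln (1 / (1 - (norm u)\<^sup>2))))"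
          by (simp only: real_norm_def)
      qed
    qed
    then show "integrable ?M (\<lambda>u. \<integral>w. norm (case (u, w) of (u, w) \<Rightarrow> Q u w) \<partial>?N)"
      by simp
  qed
  have inner_w: "(\<integral>w. Q u w \<partial>?N) = kern s (hinner z u) * cblinfun_apply \<phi> (cblinfun_apply (b u) (bar (f u)))" if u: "norm u < 1" for u
  proof -
    from conjugate_functional[of \<phi> "b u"]
    obtain \<psi> :: "('x, complex) cblinfun"
      where \<psi>': "\<forall>x. cblinfun_apply \<psi> x = cnj (cblinfun_apply \<phi> (cblinfun_apply (b u) (bar x)))"
      by (elim exE)
    note \<psi> = \<psi>'[rule_format]
    \<comment> \<open>Conjugated in this way, the w-dependence of Q becomes a holomorphic function
      times the reproducing kernel for \<beta>.\<close>
    define h where "h w = kern s (hinner w z) * cblinfun_apply \<psi> (f w)" for w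
    have "holomorphic_ball (\<lambda>w. kern s (hinner w z))"
      using kern_test_function[OF z s, of "1 :: complex"] by (simp add: Hinf_def scaleC_complex_def)
    then have hh: "holomorphic_ball h"
      unfolding h_def by (intro holomorphic_ball_mult holomorphic_ball_functional[OF fh])
    have hk: "cnj (h w * kern t (hinner u w)) = Q u w" if w: "norm w < 1" for w
      unfolding h_def Q_def complex_cnj_mult \<psi> complex_cnj_cnj cnj_kern[OF norm_hinner_less_1[OF w z]]
        cnj_kern[OF norm_hinner_less_1[OF u w]] hinner_commute[of w z, symmetric] hinner_commute[of w u]
        hinner_commute[of z w] complex_cnj_cnj ..
    have hint: "integrable ?N h"
    proof (rule integrable_ball_bounded[OF \<beta> holomorphic_ball_continuous[OF hh]])
      fix w :: "complex ^ 'n" assume w: "norm w < 1"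
      have "cmod (hinner w z) \<le> norm z"
        using hinner_le_left[OF w, of z] hinner_commute[of w z] by simp
      then have "cmod (kern s (hinner w z)) \<le> 1 / (1 - norm z) powr s"
        by (rule norm_kern_le[OF _ z s])
      moreover have "norm (cblinfun_apply \<psi> (f w)) \<le> norm \<psi> * B"
        by (rule order_trans[OF norm_cblinfun mult_left_mono[OF B(2)[OF w]]]) (simp add: norm_cblinfun.rep_eq)
      ultimately show "norm (h w) \<le> 1 / (1 - norm z) powr s * (norm \<psi> * B)"
        unfolding h_def norm_mult by (intro mult_mono) auto
    qed
    have "(\<integral>w. Q u w \<partial>?N) = (\<integral>w. cnj (h w * kern t (hinner u w)) \<partial>?N)"
      by (intro Bochner_Integration.integral_cong refl) (simp only: space_ball_measure mem_ball_0 hk)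
    also have "\<dots> = cnj (\<integral>w. h w * kern t (hinner u w) \<partial>?N)"
      by (rule integral_bounded_linear'[OF bounded_linear_cnj bounded_linear_cnj]) simp
    also have "(\<integral>w. h w * kern t (hinner u w) \<partial>?N) = h u"
      unfolding t_def by (rule reproducing[OF hh hint \<beta> u])
    also have "cnj (h u) = kern s (hinner z u) * cblinfun_apply \<phi> (cblinfun_apply (b u) (bar (f u)))"
      unfolding h_def complex_cnj_mult \<psi> complex_cnj_cnj cnj_kern[OF norm_hinner_less_1[OF u z]] hinner_commute[of z u] ..
    finally show ?thesis .
  qed
  have inner_u: "(\<integral>u. Q u w \<partial>?M) = kern s (hinner z w) * cblinfun_apply \<phi> (cblinfun_apply (frac_deriv \<alpha> (real k) b w) (bar (f w)))"
    if w: "norm w < 1" for w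
  proof -
    from evaluation_functional[of \<phi> "bar (f w)"]
    obtain \<psi> :: "(('x conj_space, 'y) cblinfun, complex) cblinfun"
      where \<psi>': "\<forall>T. cblinfun_apply \<psi> T = cblinfun_apply \<phi> (cblinfun_apply T (bar (f w)))"
      by (elim exE)
    note \<psi> = \<psi>'[rule_format]
    have "(\<integral>u. Q u w \<partial>?M) = (\<integral>u. kern s (hinner z w) * (kern t (hinner w u) * cblinfun_apply \<psi> (b u)) \<partial>?M)"
      unfolding Q_def \<psi> by (simp only: mult_ac)
    also have "\<dots> = kern s (hinner z w) * (\<integral>u. kern t (hinner w u) * cblinfun_apply \<psi> (b u) \<partial>?M)"
      by (rule integral_mult_right_zero)
    also have "(\<integral>u. kern t (hinner w u) * cblinfun_apply \<psi> (b u) \<partial>?M) = cblinfun_apply \<psi> (kern_transform \<alpha> t b w)"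
      by (rule has_bochner_integral_integral_eq[OF kern_transform_functional[OF b(1) w t]])
    also have "kern_transform \<alpha> t b w = frac_deriv \<alpha> (real k) b w"
      using frac_deriv_eq[OF b(1,2) w, of "real k"] by (simp add: t_def \<beta>_def add.assoc)
    finally show ?thesis
      unfolding \<psi> .
  qed
  have "cblinfun_apply \<phi> (hankel \<alpha> b f z) = (\<integral>u. kern s (hinner z u) * cblinfun_apply \<phi> (cblinfun_apply (b u) (bar (f u))) \<partial>?M)"
    unfolding hankel_eq_kern_transform s_def[symmetric]
    by (rule has_bochner_integral_integral_eq[OF kern_transform_functional[OF ball_integrand_hankel[OF b(1) f] z s], symmetric])
  also have "\<dots> = (\<integral>u. (\<integral>w. Q u w \<partial>?N) \<partial>?M)"
    by (intro Bochner_Integration.integral_cong refl) (simp only: space_ball_measure mem_ball_0 inner_w)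
  also have "\<dots> = (\<integral>w. (\<integral>u. Q u w \<partial>?M) \<partial>?N)"
    by (rule P.Fubini_integral[OF Qint, symmetric])
  also have "\<dots> = (\<integral>w. kern s (hinner z w) * cblinfun_apply \<phi> (cblinfun_apply (frac_deriv \<alpha> (real k) b w) (bar (f w))) \<partial>?N)"
    by (intro Bochner_Integration.integral_cong refl) (simp only: space_ball_measure mem_ball_0 inner_u)
  finally show ?thesis
    unfolding s_def \<beta>_def .
qed

text \<open>The bound L (1 - |w|^2) powr (- (k - \<gamma>)) meets the extra weight of exponent k,
  and the power \<gamma> is left with respect to the original measure. A continuous bounded majorant
  g takes the place of the weighted norm of f, so that the positive projection can be applied to
  it.\<close>

lemma hankel_pointwise_bound:
  fixes b :: "complex ^ 'n \<Rightarrow> ('x::complex_banach conj_space, 'y::complex_banach) cblinfun"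
  assumes adm: "admissible_symbol \<alpha> b" and \<alpha>: "-1 < \<alpha>" and f: "f \<in> Hinf" and z: "norm z < 1"
    and L: "0 \<le> L" "\<And>w. norm w < 1 \<Longrightarrow> norm (frac_deriv \<alpha> (real k) b w) \<le> L * (1 - (norm w)\<^sup>2) powr (- (real k - \<gamma>))"
    and g: "continuous_on (ball 0 1) g" "\<And>w. norm w < 1 \<Longrightarrow> g w \<le> B"
      "\<And>w. norm w < 1 \<Longrightarrow> L * norm (f w) * (1 - (norm w)\<^sup>2) powr \<gamma> \<le> g w"
  shows "norm (hankel \<alpha> b f z) \<le> weight_const TYPE('n) (\<alpha> + real k) / weight_const TYPE('n) \<alpha>
    * (\<integral>w. g w * (1 / cmod (1 - hinner z w) powr (real CARD('n) + 1 + \<alpha>)) \<partial>ball_measure \<alpha>)"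
proof (rule norm_le_functional)
  let ?M = "ball_measure \<alpha> :: (complex ^ 'n) measure"
  define s where "s = real CARD('n) + 1 + \<alpha>"
  define \<beta> where "\<beta> = \<alpha> + real k"
  have \<beta>: "-1 < \<beta>" "-1 < \<alpha> + real k" using \<alpha> by (simp_all add: \<beta>_def)
  have s: "0 \<le> s" using \<alpha> by (simp add: s_def)
  let ?N = "ball_measure \<beta> :: (complex ^ 'n) measure"
  define v where "v = weight_const TYPE('n) \<beta> / weight_const TYPE('n) \<alpha>"
  have wp: "0 < weight_const TYPE('n) \<alpha>" "0 < weight_const TYPE('n) \<beta>"
    by (rule weight_const_pos[OF \<alpha>], rule weight_const_pos[OF \<beta>(1)])
  have v: "0 < v" using wp by (simp add: v_def)
  define K where "K w = 1 / cmod (1 - hinner z w) powr s" for w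
  have K0: "0 \<le> K w" for w by (simp add: K_def)
  have Kc: "continuous_on (ball 0 1) K"
    unfolding K_def using z by (intro continuous_on_kern_norm) (auto intro: continuous_intros)
  have fc: "continuous_on (ball 0 1) f"
    using f by (intro holomorphic_ball_continuous) (simp add: Hinf_def)
  fix \<phi> :: "('y, complex) cblinfun"
  assume \<phi>: "\<And>y. cmod (cblinfun_apply \<phi> y) \<le> norm y"
  define F where "F w = kern s (hinner z w) * cblinfun_apply \<phi> (cblinfun_apply (frac_deriv \<alpha> (real k) b w) (bar (f w)))" for w
  define G where "G w = L * norm (f w) * (1 - (norm w)\<^sup>2) powr (- (real k - \<gamma>)) * K w" for w
  have FG: "cmod (F w) \<le> G w" if w: "norm w < 1" for w
  proof -
    have "cmod (cblinfun_apply \<phi> (cblinfun_apply (frac_deriv \<alpha> (real k) b w) (bar (f w))))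
        \<le> (L * (1 - (norm w)\<^sup>2) powr (- (real k - \<gamma>))) * norm (f w)"
      by (rule order_trans[OF \<phi> order_trans[OF norm_apply_bar_le mult_right_mono[OF L(2)[OF w] norm_ge_zero]]])
    then have "K w * cmod (cblinfun_apply \<phi> (cblinfun_apply (frac_deriv \<alpha> (real k) b w) (bar (f w))))
        \<le> K w * ((L * (1 - (norm w)\<^sup>2) powr (- (real k - \<gamma>))) * norm (f w))"
      by (rule mult_left_mono[OF _ K0])
    then show ?thesis
      unfolding F_def G_def norm_mult norm_kern K_def by (simp only: mult_ac)
  qed
  have Gm: "(\<lambda>w. ennreal (G w)) \<in> borel_measurable ?M"
    unfolding G_def
    by (intro measurable_compose[OF _ measurable_ennreal] measurable_ball_continuous continuous_on_mult
        continuous_on_const continuous_on_norm fc continuous_on_weight Kc)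
  have gi: "integrable ?M (\<lambda>w. g w * K w)"
  proof (rule integrable_ball_bounded[OF \<alpha>])
    show "continuous_on (ball 0 1) (\<lambda>w. g w * K w)"
      by (intro continuous_on_mult g(1) Kc)
    fix w :: "complex ^ 'n" assume w: "norm w < 1"
    have "0 \<le> g w"
      by (rule order_trans[OF _ g(3)[OF w]]) (use L(1) in simp)
    moreover have "K w \<le> 1 / (1 - norm z) powr s"
      unfolding K_def norm_kern[symmetric] by (rule kern_hinner_le[OF z w s])
    ultimately have "g w * K w \<le> B * (1 / (1 - norm z) powr s)"
      using g(2)[OF w] K0 by (intro mult_mono) auto
    then show "norm (g w * K w) \<le> B * (1 / (1 - norm z) powr s)"
      using \<open>0 \<le> g w\<close> K0[of w] by simp
  qed
  have gp: "ennreal (G w) * ennreal ((1 - (norm w)\<^sup>2) powr real k) \<le> ennreal (g w * K w)" if w: "norm w < 1" for w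
  proof -
    have "(1 - (norm w)\<^sup>2) powr (- (real k - \<gamma>)) * (1 - (norm w)\<^sup>2) powr real k = (1 - (norm w)\<^sup>2) powr \<gamma>"
      by (simp add: powr_add[symmetric])
    then have "G w * (1 - (norm w)\<^sup>2) powr real k = L * norm (f w) * (1 - (norm w)\<^sup>2) powr \<gamma> * K w"
      unfolding G_def by (metis (no_types, lifting) mult.assoc mult.commute)
    also have "\<dots> \<le> g w * K w"
      by (rule mult_right_mono[OF g(3)[OF w] K0])
    finally show ?thesis
      using L(1) K0 by (simp add: G_def ennreal_mult[symmetric] ennreal_leI)
  qed
  have shift: "(\<integral>\<^sup>+w. ennreal (G w) * ennreal ((1 - (norm w)\<^sup>2) powr real k) \<partial>?M) = ennreal (1 / v) * (\<integral>\<^sup>+w. ennreal (G w) \<partial>?N)"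
    unfolding \<beta>_def v_def using nn_integral_ball_measure_shift[OF Gm \<alpha> \<beta>(2)] by simp
  have "ennreal (1 / v) * (\<integral>\<^sup>+w. ennreal (G w) \<partial>?N) \<le> (\<integral>\<^sup>+w. ennreal (g w * K w) \<partial>?M)"
    unfolding shift[symmetric] using gp by (intro nn_integral_mono) (simp add: space_ball_measure)
  also have "\<dots> = ennreal (\<integral>w. g w * K w \<partial>?M)"
    using K0 L(1) by (intro nn_integral_eq_integral gi AE_I2)
      (auto simp: space_ball_measure intro!: mult_nonneg_nonneg order_trans[OF _ g(3)])
  finally have "ennreal v * (ennreal (1 / v) * (\<integral>\<^sup>+w. ennreal (G w) \<partial>?N)) \<le> ennreal v * ennreal (\<integral>w. g w * K w \<partial>?M)"
    by (rule mult_left_mono) simp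
  then have GN: "(\<integral>\<^sup>+w. ennreal (G w) \<partial>?N) \<le> ennreal (v * (\<integral>w. g w * K w \<partial>?M))"
    using v by (simp add: mult.assoc[symmetric] ennreal_mult'[symmetric])
  have I0: "0 \<le> (\<integral>w. g w * K w \<partial>?M)"
    using K0 L(1) by (intro integral_nonneg_AE AE_I2)
      (auto simp: space_ball_measure intro!: mult_nonneg_nonneg order_trans[OF _ g(3)])
  have "cmod (\<integral>w. F w \<partial>?N) \<le> v * (\<integral>w. g w * K w \<partial>?M)"
  \<comment> \<open>Otherwise the integral has the default value 0 and the estimate is trivial;
    integrability of F, and thus measurability of the fractional derivative, need not be
    established.\<close>
  proof (cases "integrable ?N F")
    case True
    have "ennreal (cmod (\<integral>w. F w \<partial>?N)) \<le> (\<integral>\<^sup>+w. ennreal (cmod (F w)) \<partial>?N)"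
      by (rule integral_norm_bound_ennreal[OF True])
    also have "\<dots> \<le> (\<integral>\<^sup>+w. ennreal (G w) \<partial>?N)"
      using FG by (intro nn_integral_mono ennreal_leI) (simp add: space_ball_measure)
    also note GN
    finally show ?thesis
      using v I0 by (subst (asm) ennreal_le_iff) auto
  next
    case False
    then show ?thesis
      using v I0 by (simp add: not_integrable_integral_eq)
  qed
  then show "cmod (cblinfun_apply \<phi> (hankel \<alpha> b f z)) \<le> weight_const TYPE('n) (\<alpha> + real k) / weight_const TYPE('n) \<alpha>
    * (\<integral>w. g w * (1 / cmod (1 - hinner z w) powr (real CARD('n) + 1 + \<alpha>)) \<partial>ball_measure \<alpha>)"
    unfolding hankel_functional_frac_deriv[OF adm \<alpha> f z \<phi>, of k] F_def K_def s_def v_def \<beta>_def .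
qed

text \<open>The norm of f is split as its powers \<theta> = 1 - p/q and p/q. Point evaluation bounds
  the first by a power - s \<theta> / p = - \<gamma> of 1 - |w|^2, exactly compensating the weight
  of exponent \<gamma>; the second has its q-th power integrable with integral the p-norm to the
  power p.\<close>

lemma frac_deriv_bound_imp_hankel_bound:
  fixes \<alpha> p q \<gamma> :: real
  assumes \<alpha>: "-1 < \<alpha>" and p: "1 < p" and pq: "p \<le> q"
    and \<gamma>: "\<gamma> = (real CARD('n::finite) + 1 + \<alpha>) * (1 / p - 1 / q)"
  shows "\<exists>C>0. \<forall>(b :: complex ^ 'n \<Rightarrow> ('x::complex_banach conj_space, 'y::complex_banach) cblinfun) L.
    admissible_symbol \<alpha> b \<longrightarrow> 0 \<le> L \<longrightarrow>
    (\<forall>z. norm z < 1 \<longrightarrow> norm (frac_deriv \<alpha> (real k) b z) \<le> L * (1 - (norm z)\<^sup>2) powr (- (real k - \<gamma>))) \<longrightarrow>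
    hankel_bound \<alpha> p q b (C * L)"
proof -
  let ?M = "ball_measure \<alpha> :: (complex ^ 'n) measure"
  define s where "s = real CARD('n) + 1 + \<alpha>"
  have s: "0 < s" using \<alpha> by (simp add: s_def)
  have q: "1 < q" using p pq by simp
  define \<theta> where "\<theta> = 1 - p / q"
  have \<theta>: "0 \<le> \<theta>" using p pq by (simp add: \<theta>_def)
  have \<gamma>\<theta>: "s / p * \<theta> = \<gamma>"
    using p q by (simp add: \<theta>_def \<gamma> s_def field_simps)
  obtain C2 where C2: "0 < C2" "\<And>(g :: complex ^ 'n \<Rightarrow> 'x) z. g \<in> bergman p \<alpha> \<Longrightarrow> norm z < 1 \<Longrightarrow>
      norm (g z) \<le> C2 * (1 - (norm z)\<^sup>2) powr (- (s / p)) * bergman_norm p \<alpha> g"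
    unfolding s_def using bergman_point_evaluation[OF \<alpha> p, where 'n = 'n and 'b = 'x] by blast
  obtain C3 where C3: "0 < C3" "\<And>(G :: complex ^ 'n \<Rightarrow> real) B. continuous_on (ball 0 1) G \<Longrightarrow> (\<And>w. 0 \<le> G w) \<Longrightarrow>
      (\<And>w. norm w < 1 \<Longrightarrow> G w \<le> B) \<Longrightarrow>
      (\<integral>\<^sup>+z. ennreal ((\<integral>w. G w * (1 / cmod (1 - hinner z w) powr (real CARD('n) + 1 + \<alpha>)) \<partial>?M) powr q) \<partial>?M)
      \<le> ennreal C3 * (\<integral>\<^sup>+w. ennreal (G w powr q) \<partial>?M)"
    using positive_bergman_projection_bounded[OF \<alpha> q, where 'n = 'n] by blast
  define v where "v = weight_const TYPE('n) (\<alpha> + real k) / weight_const TYPE('n) \<alpha>"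
  have \<beta>: "-1 < \<alpha> + real k" using \<alpha> by simp
  have wp: "0 < weight_const TYPE('n) \<alpha>" "0 < weight_const TYPE('n) (\<alpha> + real k)"
    by (rule weight_const_pos[OF \<alpha>], rule weight_const_pos[OF \<beta>])
  have v: "0 < v" using wp by (simp add: v_def)
  define C where "C = v * C2 powr \<theta> * C3 powr (1 / q)"
  have C: "0 < C" using v C2(1) C3(1) by (simp add: C_def)
  show ?thesis
  proof (intro exI[of _ C] conjI allI impI)
    show "0 < C" by (rule C)
    fix b :: "complex ^ 'n \<Rightarrow> ('x conj_space, 'y) cblinfun" and L
    assume adm: "admissible_symbol \<alpha> b" and L: "0 \<le> L"
      and bound: "\<forall>z. norm z < 1 \<longrightarrow> norm (frac_deriv \<alpha> (real k) b z) \<le> L * (1 - (norm z)\<^sup>2) powr (- (real k - \<gamma>))"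
    note b = admissible_symbolD[OF adm \<alpha>]
    show "hankel_bound \<alpha> p q b (C * L)"
      unfolding hankel_bound_def
    proof (intro conjI ballI)
      show "0 \<le> C * L" using C L by simp
      fix f :: "complex ^ 'n \<Rightarrow> 'x" assume f: "f \<in> Hinf"
      from Hinf_bounded[OF f] obtain B where B': "0 \<le> B" "\<forall>w. norm w < 1 \<longrightarrow> norm (f w) \<le> B"
        by (elim exE conjE)
      note B = B'(1) B'(2)[rule_format]
      have fh: "holomorphic_ball f" using f by (simp add: Hinf_def)
      have fc: "continuous_on (ball 0 1) (\<lambda>w. norm (f w))"
        by (intro continuous_on_norm holomorphic_ball_continuous[OF fh])
      have fp: "continuous_on (ball 0 1) (\<lambda>w. norm (f w) powr e)" if "0 < e" for e
        using that by (intro continuous_on_powr' fc continuous_on_const) auto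
      have fpi: "integrable ?M (\<lambda>w. norm (f w) powr p)"
        using p B by (intro integrable_ball_bounded[OF \<alpha> fp, where B = "B powr p"]) (auto intro: powr_mono2)
      then have fb: "f \<in> bergman p \<alpha>" using fh by (simp add: bergman_def)
      define I where "I = (\<integral>w. norm (f w) powr p \<partial>?M)"
      have I: "0 \<le> I" by (simp add: I_def)
      have N: "bergman_norm p \<alpha> f = I powr (1 / p)" by (simp add: bergman_norm_def I_def)
      \<comment> \<open>The factor left over from point evaluation to the power \<theta>; it depends
        on f only through its p-norm.\<close>
      define A where "A = L * (C2 powr \<theta> * (I powr (1 / p)) powr \<theta>)"
      have A: "0 \<le> A" using L by (simp add: A_def)
      define G where "G w = A * norm (f w) powr (p / q)" for w
      have pq0: "0 < p / q" using p q by simp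
      have Gc: "continuous_on (ball 0 1) G"
        unfolding G_def by (intro continuous_on_mult continuous_on_const fp pq0)
      have G0: "0 \<le> G w" for w using A by (simp add: G_def)
      have GB: "G w \<le> A * B powr (p / q)" if "norm w < 1" for w
        unfolding G_def using A B(2)[OF that] pq0 by (intro mult_left_mono powr_mono2) auto
      have Gle: "L * norm (f w) * (1 - (norm w)\<^sup>2) powr \<gamma> \<le> G w" if w: "norm w < 1" for w
      proof -
        define R where "R = 1 - (norm w)\<^sup>2"
        have R: "0 < R" using norm_sq_less_1[OF w] by (simp add: R_def)
        have "norm (f w) \<le> C2 * R powr (- (s / p)) * I powr (1 / p)"
          using C2(2)[OF fb w] by (simp only: N R_def)
        then have "norm (f w) powr \<theta> \<le> (C2 * R powr (- (s / p)) * I powr (1 / p)) powr \<theta>"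
          by (intro powr_mono2 \<theta>) auto
        also have "\<dots> = C2 powr \<theta> * (I powr (1 / p)) powr \<theta> * R powr (- \<gamma>)"
        proof -
          have "(R powr (- (s / p))) powr \<theta> = R powr (- \<gamma>)"
            unfolding powr_powr \<gamma>\<theta>[symmetric] by simp
          then show ?thesis
            using C2(1) by (simp add: powr_mult mult_ac)
        qed
        finally have 1: "norm (f w) powr \<theta> \<le> C2 powr \<theta> * (I powr (1 / p)) powr \<theta> * R powr (- \<gamma>)" .
        have "norm (f w) = norm (f w) powr \<theta> * norm (f w) powr (p / q)"
          by (simp add: powr_add[symmetric] \<theta>_def)
        also have "\<dots> \<le> C2 powr \<theta> * (I powr (1 / p)) powr \<theta> * R powr (- \<gamma>) * norm (f w) powr (p / q)"
          by (rule mult_right_mono[OF 1]) simp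
        finally have 2: "norm (f w) \<le> C2 powr \<theta> * (I powr (1 / p)) powr \<theta> * R powr (- \<gamma>) * norm (f w) powr (p / q)" .
        have "norm (f w) * (L * R powr \<gamma>)
            \<le> C2 powr \<theta> * (I powr (1 / p)) powr \<theta> * R powr (- \<gamma>) * norm (f w) powr (p / q) * (L * R powr \<gamma>)"
          by (rule mult_right_mono[OF 2]) (use L in simp)
        also have "\<dots> = (R powr (- \<gamma>) * R powr \<gamma>) * G w"
          by (simp only: G_def A_def mult_ac)
        also have "R powr (- \<gamma>) * R powr \<gamma> = 1"
          using R by (simp add: powr_add[symmetric])
        finally show ?thesis
          by (simp only: R_def mult_ac mult_1_left)
      qed
      define h where "h = hankel \<alpha> b f"
      have hh: "holomorphic_ball h"
        unfolding h_def hankel_eq_kern_transform using s unfolding s_def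
        by (intro holomorphic_kern_transform ball_integrand_hankel[OF b(1) f]) simp
      define T where "T z = (\<integral>w. G w * (1 / cmod (1 - hinner z w) powr (real CARD('n) + 1 + \<alpha>)) \<partial>?M)" for z
      have T0: "0 \<le> T z" for z
        unfolding T_def using G0 by (intro Bochner_Integration.integral_nonneg) simp
      have hT: "norm (h z) \<le> v * T z" if z: "norm z < 1" for z
        unfolding h_def v_def T_def
        by (rule hankel_pointwise_bound[OF adm \<alpha> f z L bound[rule_format] Gc GB Gle])
      have Gq: "G w powr q = A powr q * norm (f w) powr p" for w
        using A q by (simp add: G_def powr_mult powr_powr)
      have nn: "(\<integral>\<^sup>+z. ennreal (norm (h z) powr q) \<partial>?M) \<le> ennreal (v powr q * C3 * (A powr q * I))"
      proof -
        have vG: "continuous_on (ball 0 1) (\<lambda>w. v * G w)" "0 \<le> v * G w" for w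
          using Gc G0 v by (auto intro!: continuous_on_mult continuous_on_const)
        have vB: "v * G w \<le> v * (A * B powr (p / q))" if "norm w < 1" for w
          using GB[OF that] v by simp
        have vT: "v * T z = (\<integral>w. v * G w * (1 / cmod (1 - hinner z w) powr (real CARD('n) + 1 + \<alpha>)) \<partial>?M)" for z
          unfolding T_def mult.assoc by (rule integral_mult_right_zero[symmetric])
        have "(\<integral>\<^sup>+z. ennreal (norm (h z) powr q) \<partial>?M) \<le> (\<integral>\<^sup>+z. ennreal ((v * T z) powr q) \<partial>?M)"
          using hT q by (intro nn_integral_mono ennreal_leI powr_mono2) (auto simp: space_ball_measure)
        also have "\<dots> \<le> ennreal C3 * (\<integral>\<^sup>+w. ennreal ((v * G w) powr q) \<partial>?M)"
          unfolding vT by (rule C3(2)[OF vG vB])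
        also have "(\<integral>\<^sup>+w. ennreal ((v * G w) powr q) \<partial>?M) = (\<integral>\<^sup>+w. ennreal (v powr q * A powr q * norm (f w) powr p) \<partial>?M)"
          using v G0 by (intro nn_integral_cong) (simp add: powr_mult Gq)
        also have "\<dots> = ennreal (v powr q * A powr q * I)"
          unfolding I_def integral_mult_right_zero[symmetric]
          by (intro nn_integral_eq_integral integrable_mult_right fpi) auto
        also have "ennreal C3 * ennreal (v powr q * A powr q * I) = ennreal (v powr q * C3 * (A powr q * I))"
          using C3(1) I by (simp add: ennreal_mult[symmetric] mult_ac)
        finally show ?thesis .
      qed
      have hi: "integrable ?M (\<lambda>z. norm (h z) powr q)"
      proof (rule integrableI_bounded)
        show "(\<lambda>z. norm (h z) powr q) \<in> borel_measurable ?M"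
          using q by (intro measurable_ball_continuous continuous_on_powr' continuous_on_norm
              holomorphic_ball_continuous[OF hh] continuous_on_const) auto
        show "(\<integral>\<^sup>+z. ennreal (norm (norm (h z) powr q)) \<partial>?M) < \<infinity>"
          using nn by (simp add: le_less_trans)
      qed
      show "hankel \<alpha> b f \<in> bergman q \<alpha>"
        using hh hi by (simp add: bergman_def h_def)
      have "ennreal (\<integral>z. norm (h z) powr q \<partial>?M) \<le> ennreal (v powr q * C3 * (A powr q * I))"
        using nn by (subst nn_integral_eq_integral[OF hi, symmetric]) auto
      then have "(\<integral>z. norm (h z) powr q \<partial>?M) \<le> v powr q * C3 * (A powr q * I)"
        using I C3(1) by (subst (asm) ennreal_le_iff) auto
      then have "bergman_norm q \<alpha> h \<le> (v powr q * C3 * (A powr q * I)) powr (1 / q)"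
        unfolding bergman_norm_def using q by (intro powr_mono2) auto
      also have "\<dots> = v * C3 powr (1 / q) * (A * I powr (1 / q))"
        using v C3(1) A I q by (simp add: powr_mult powr_powr)
      also have "\<dots> = C * L * ((I powr (1 / p)) powr \<theta> * I powr (1 / q))"
        by (simp only: C_def A_def mult_ac)
      \<comment> \<open>The homogeneity check: \<theta> / p + 1 / q = 1 / p, so the split recombines
        to the first power of the norm of f.\<close>
      also have "(I powr (1 / p)) powr \<theta> * I powr (1 / q) = I powr (1 / p)"
      proof -
        have "1 / p * \<theta> + 1 / q = 1 / p"
          using p q by (simp add: \<theta>_def field_simps)
        then show ?thesis
          by (simp only: powr_powr powr_add[symmetric])
      qed
      finally show "bergman_norm q \<alpha> (hankel \<alpha> b f) \<le> C * L * bergman_norm p \<alpha> f"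
        by (simp only: h_def N)
    qed
  qed
qed

section \<open>Assembling the equivalence\<close>

lemma lipschitz_norm_le_iff:
  fixes b :: "complex ^ 'n \<Rightarrow> 'a::complex_normed_vector"
  assumes "0 \<le> L"
  shows "lipschitz_norm \<alpha> \<gamma> k b \<le> ennreal L \<longleftrightarrow>
    (\<forall>z. norm z < 1 \<longrightarrow> norm (frac_deriv \<alpha> (real k) b z) \<le> L * (1 - (norm z)\<^sup>2) powr (- (real k - \<gamma>)))"
proof -
  have *: "ennreal ((1 - (norm z)\<^sup>2) powr (real k - \<gamma>) * x) \<le> ennreal L \<longleftrightarrow> x \<le> L * (1 - (norm z)\<^sup>2) powr (- (real k - \<gamma>))"
    if z: "norm z < 1" for x and z :: "complex ^ 'n"
  proof -
    have "0 < (1 - (norm z)\<^sup>2) powr (real k - \<gamma>)"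
      using norm_sq_less_1[OF z] by simp
    then show ?thesis
      using assms unfolding powr_minus[of _ "real k - \<gamma>"] ennreal_le_iff[OF assms] by (simp add: field_simps)
  qed
  show ?thesis
    unfolding lipschitz_norm_def SUP_le_iff Ball_def mem_ball_0
  proof (intro iffI allI impI)
    fix z :: "complex ^ 'n" assume z: "norm z < 1"
    show "norm (frac_deriv \<alpha> (real k) b z) \<le> L * (1 - (norm z)\<^sup>2) powr (- (real k - \<gamma>))"
      if "\<forall>z. norm z < 1 \<longrightarrow> ennreal ((1 - (norm z)\<^sup>2) powr (real k - \<gamma>) * norm (frac_deriv \<alpha> (real k) b z)) \<le> ennreal L"
      by (rule iffD1[OF *[OF z] that[rule_format, OF z]])
    show "ennreal ((1 - (norm z)\<^sup>2) powr (real k - \<gamma>) * norm (frac_deriv \<alpha> (real k) b z)) \<le> ennreal L"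
      if "\<forall>z. norm z < 1 \<longrightarrow> norm (frac_deriv \<alpha> (real k) b z) \<le> L * (1 - (norm z)\<^sup>2) powr (- (real k - \<gamma>))"
      by (rule iffD2[OF *[OF z] that[rule_format, OF z]])
  qed
qed

theorem theorem7:
  fixes \<alpha> p q \<gamma>\<^sub>0 :: real
  assumes "\<alpha> > -1" and "1 < p" and "p \<le> q"
    and "\<gamma>\<^sub>0 = (real CARD('n::finite) + 1 + \<alpha>) * (1 / p - 1 / q)"
  shows "(\<forall>b :: complex ^ 'n \<Rightarrow> ('x::complex_banach conj_space, 'y::complex_banach) cblinfun.
            admissible_symbol \<alpha> b \<longrightarrow>
              (hankel_bounded \<alpha> p q b \<longleftrightarrow> b \<in> lipschitz_space \<alpha> \<gamma>\<^sub>0))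
       \<and> (\<forall>k::nat. real k > \<gamma>\<^sub>0 \<longrightarrow>
            (\<exists>c>0. \<exists>c'>0. \<forall>b :: complex ^ 'n \<Rightarrow> ('x conj_space, 'y) cblinfun.
               admissible_symbol \<alpha> b \<longrightarrow> hankel_bounded \<alpha> p q b \<longrightarrow>
                 ennreal (hankel_norm \<alpha> p q b) \<le> ennreal c * lipschitz_norm \<alpha> \<gamma>\<^sub>0 k b \<and>
                 lipschitz_norm \<alpha> \<gamma>\<^sub>0 k b \<le> ennreal c' * ennreal (hankel_norm \<alpha> p q b)))"
proof -
  have sufficient: "\<exists>C>0. \<forall>(b :: complex ^ 'n \<Rightarrow> ('x conj_space, 'y) cblinfun) L.
      admissible_symbol \<alpha> b \<longrightarrow> 0 \<le> L \<longrightarrow> lipschitz_norm \<alpha> \<gamma>\<^sub>0 k b \<le> ennreal L \<longrightarrow> hankel_bound \<alpha> p q b (C * L)" for k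
  proof -
    from frac_deriv_bound_imp_hankel_bound[OF assms, of k, where 'x = 'x and 'y = 'y]
    obtain C where C: "0 < C" "\<forall>(b :: complex ^ 'n \<Rightarrow> ('x conj_space, 'y) cblinfun) L.
      admissible_symbol \<alpha> b \<longrightarrow> 0 \<le> L \<longrightarrow>
      (\<forall>z. norm z < 1 \<longrightarrow> norm (frac_deriv \<alpha> (real k) b z) \<le> L * (1 - (norm z)\<^sup>2) powr (- (real k - \<gamma>\<^sub>0))) \<longrightarrow>
      hankel_bound \<alpha> p q b (C * L)"
      by (elim exE conjE)
    show ?thesis
    proof (intro exI[of _ C] conjI C(1) allI impI)
      fix b :: "complex ^ 'n \<Rightarrow> ('x conj_space, 'y) cblinfun" and L
      assume b: "admissible_symbol \<alpha> b" "0 \<le> L" "lipschitz_norm \<alpha> \<gamma>\<^sub>0 k b \<le> ennreal L"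
      show "hankel_bound \<alpha> p q b (C * L)"
        by (rule C(2)[THEN spec, THEN spec, THEN mp, THEN mp, THEN mp, OF b(1,2) iffD1[OF lipschitz_norm_le_iff[OF b(2)] b(3)]])
    qed
  qed
  have necessary: "\<exists>C>0. \<forall>(b :: complex ^ 'n \<Rightarrow> ('x conj_space, 'y) cblinfun) C0.
      admissible_symbol \<alpha> b \<longrightarrow> hankel_bound \<alpha> p q b C0 \<longrightarrow> lipschitz_norm \<alpha> \<gamma>\<^sub>0 k b \<le> ennreal (C * C0)"
    if "\<gamma>\<^sub>0 < real k" for k
  proof -
    from hankel_bound_imp_frac_deriv_bound[OF assms that, where 'x = 'x and 'y = 'y]
    obtain C where C: "0 < C" "\<forall>(b :: complex ^ 'n \<Rightarrow> ('x conj_space, 'y) cblinfun) C0.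
      admissible_symbol \<alpha> b \<longrightarrow> hankel_bound \<alpha> p q b C0 \<longrightarrow>
      (\<forall>z. norm z < 1 \<longrightarrow> norm (frac_deriv \<alpha> (real k) b z) \<le> C * C0 * (1 - (norm z)\<^sup>2) powr (- (real k - \<gamma>\<^sub>0)))"
      by (elim exE conjE)
    show ?thesis
    proof (intro exI[of _ C] conjI C(1) allI impI)
      fix b :: "complex ^ 'n \<Rightarrow> ('x conj_space, 'y) cblinfun" and C0
      assume b: "admissible_symbol \<alpha> b" "hankel_bound \<alpha> p q b C0"
      then have "0 \<le> C * C0"
        using C(1) by (simp add: hankel_bound_def)
      from iffD2[OF lipschitz_norm_le_iff[OF this] C(2)[THEN spec, THEN spec, THEN mp, THEN mp, OF b]]
      show "lipschitz_norm \<alpha> \<gamma>\<^sub>0 k b \<le> ennreal (C * C0)" .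
    qed
  qed
  show ?thesis
  proof (intro conjI allI impI)
    fix b :: "complex ^ 'n \<Rightarrow> ('x conj_space, 'y) cblinfun"
    assume b: "admissible_symbol \<alpha> b"
    show "hankel_bounded \<alpha> p q b \<longleftrightarrow> b \<in> lipschitz_space \<alpha> \<gamma>\<^sub>0"
    proof
      assume "hankel_bounded \<alpha> p q b"
      then obtain C0 where C0: "hankel_bound \<alpha> p q b C0"
        unfolding hankel_bounded_def by (elim exE)
      \<comment> \<open>Membership in the Lipschitz space asks for some order above the smoothness
        index; any integer above it serves, because the necessity bound is available for all of
        them.\<close>
      obtain k :: nat where k: "\<gamma>\<^sub>0 < real k"
        using reals_Archimedean2[of "\<gamma>\<^sub>0"] by (elim exE)
      from necessary[OF k] obtain C where C: "\<forall>(b :: complex ^ 'n \<Rightarrow> ('x conj_space, 'y) cblinfun) C0.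
          admissible_symbol \<alpha> b \<longrightarrow> hankel_bound \<alpha> p q b C0 \<longrightarrow> lipschitz_norm \<alpha> \<gamma>\<^sub>0 k b \<le> ennreal (C * C0)"
        by (elim exE conjE)
      have "lipschitz_norm \<alpha> \<gamma>\<^sub>0 k b \<le> ennreal (C * C0)"
        by (rule C[rule_format, OF b C0])
      then have "lipschitz_norm \<alpha> \<gamma>\<^sub>0 k b < \<infinity>"
        by (rule le_less_trans) simp
      then show "b \<in> lipschitz_space \<alpha> \<gamma>\<^sub>0"
        using admissible_symbolD(2)[OF b assms(1)] k unfolding lipschitz_space_def mem_Collect_eq
        by (intro conjI exI[of _ k])
    next
      assume "b \<in> lipschitz_space \<alpha> \<gamma>\<^sub>0"
      then obtain k :: nat where k: "lipschitz_norm \<alpha> \<gamma>\<^sub>0 k b < \<infinity>"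
        unfolding lipschitz_space_def mem_Collect_eq by (elim exE conjE)
      define L where "L = enn2real (lipschitz_norm \<alpha> \<gamma>\<^sub>0 k b)"
      have L: "0 \<le> L" "lipschitz_norm \<alpha> \<gamma>\<^sub>0 k b \<le> ennreal L"
        using k by (simp_all add: L_def)
      from sufficient[of k] obtain C where C: "\<forall>(b :: complex ^ 'n \<Rightarrow> ('x conj_space, 'y) cblinfun) L.
          admissible_symbol \<alpha> b \<longrightarrow> 0 \<le> L \<longrightarrow> lipschitz_norm \<alpha> \<gamma>\<^sub>0 k b \<le> ennreal L \<longrightarrow> hankel_bound \<alpha> p q b (C * L)"
        by (elim exE conjE)
      have "hankel_bound \<alpha> p q b (C * L)"
        by (rule C[rule_format, OF b L])
      then show "hankel_bounded \<alpha> p q b"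
        unfolding hankel_bounded_def by (rule exI)
    qed
  next
    fix k :: nat assume k: "\<gamma>\<^sub>0 < real k"
    from sufficient[of k] obtain c where c: "0 < c" "\<forall>(b :: complex ^ 'n \<Rightarrow> ('x conj_space, 'y) cblinfun) L.
        admissible_symbol \<alpha> b \<longrightarrow> 0 \<le> L \<longrightarrow> lipschitz_norm \<alpha> \<gamma>\<^sub>0 k b \<le> ennreal L \<longrightarrow> hankel_bound \<alpha> p q b (c * L)"
      by (elim exE conjE)
    from necessary[OF k] obtain c' where c': "0 < c'" "\<forall>(b :: complex ^ 'n \<Rightarrow> ('x conj_space, 'y) cblinfun) C0.
        admissible_symbol \<alpha> b \<longrightarrow> hankel_bound \<alpha> p q b C0 \<longrightarrow> lipschitz_norm \<alpha> \<gamma>\<^sub>0 k b \<le> ennreal (c' * C0)"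
      by (elim exE conjE)
    show "\<exists>c>0. \<exists>c'>0. \<forall>b :: complex ^ 'n \<Rightarrow> ('x conj_space, 'y) cblinfun.
        admissible_symbol \<alpha> b \<longrightarrow> hankel_bounded \<alpha> p q b \<longrightarrow>
          ennreal (hankel_norm \<alpha> p q b) \<le> ennreal c * lipschitz_norm \<alpha> \<gamma>\<^sub>0 k b \<and>
          lipschitz_norm \<alpha> \<gamma>\<^sub>0 k b \<le> ennreal c' * ennreal (hankel_norm \<alpha> p q b)"
    proof (rule exI[of _ c], rule conjI[OF c(1)], rule exI[of _ c'], rule conjI[OF c'(1)], intro allI impI)
      fix b :: "complex ^ 'n \<Rightarrow> ('x conj_space, 'y) cblinfun"
      assume b: "admissible_symbol \<alpha> b" and "hankel_bounded \<alpha> p q b"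
      then obtain C0 where C0: "hankel_bound \<alpha> p q b C0"
        unfolding hankel_bounded_def by (elim exE)
      have nec: "lipschitz_norm \<alpha> \<gamma>\<^sub>0 k b \<le> ennreal (c' * D)" if "hankel_bound \<alpha> p q b D" for D
        by (rule c'(2)[rule_format, OF b that])
      define L where "L = enn2real (lipschitz_norm \<alpha> \<gamma>\<^sub>0 k b)"
      have "lipschitz_norm \<alpha> \<gamma>\<^sub>0 k b < \<infinity>"
        by (rule le_less_trans[OF nec[OF C0]]) simp
      then have L: "0 \<le> L" "lipschitz_norm \<alpha> \<gamma>\<^sub>0 k b = ennreal L"
        by (simp_all add: L_def)
      \<comment> \<open>Bounds of the operator are nonnegative by definition, so the infimum is at
        most the particular bound c L supplied by sufficiency.\<close>
      have bdd: "bdd_below {C. hankel_bound \<alpha> p q b C}"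
        by (rule bdd_belowI[of _ 0]) (simp add: hankel_bound_def)
      have "hankel_bound \<alpha> p q b (c * L)"
        by (rule c(2)[rule_format, OF b L(1)]) (simp add: L(2))
      then have "hankel_norm \<alpha> p q b \<le> c * L"
        unfolding hankel_norm_def by (intro cInf_lower bdd) simp
      then have 1: "ennreal (hankel_norm \<alpha> p q b) \<le> ennreal c * lipschitz_norm \<alpha> \<gamma>\<^sub>0 k b"
        unfolding L(2) using c(1) L(1) by (simp add: ennreal_mult[symmetric] ennreal_leI)
      \<comment> \<open>The reverse estimate holds for every bound D with the same c', hence it
        passes to the infimum; \<open>C0\<close> shows that the set of bounds is nonempty.\<close>
      have "L / c' \<le> D" if D: "hankel_bound \<alpha> p q b D" for D
      proof -
        have "0 \<le> c' * D"
          using c'(1) D by (simp add: hankel_bound_def)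
        then have "L \<le> c' * D"
          using nec[OF D] unfolding L(2) by (simp only: ennreal_le_iff)
        then show ?thesis
          using c'(1) by (simp add: divide_le_eq mult.commute)
      qed
      then have "L / c' \<le> hankel_norm \<alpha> p q b"
        unfolding hankel_norm_def using C0 by (intro cInf_greatest) auto
      then have "L \<le> c' * hankel_norm \<alpha> p q b"
        using c'(1) by (simp add: divide_le_eq mult.commute)
      then have "lipschitz_norm \<alpha> \<gamma>\<^sub>0 k b \<le> ennreal c' * ennreal (hankel_norm \<alpha> p q b)"
        unfolding L(2) using c'(1) by (simp add: ennreal_mult'[symmetric] ennreal_leI)
      with 1 show "ennreal (hankel_norm \<alpha> p q b) \<le> ennreal c * lipschitz_norm \<alpha> \<gamma>\<^sub>0 k b \<and>
          lipschitz_norm \<alpha> \<gamma>\<^sub>0 k b \<le> ennreal c' * ennreal (hankel_norm \<alpha> p q b)"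
        by (rule conjI)
    qed
  qed
qed

end
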